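(* Let $p,q,r\in[1,\infty)$, let $g\in L^1(G,L^{p,q}_{\mathcal{D}}(E))$, and let $$\mathfrak{L}\colon L^{p,q}_{\mathcal{D}}(E)\to \mathcal{L}^r_{\mathcal{P}'}(\mathbb{T})$$ be a linear and continuous operator. Then there exist measurable functions $$X_1\colon (D\times G,\mathcal{D}\otimes\mathcal{G})\to E,\qquad X_2\colon(\Omega_T\times G,(\mathcal{F}_T\otimes\mathcal{B}_T)\otimes\mathcal{G})\to F$$ such that: (a) $X_1(x,\cdot)\in L^1(G,E)$ for all $x\in D$, and $X_2((\omega,t),\cdot)\in L^1(G,F)$ for all $(\omega,t)\in\Omega_T$; (b) the map $D\to L^1(G,E)$, $x\mapsto X_1(x,\cdot)$, belongs to $L^{p,q}_{\mathcal{D}}(L^1(G,E))$; (c) the map $(\Omega_T,\mathcal{P}')\to L^1(G,F)$, $(\omega,t)\mapsto X_2((\omega,t),\cdot)$, is measurable; (d) $X_1(\cdot,y)\in L^{p,q}_{\mathcal{D}}(E)$ for all $y\in G$; (e) the map $G\to L^{p,q}_{\mathcal{D}}(E)$, $y\mapsto X_1(\cdot,y)$, belongs to $L^1(G,L^{p,q}_{\mathcal{D}}(E))$; (f) $X_1(\cdot,y)=g(y)$ in $L^{p,q}_{\mathcal{D}}(E)$ for $\mu$-a.e. $y\in G$; (g) $X_2(\cdot,y)\in\mathcal{L}^r_{\mathcal{P}'}(\mathbb{T})$ for all $y\in G$; (h) $X_2(\cdot,y)=\mathfrak{L}g(y)$ in $\mathcal{L}^r_{\mathcal{P}'}(\mathbb{T})$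 for $\mu$-a.e. $y\in G$; (i) for $\mathbb{P}$-a.e. $\omega\in\Omega$, $$(\mathfrak{L}Y)(\omega,t)=\int_G X_2((\omega,t),y)\,\mu(dy)\qquad\forall t\in[0,T],$$ where $Y(x):=\int_G X_1(x,y)\,\mu(dy)$ for all $x\in D$.
   Context: $(G,\mathcal{G},\mu)$ and $(D_2,\mathcal{D}_2,\nu_2)$ are positive finite measure spaces, $(D_1,\mathcal{D}_1)$ is a measurable space, and $\nu_1\colon\mathcal{D}_1\times D_2\to\mathbb{R}^+$ is a kernel from $D_2$ to $D_1$: $\nu_1(A,\cdot)$ is $\mathcal{D}_2$-measurable for all $A\in\mathcal{D}_1$, and $\nu_1(\cdot,x)$ is a (finite) positive measure for all $x\in D_2$. It is assumed that $\int_{D_2}\nu_1(D_1,x)\,\nu_2(dx)<\infty$. Put $D:=D_1\times D_2$ and, on $\mathcal{D}_1\otimes\mathcal{D}_2$, define the finite measure $\nu(A):=\int_{D_2}\big(\int_{D_1}\mathbf{1}_A(x_1,x_2)\,\nu_1(dx_1,x_2)\big)\nu_2(dx_2)$. $\mathcal{D}$ is a given sub-$\sigma$-algebra of $\mathcal{D}_1\otimes\mathcal{D}_2$; measurability and integrability on $D$ refer to $(D,\mathcal{D},\nu)$ and on $G$ to $(G,\mathcal{G},\mu)$. For a Banach space $V$, $L^1(G,V)$ is the space of $V$-valued Bochner integrable functions on $(G,\mathcal{G},\mu)$. For a Banach space $V$ and $p,q\in[1,\infty)$, $L^{p,q}_{\mathcal{D}}(V)$ is the Banach space of (classes, modulo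 $\nu$-a.e. equality, of) measurable functions $f\colon(D,\mathcal{D})\to V$ such that there is $N\in\mathcal{D}$ with $\nu(N)=0$ and $f(D\setminus N)$ separable, and $$|f|_{p,q}:=\Big(\int_{D_2}\Big(\int_{D_1}|f(x_1,x_2)|_V^p\,\nu_1(dx_1,x_2)\Big)^{q/p}\nu_2(dx_2)\Big)^{1/q}<\infty.$$ $E$ and $F$ are Banach spaces. $T>0$, $\mathcal{B}_T$ is the Borel $\sigma$-algebra of $[0,T]$, $(\Omega,\mathcal{F},\mathbb{F}=\{\mathcal{F}_t\}_{t\in[0,T]},\mathbb{P})$ is a complete filtered probability space, and $\Omega_T:=\Omega\times[0,T]$. $B_b([0,T],F)$ is the space of bounded Borel functions $[0,T]\to F$ with the sup norm $|\cdot|_\infty$, and $\mathbb{T}\subset B_b([0,T],F)$ is a closed subspace such that the evaluation map $\mathbb{T}\times[0,T]\to F$, $(\mathbf{x},t)\mapsto\mathbf{x}(t)$, is measurable when $\mathbb{T}\times[0,T]$ is endowed with the product $\sigma$-algebra $\mathcal{B}_{\mathbb{T}}\otimes\mathcal{B}_T$ ($\mathcal{B}_{\mathbb{T}}$ being the Borel $\sigma$-algebra of $(\mathbb{T},|\cdot|_\infty)$) and $F$ with its Borel $\sigma$-algebra. $\mathcal{P}'$ is a given sub-$\sigma$-algebra of $\mathcal{F}_T\otimes\mathcal{B}_T$ such that $A\times[0,T]\in\mathcal{P}'$ for all $A\in\mathcal{F}_T$ with $\mathbb{P}(A)=0$. $\mathcal{L}^0_{\mathcal{P}'}(\mathbb{T})$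 is the vector space of measurable functions $X\colon(\Omega_T,\mathcal{P}')\to F$ such that for $\mathbb{P}$-a.e. $\omega$ the path $X(\omega)\colon t\mapsto X_t(\omega)$ belongs to $\mathbb{T}$ and the $\mathbb{P}$-a.e. defined map $(\Omega,\mathcal{F}_T)\to(\mathbb{T},\mathcal{B}_{\mathbb{T}})$, $\omega\mapsto X(\omega)$, is measurable. For $r\in[1,\infty)$, $\mathcal{L}^r_{\mathcal{P}'}(\mathbb{T})$ is the Banach space of (equivalence classes of) $X\in\mathcal{L}^0_{\mathcal{P}'}(\mathbb{T})$ such that $\omega\mapsto X(\omega)$ has separable range and $|X|_{\mathcal{L}^r_{\mathcal{P}'}(\mathbb{T})}:=(\mathbb{E}[|X|_\infty^r])^{1/r}<\infty$ (two elements are identified if their paths coincide for $\mathbb{P}$-a.e. $\omega$). *)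

theory Defs
  imports "HOL-Probability.Probability"
begin

text \<open>
  \<^bold>\<open>Representatives instead of classes.\<close>
  The Banach spaces of classes of functions are represented by the set of the admissible
  representatives together with the seminorm, whose kernel is the relation by which the
  representatives are identified. Open sets of the seminorm topology are saturated for this
  relation, so they are exactly the open sets of the quotient; hence Borel sets, separability and
  continuity mean the same for representatives and for classes. The construction can be iterated:
  the values of a function may themselves be representatives.

  The Bochner integral of the library is restricted to second countable spaces, which is why
  integrability and integral are introduced here for arbitrary Banach spaces.
\<close>

record 'v seminormed =
  elems :: "'v set"
  nrm :: "'v \<Rightarrow> ennreal"

definition seminorm_topology :: "'v::minus seminormed \<Rightarrow> 'v topology" where
  "seminorm_topology V = topology (\<lambda>U. U \<subseteq> elems V \<and>
     (\<forall>u\<in>U. \<exists>e>0. \<forall>v\<in>elems V. nrm V (v - u) < e \<longrightarrow> v \<in> U))"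

definition seminorm_borel :: "'v::minus seminormed \<Rightarrow> 'v measure" where
  "seminorm_borel V = sigma (elems V) {U. openin (seminorm_topology V) U}"

definition separable_in :: "'v::minus seminormed \<Rightarrow> 'v set \<Rightarrow> bool" where
  "separable_in V A \<longleftrightarrow> separable_space (subtopology (seminorm_topology V) A)"

definition normed_type :: "'v::real_normed_vector seminormed" where
  "normed_type = \<lparr>elems = UNIV, nrm = (\<lambda>v. ennreal (norm v))\<rparr>"

lemma openin_seminorm_topology:
  "openin (seminorm_topology V) U \<longleftrightarrow> U \<subseteq> elems V \<and>
     (\<forall>u\<in>U. \<exists>e>0. \<forall>v\<in>elems V. nrm V (v - u) < e \<longrightarrow> v \<in> U)"
proof -
  let ?L = "\<lambda>U. U \<subseteq> elems V \<and> (\<forall>u\<in>U. \<exists>e>0. \<forall>v\<in>elems V. nrm V (v - u) < e \<longrightarrow> v \<in> U)"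
  have "?L (S \<inter> S')" if S: "?L S" and S': "?L S'" for S S'
  proof (intro conjI ballI)
    show "S \<inter> S' \<subseteq> elems V" using S by blast
    fix u assume u: "u \<in> S \<inter> S'"
    obtain e where e: "e > 0" "\<forall>v\<in>elems V. nrm V (v - u) < e \<longrightarrow> v \<in> S" using S u by blast
    obtain e' where e': "e' > 0" "\<forall>v\<in>elems V. nrm V (v - u) < e' \<longrightarrow> v \<in> S'" using S' u by blast
    show "\<exists>e>0. \<forall>v\<in>elems V. nrm V (v - u) < e \<longrightarrow> v \<in> S \<inter> S'"
      by (rule exI[of _ "min e e'"]) (use e e' in auto)
  qed
  moreover have "?L (\<Union>K)" if K: "\<forall>U\<in>K. ?L U" for K
    using K by (smt (verit, ccfv_threshold) Union_iff Sup_le_iff)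
  ultimately have "istopology ?L"
    unfolding istopology_def by blast
  then show ?thesis
    unfolding seminorm_topology_def by simp
qed

lemma topspace_seminorm_topology [simp]: "topspace (seminorm_topology V) = elems V"
proof -
  have "openin (seminorm_topology V) (elems V)"
    unfolding openin_seminorm_topology by (auto intro!: exI[of _ 1])
  then show ?thesis
    by (metis openin_seminorm_topology openin_subset openin_topspace subset_antisym)
qed

lemma seminorm_topology_normed_type: "seminorm_topology normed_type = euclidean"
proof -
  have "openin (seminorm_topology normed_type) U \<longleftrightarrow> openin euclidean U" for U :: "'a set"
  proof -
    have "(\<exists>e>0. \<forall>v. ennreal (norm (v - u)) < e \<longrightarrow> v \<in> U) \<longleftrightarrow>
          (\<exists>e>0. \<forall>v. dist v u < e \<longrightarrow> v \<in> U)" (is "?A \<longleftrightarrow> ?B") for u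
    proof
      assume ?A
      then obtain e where e: "e > 0" "\<And>v. ennreal (norm (v - u)) < e \<Longrightarrow> v \<in> U" by blast
      obtain d where d: "d > 0" "ennreal d \<le> e"
      proof (cases e)
        case (real r) then show ?thesis using e that[of r] by auto
      next
        case top then show ?thesis using that[of 1] by auto
      qed
      have "v \<in> U" if "dist v u < d" for v
        using that d e(2)[of v] by (metis dist_norm ennreal_lessI order_less_le_trans)
      then show ?B using d by blast
    next
      assume ?B
      then obtain d where d: "d > 0" "\<And>v. dist v u < d \<Longrightarrow> v \<in> U" by blast
      then show ?A
        by (intro exI[of _ "ennreal d"]) (auto simp: dist_norm ennreal_less_iff)
    qed
    then show ?thesis
      by (simp add: openin_seminorm_topology normed_type_def open_dist)
  qed
  then show ?thesis by (simp add: topology_eq)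
qed

lemma sets_seminorm_borel_normed_type: "sets (seminorm_borel normed_type) = sets borel"
  unfolding seminorm_borel_def seminorm_topology_normed_type
  by (simp add: borel_def normed_type_def)

subsection \<open>Bochner integrability and Bochner integral\<close>

text \<open>
  As in the library, up to the restriction to second countable spaces, an integrable function is
  a Borel function approximated in \<open>L\<^sup>1\<close> by simple ones. The measure is meant to be finite, so
  every simple function is integrable.
\<close>

definition L1 :: "'g measure \<Rightarrow> 'v::minus seminormed \<Rightarrow> ('g \<Rightarrow> 'v) seminormed" where
  "L1 M V = \<lparr>
     elems = {f \<in> measurable M (seminorm_borel V).
       \<exists>s. (\<forall>i::nat. simple_function M (s i) \<and> s i \<in> space M \<rightarrow> elems V) \<and>
           (\<lambda>i. \<integral>\<^sup>+y. nrm V (f y - s i y) \<partial>M) \<longlonglongrightarrow> 0},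
     nrm = (\<lambda>f. \<integral>\<^sup>+y. nrm V (f y) \<partial>M)\<rparr>"

definition bochner_integral :: "'g measure \<Rightarrow> ('g \<Rightarrow> 'v::banach) \<Rightarrow> 'v" where
  "bochner_integral M f = (THE z. \<exists>s. (\<forall>i::nat. Bochner_Integration.simple_bochner_integrable M (s i)) \<and>
     (\<lambda>i. \<integral>\<^sup>+y. norm (f y - s i y) \<partial>M) \<longlonglongrightarrow> 0 \<and>
     (\<lambda>i. Bochner_Integration.simple_bochner_integral M (s i)) \<longlonglongrightarrow> z)"

lemma elems_L1_normed_type:
  fixes M :: "'g measure" and f :: "'g \<Rightarrow> 'v::{banach, second_countable_topology}"
  assumes "finite_measure M"
  shows "f \<in> elems (L1 M normed_type) \<longleftrightarrow> integrable M f"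
proof -
  interpret finite_measure M by fact
  have sbi: "Bochner_Integration.simple_bochner_integrable M s \<longleftrightarrow> simple_function M s"
    for s :: "'g \<Rightarrow> 'v"
    by (auto simp: Bochner_Integration.simple_bochner_integrable.simps)
  have m: "measurable M (seminorm_borel (normed_type :: 'v seminormed)) = borel_measurable M"
    by (rule measurable_cong_sets) (simp_all add: sets_seminorm_borel_normed_type)
  have "f \<in> elems (L1 M normed_type) \<longleftrightarrow> f \<in> borel_measurable M \<and>
      (\<exists>s. (\<forall>i::nat. simple_function M (s i)) \<and> (\<lambda>i. \<integral>\<^sup>+y. norm (f y - s i y) \<partial>M) \<longlonglongrightarrow> 0)"
    unfolding L1_def by (simp add: m) (simp add: normed_type_def)
  also have "\<dots> \<longleftrightarrow> integrable M f"
  proof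
    assume A: "f \<in> borel_measurable M \<and>
      (\<exists>s. (\<forall>i::nat. simple_function M (s i)) \<and> (\<lambda>i. \<integral>\<^sup>+y. norm (f y - s i y) \<partial>M) \<longlonglongrightarrow> 0)"
    then obtain s where s: "\<And>i::nat. simple_function M (s i)"
      "(\<lambda>i. \<integral>\<^sup>+y. norm (f y - s i y) \<partial>M) \<longlonglongrightarrow> 0" by blast
    show "integrable M f"
      using A s by (auto intro!: integrableI_sequence[of f M s] simp: sbi)
  next
    assume "integrable M f"
    then show "f \<in> borel_measurable M \<and>
      (\<exists>s. (\<forall>i::nat. simple_function M (s i)) \<and> (\<lambda>i. \<integral>\<^sup>+y. norm (f y - s i y) \<partial>M) \<longlonglongrightarrow> 0)"
      by (auto simp: integrable.simps has_bochner_integral.simps sbi)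
  qed
  finally show ?thesis .
qed

lemma bochner_integral_eq_lebesgue_integral:
  fixes f :: "'g \<Rightarrow> 'v::{banach, second_countable_topology}"
  assumes "integrable M f"
  shows "bochner_integral M f = integral\<^sup>L M f"
proof -
  have "f \<in> borel_measurable M" using assms by simp
  then have "(\<lambda>z. \<exists>s. (\<forall>i::nat. Bochner_Integration.simple_bochner_integrable M (s i)) \<and>
     (\<lambda>i. \<integral>\<^sup>+y. norm (f y - s i y) \<partial>M) \<longlonglongrightarrow> 0 \<and>
     (\<lambda>i. Bochner_Integration.simple_bochner_integral M (s i)) \<longlonglongrightarrow> z) = has_bochner_integral M f"
    by (auto simp: has_bochner_integral.simps fun_eq_iff)
  then show ?thesis
    using assms by (auto simp: bochner_integral_def lebesgue_integral_def integrable.simps)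
qed

subsection \<open>Mixed \<open>L\<^sup>p\<close>-spaces over a kernel\<close>

definition ennpowr :: "ennreal \<Rightarrow> real \<Rightarrow> ennreal" where
  "ennpowr x a = (if x = \<infinity> then \<infinity> else ennreal (enn2real x powr a))"

definition finite_kernel :: "'b measure \<Rightarrow> 'a measure \<Rightarrow> ('b \<Rightarrow> 'a measure) \<Rightarrow> bool" where
  "finite_kernel D2 D1 \<nu>1 \<longleftrightarrow>
     (\<forall>x\<in>space D2. sets (\<nu>1 x) = sets D1 \<and> finite_measure (\<nu>1 x)) \<and>
     (\<forall>A\<in>sets D1. (\<lambda>x. emeasure (\<nu>1 x) A) \<in> borel_measurable D2)"

definition kernel_measure ::
    "'a measure \<Rightarrow> 'b measure \<Rightarrow> ('b \<Rightarrow> 'a measure) \<Rightarrow> ('a \<times> 'b) measure" where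
  "kernel_measure D1 D2 \<nu>1 = measure_of (space D1 \<times> space D2) (sets (D1 \<Otimes>\<^sub>M D2))
     (\<lambda>A. \<integral>\<^sup>+x2. (\<integral>\<^sup>+x1. indicator A (x1, x2) \<partial>\<nu>1 x2) \<partial>D2)"

lemma kernel_section_measurable:
  assumes k: "finite_kernel D2 D1 \<nu>1" and A: "A \<in> sets (D1 \<Otimes>\<^sub>M D2)"
  shows "(\<lambda>x2. \<integral>\<^sup>+x1. indicator A (x1, x2) \<partial>\<nu>1 x2) \<in> borel_measurable D2"
proof -
  have s: "sets (\<nu>1 x) = sets D1" "finite_measure (\<nu>1 x)" if "x \<in> space D2" for x
    using k that unfolding finite_kernel_def by auto
  have m: "(\<lambda>x. emeasure (\<nu>1 x) B) \<in> borel_measurable D2" if "B \<in> sets D1" for B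
    using k that unfolding finite_kernel_def by auto
  let ?S = "\<lambda>A x2. (\<lambda>x1. (x1, x2)) -` A"
  have sec: "?S A x2 \<in> sets D1" if "A \<in> sets (D1 \<Otimes>\<^sub>M D2)" for A x2
    using sets_Pair2[OF that] .
  have eq: "(\<integral>\<^sup>+x1. indicator A (x1, x2) \<partial>\<nu>1 x2) = emeasure (\<nu>1 x2) (?S A x2)"
    if "A \<in> sets (D1 \<Otimes>\<^sub>M D2)" "x2 \<in> space D2" for A x2
  proof -
    have "(\<integral>\<^sup>+x1. indicator A (x1, x2) \<partial>\<nu>1 x2) = (\<integral>\<^sup>+x1. indicator (?S A x2) x1 \<partial>\<nu>1 x2)"
      by (intro nn_integral_cong) (auto simp: indicator_def)
    then show ?thesis using sec that s by simp
  qed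
  have "(\<lambda>x2. emeasure (\<nu>1 x2) (?S A x2)) \<in> borel_measurable D2"
    using A unfolding sets_pair_measure
  proof (induction rule: sigma_sets_induct_disjoint[OF Int_stable_pair_measure_generator
        pair_measure_closed, consumes 1, case_names basic empty compl union])
    case (basic A)
    then obtain a b where A: "A = a \<times> b" and a[measurable]: "a \<in> sets D1" and b[measurable]: "b \<in> sets D2"
      by auto
    note m[OF a, measurable]
    have "(\<lambda>x2. emeasure (\<nu>1 x2) a * indicator b x2) \<in> borel_measurable D2" by measurable
    moreover have "emeasure (\<nu>1 x2) (?S A x2) = emeasure (\<nu>1 x2) a * indicator b x2" for x2
      unfolding A by (auto simp: indicator_def vimage_def)
    ultimately show ?case by simp
  next
    case empty show ?case by simp
  next
    case (compl A)
    then have A: "A \<in> sets (D1 \<Otimes>\<^sub>M D2)" by (simp add: sets_pair_measure)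
    have "emeasure (\<nu>1 x) (?S (space D1 \<times> space D2 - A) x) =
        emeasure (\<nu>1 x) (space D1) - emeasure (\<nu>1 x) (?S A x)" if x: "x \<in> space D2" for x
    proof -
      interpret finite_measure "\<nu>1 x" using s x by simp
      have "?S (space D1 \<times> space D2 - A) x = space D1 - ?S A x" using x by auto
      moreover have "?S A x \<subseteq> space D1" using sec[OF A] sets.sets_into_space by blast
      ultimately show ?thesis using s[OF x] sec[OF A] by (simp add: emeasure_Diff)
    qed
    moreover have "(\<lambda>x. emeasure (\<nu>1 x) (space D1) - emeasure (\<nu>1 x) (?S A x)) \<in> borel_measurable D2"
      using m[OF sets.top] compl by measurable
    ultimately show ?case by (simp cong: measurable_cong)
  next
    case (union A)
    then have A: "A i \<in> sets (D1 \<Otimes>\<^sub>M D2)" for i by (auto simp: sets_pair_measure)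
    have "emeasure (\<nu>1 x) (?S (\<Union>i. A i) x) = (\<Sum>i. emeasure (\<nu>1 x) (?S (A i) x))"
      if x: "x \<in> space D2" for x
    proof -
      have "disjoint_family (\<lambda>i. ?S (A i) x)"
        using \<open>disjoint_family A\<close> by (fastforce simp: disjoint_family_on_def)
      moreover have "range (\<lambda>i. ?S (A i) x) \<subseteq> sets (\<nu>1 x)"
        using sec[OF A] s[OF x] by auto
      ultimately show ?thesis
        unfolding vimage_UN by (subst suminf_emeasure) auto
    qed
    moreover have "(\<lambda>x. \<Sum>i. emeasure (\<nu>1 x) (?S (A i) x)) \<in> borel_measurable D2"
      using union by measurable
    ultimately show ?case by (simp cong: measurable_cong)
  qed
  then show ?thesis using eq A by (simp cong: measurable_cong)
qed

lemma space_kernel_measure [simp]: "space (kernel_measure D1 D2 \<nu>1) = space D1 \<times> space D2"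
  and sets_kernel_measure [simp]: "sets (kernel_measure D1 D2 \<nu>1) = sets (D1 \<Otimes>\<^sub>M D2)"
  unfolding kernel_measure_def
  using sets.space_closed[of "D1 \<Otimes>\<^sub>M D2"] sets.sigma_sets_eq[of "D1 \<Otimes>\<^sub>M D2"]
  by (simp_all add: space_pair_measure)

lemma emeasure_kernel_measure:
  assumes k: "finite_kernel D2 D1 \<nu>1" and A: "A \<in> sets (D1 \<Otimes>\<^sub>M D2)"
  shows "emeasure (kernel_measure D1 D2 \<nu>1) A =
    (\<integral>\<^sup>+x2. (\<integral>\<^sup>+x1. indicator A (x1, x2) \<partial>\<nu>1 x2) \<partial>D2)"
proof (rule emeasure_measure_of[OF kernel_measure_def])
  show "sets (D1 \<Otimes>\<^sub>M D2) \<subseteq> Pow (space D1 \<times> space D2)"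
    using sets.space_closed[of "D1 \<Otimes>\<^sub>M D2"] by (simp add: space_pair_measure)
  show "A \<in> sets (kernel_measure D1 D2 \<nu>1)" using A by simp
  show "positive (sets (kernel_measure D1 D2 \<nu>1))
     (\<lambda>A. \<integral>\<^sup>+x2. (\<integral>\<^sup>+x1. indicator A (x1, x2) \<partial>\<nu>1 x2) \<partial>D2)"
    by (simp add: positive_def)
  show "countably_additive (sets (kernel_measure D1 D2 \<nu>1))
     (\<lambda>A. \<integral>\<^sup>+x2. (\<integral>\<^sup>+x1. indicator A (x1, x2) \<partial>\<nu>1 x2) \<partial>D2)"
  proof (rule countably_additiveI)
    fix A :: "nat \<Rightarrow> _ set"
    assume "range A \<subseteq> sets (kernel_measure D1 D2 \<nu>1)" and d: "disjoint_family A"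
    then have A: "A i \<in> sets (D1 \<Otimes>\<^sub>M D2)" for i by auto
    have "(\<Sum>i. \<integral>\<^sup>+x2. (\<integral>\<^sup>+x1. indicator (A i) (x1, x2) \<partial>\<nu>1 x2) \<partial>D2) =
        (\<integral>\<^sup>+x2. (\<Sum>i. \<integral>\<^sup>+x1. indicator (A i) (x1, x2) \<partial>\<nu>1 x2) \<partial>D2)"
      by (rule nn_integral_suminf[symmetric]) (rule kernel_section_measurable[OF k A])
    also have "\<dots> = (\<integral>\<^sup>+x2. (\<integral>\<^sup>+x1. indicator (\<Union>i. A i) (x1, x2) \<partial>\<nu>1 x2) \<partial>D2)"
    proof (rule nn_integral_cong)
      fix x2 assume x2: "x2 \<in> space D2"
      have [measurable_cong]: "sets (\<nu>1 x2) = sets D1" using k x2 by (simp add: finite_kernel_def)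
      note A[measurable]
      have "(\<lambda>x1. indicator (A i) (x1, x2) :: ennreal) \<in> borel_measurable (\<nu>1 x2)" for i
        using x2 by measurable
      then have "(\<Sum>i. \<integral>\<^sup>+x1. indicator (A i) (x1, x2) \<partial>\<nu>1 x2) =
          (\<integral>\<^sup>+x1. (\<Sum>i. indicator (A i) (x1, x2)) \<partial>\<nu>1 x2)"
        by (rule nn_integral_suminf[symmetric])
      then show "(\<Sum>i. \<integral>\<^sup>+x1. indicator (A i) (x1, x2) \<partial>\<nu>1 x2) =
          (\<integral>\<^sup>+x1. indicator (\<Union>i. A i) (x1, x2) \<partial>\<nu>1 x2)"
        using suminf_indicator[OF d] by simp
    qed
    finally show "(\<Sum>i. \<integral>\<^sup>+x2. (\<integral>\<^sup>+x1. indicator (A i) (x1, x2) \<partial>\<nu>1 x2) \<partial>D2) =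
        (\<integral>\<^sup>+x2. (\<integral>\<^sup>+x1. indicator (\<Union>i. A i) (x1, x2) \<partial>\<nu>1 x2) \<partial>D2)" .
  qed
qed

text \<open>
  In \<open>Lpq p q D1 D2 \<nu>1 \<D> V\<close> the argument \<open>\<D>\<close> only serves as a sub-\<open>\<sigma>\<close>-algebra
  of the product \<open>\<sigma>\<close>-algebra.
\<close>

definition Lpq :: "real \<Rightarrow> real \<Rightarrow> 'a measure \<Rightarrow> 'b measure \<Rightarrow> ('b \<Rightarrow> 'a measure) \<Rightarrow>
    ('a \<times> 'b) measure \<Rightarrow> 'v::minus seminormed \<Rightarrow> ('a \<times> 'b \<Rightarrow> 'v) seminormed" where
  "Lpq p q D1 D2 \<nu>1 \<D> V =
    (let N = (\<lambda>f. ennpowr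
           (\<integral>\<^sup>+x2. ennpowr (\<integral>\<^sup>+x1. ennpowr (nrm V (f (x1, x2))) p \<partial>\<nu>1 x2) (q / p) \<partial>D2) (1 / q))
     in \<lparr>elems = {f \<in> measurable \<D> (seminorm_borel V).
            (\<exists>A\<in>sets \<D>. emeasure (kernel_measure D1 D2 \<nu>1) A = 0 \<and>
               separable_in V (f ` (space \<D> - A))) \<and> N f < \<infinity>},
         nrm = N\<rparr>)"

subsection \<open>Path spaces and processes\<close>

definition complete_filtered_prob_space ::
    "'o measure \<Rightarrow> (real \<Rightarrow> 'o measure) \<Rightarrow> real \<Rightarrow> bool" where
  "complete_filtered_prob_space P F T \<longleftrightarrow>
     prob_space P \<and> complete_measure P \<and>
     (\<forall>t\<in>{0..T}. subalgebra P (F t) \<and> null_sets P \<subseteq> sets (F t)) \<and>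
     (\<forall>s\<in>{0..T}. \<forall>t\<in>{0..T}. s \<le> t \<longrightarrow> sets (F s) \<subseteq> sets (F t))"

text \<open>
  Functions on \<open>[0,T]\<close> are extended by \<open>0\<close> to all of \<open>\<real>\<close>; this makes the pointwise operations
  of the function type those of the function space, and the supremum seminorm a norm.
\<close>

definition Bb :: "real \<Rightarrow> (real \<Rightarrow> 'f::banach) seminormed" where
  "Bb T = \<lparr>
     elems = {x \<in> borel_measurable (restrict_space borel {0..T}).
       bounded (x ` {0..T}) \<and> (\<forall>t. t \<notin> {0..T} \<longrightarrow> x t = 0)},
     nrm = (\<lambda>x. SUP t\<in>{0..T}. ennreal (norm (x t)))\<rparr>"

definition path_space :: "real \<Rightarrow> (real \<Rightarrow> 'f::banach) set \<Rightarrow> (real \<Rightarrow> 'f) seminormed" where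
  "path_space T TT = (Bb T)\<lparr>elems := TT\<rparr>"

definition closed_path_subspace :: "real \<Rightarrow> (real \<Rightarrow> 'f::banach) set \<Rightarrow> bool" where
  "closed_path_subspace T TT \<longleftrightarrow>
     closedin (seminorm_topology (Bb T)) TT \<and> (\<lambda>t. 0) \<in> TT \<and>
     (\<forall>x\<in>TT. \<forall>y\<in>TT. \<forall>a b. (\<lambda>t. a *\<^sub>R x t + b *\<^sub>R y t) \<in> TT)"

definition path :: "real \<Rightarrow> ('o \<times> real \<Rightarrow> 'f::banach) \<Rightarrow> 'o \<Rightarrow> real \<Rightarrow> 'f" where
  "path T X \<omega> = (\<lambda>t. if t \<in> {0..T} then X (\<omega>, t) else 0)"

text \<open>
  The map \<open>\<omega> \<mapsto> X(\<omega>)\<close> has values in \<open>TT\<close> only for almost every \<open>\<omega>\<close>; its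
  measurability and the separability of its range refer to the set of these \<open>\<omega>\<close>.
\<close>

definition path_dom :: "'o measure \<Rightarrow> real \<Rightarrow> (real \<Rightarrow> 'f::banach) set \<Rightarrow>
    ('o \<times> real \<Rightarrow> 'f) \<Rightarrow> 'o set" where
  "path_dom P T TT X = {\<omega> \<in> space P. path T X \<omega> \<in> TT}"

definition L0_process :: "'o measure \<Rightarrow> 'o measure \<Rightarrow> real \<Rightarrow> ('o \<times> real) measure \<Rightarrow>
    (real \<Rightarrow> 'f::banach) set \<Rightarrow> ('o \<times> real \<Rightarrow> 'f) set" where
  "L0_process P FT T \<P>' TT = {X \<in> borel_measurable \<P>'.
     (AE \<omega> in P. \<omega> \<in> path_dom P T TT X) \<and>
     path T X \<in> measurable (restrict_space FT (path_dom P T TT X))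
                           (seminorm_borel (path_space T TT))}"

definition Lr_process :: "real \<Rightarrow> 'o measure \<Rightarrow> 'o measure \<Rightarrow> real \<Rightarrow> ('o \<times> real) measure \<Rightarrow>
    (real \<Rightarrow> 'f::banach) set \<Rightarrow> ('o \<times> real \<Rightarrow> 'f) seminormed" where
  "Lr_process r P FT T \<P>' TT =
    (let N = (\<lambda>X. ennpowr (\<integral>\<^sup>+\<omega>. ennpowr (nrm (path_space T TT) (path T X \<omega>)) r \<partial>P) (1 / r))
     in \<lparr>elems = {X \<in> L0_process P FT T \<P>' TT.
            separable_in (path_space T TT) (path T X ` path_dom P T TT X) \<and> N X < \<infinity>},
         nrm = N\<rparr>)"

end

theory Submission
  imports Defs
begin

text \<open>
  Approximate \<open>g\<close> in \<open>L\<^sup>1(G, L\<^sup>p\<^sup>q)\<close> by step functions \<open>s\<^sub>n\<close> whose errors are summable. By Minkowski's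
  inequality the increments of \<open>s\<^sub>n(y)(x)\<close>, and by the boundedness of the operator those of the paths
  of \<open>\<LL>(s\<^sub>n(y))\<close> in the supremum norm, are then summable for almost all arguments, even after
  integration over \<open>G\<close>. The two sequences therefore converge pointwise, to \<open>X\<^sub>1\<close> and \<open>X\<^sub>2\<close>, and the
  formula for \<open>\<LL> Y\<close> passes to the limit from the step functions, where it is linearity.

  In a nonseparable Banach space sums and limits are controlled for measurable functions with
  separable range only. That the values of a process with separable range in the path space form
  a separable set rests on the fact that a Borel function from the reals to a metric space has
  separable range. Otherwise it has an uncountable uniformly discrete set of values. All subsets of
  this set are closed, so choosing one argument for each of these values yields an uncountable
  Borel set of reals all of whose subsets are Borel, which is impossible.
\<close>

section \<open>Separability of the range of a Borel function\<close>

text \<open>The final contradiction about Borel sets is one of counting: an uncountable Borel set of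
  reals has at least as many points as there are sets of naturals, and these also code all closed
  sets, hence by projection all Borel sets. Injectivity of the projection carries a perfect part of
  the closed set over to the Borel set itself. In the main part the obstacle is that the operator
  yields classes, and representatives chosen for them need not depend measurably on the element. A
  step function has finitely many values, so finitely many choices are made for it and joint
  measurability is checked value by value. Exceptional sets must lie in the given sigma-algebras:
  for the process they are cylinders over null sets of outcomes, which the assumption on
  \<open>\<P>'\<close> admits. Summable errors, instead of mere convergence, let one sequence of
  steps serve all arguments up to null sets; at the exceptional arguments the functions are zero,
  which gives the claims stated for all arguments.\<close>

text \<open>
  Every Borel set of reals is an injective projection of a closed set. With \<open>\<real>\<^sup>\<nat>\<close> instead of
  \<open>\<nat>\<^sup>\<nat>\<close> as the second factor an open set is covered by the graph of the reciprocal distance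
  to its complement.
\<close>

definition injproj :: "real set \<Rightarrow> bool" where
  "injproj A \<longleftrightarrow> (\<exists>K :: (real \<times> (nat \<Rightarrow> real)) set. closed K \<and> inj_on fst K \<and> fst ` K = A)"

section \<open>Countable operations on injective projections of closed sets\<close>

lemma continuous_on_snd_coordinate: "continuous_on UNIV (\<lambda>z :: real \<times> (nat \<Rightarrow> real). snd z i)"
  by (rule continuous_on_compose2[OF continuous_on_product_coordinates continuous_on_snd[OF continuous_on_id]]) auto

text \<open>One sequence carries countably many: the entries with index
  \<open>prod_encode (n, m)\<close> form its row \<open>n\<close>, which is the witness for
  \<open>A n\<close>. Every row is determined by the first component, hence so is the whole
  sequence.\<close>

lemma injproj_INT:
  assumes "\<And>n::nat. injproj (A n)"
  shows "injproj (\<Inter>n. A n)"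
proof -
  obtain K :: "nat \<Rightarrow> (real \<times> (nat \<Rightarrow> real)) set"
    where K: "\<And>n. closed (K n)" "\<And>n. inj_on fst (K n)" "\<And>n. fst ` K n = A n"
    using assms unfolding injproj_def by metis
  define s where "s = (\<lambda>n (x :: real, y :: nat \<Rightarrow> real). (x, \<lambda>m. y (prod_encode (n, m))))"
  define L where "L = (\<Inter>n. s n -` K n)"
  have "continuous_on UNIV (s n)" for n
    unfolding s_def case_prod_beta by (auto intro!: continuous_intros continuous_on_snd_coordinate)
  then have "closed L"
    unfolding L_def using K(1) by (auto intro!: closed_INT continuous_closed_vimage simp: continuous_on_eq_continuous_at)
  moreover have "inj_on fst L"
  proof (rule inj_onI)
    fix z w assume zw: "z \<in> L" "w \<in> L" "fst z = fst w"
    have "s n z = s n w" for n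
      by (rule inj_onD[OF K(2)[of n]]) (use zw in \<open>auto simp: L_def s_def case_prod_beta\<close>)
    then have *: "snd z (prod_encode (n, m)) = snd w (prod_encode (n, m))" for n m
      by (simp add: s_def case_prod_beta fun_eq_iff)
    have "snd z i = snd w i" for i
      using *[of "fst (prod_decode i)" "snd (prod_decode i)"] by simp
    then show "z = w" using zw(3) by (auto simp: prod_eq_iff)
  qed
  moreover have "fst ` L = (\<Inter>n. A n)"
  proof
    show "fst ` L \<subseteq> (\<Inter>n. A n)"
      using K(3) by (force simp: L_def s_def case_prod_beta)
    show "(\<Inter>n. A n) \<subseteq> fst ` L"
    proof
      fix x assume "x \<in> (\<Inter>n. A n)"
      then have "\<forall>n. \<exists>y. (x, y) \<in> K n" using K(3) by force
      then obtain y where y: "\<And>n. (x, y n) \<in> K n" by metis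
      have "(x, \<lambda>i. y (fst (prod_decode i)) (snd (prod_decode i))) \<in> L"
        using y by (auto simp: L_def s_def)
      then show "x \<in> fst ` L" by force
    qed
  qed
  ultimately show ?thesis unfolding injproj_def by blast
qed

text \<open>Entry 0 of the sequence records the index \<open>n\<close>, and the shifted sequence is
  the witness for \<open>A n\<close>. Disjointness lets the point determine this index, which keeps
  the projection injective.\<close>

lemma injproj_disjoint_UN:
  assumes "\<And>n::nat. injproj (A n)" and d: "disjoint_family A"
  shows "injproj (\<Union>n. A n)"
proof -
  obtain K :: "nat \<Rightarrow> (real \<times> (nat \<Rightarrow> real)) set"
    where K: "\<And>n. closed (K n)" "\<And>n. inj_on fst (K n)" "\<And>n. fst ` K n = A n"
    using assms(1) unfolding injproj_def by metis
  define s where "s = (\<lambda>(x :: real, y :: nat \<Rightarrow> real). (x, \<lambda>m. y (Suc m)))"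
  \<comment> \<open>The union over \<open>n\<close> is written as an intersection of closed
    conditions: distinct naturals have distance at least 1, so the condition for \<open>n\<close>
    binds only when entry 0 equals \<open>n\<close>.\<close>
  define L where "L = {z. snd z 0 \<in> \<nat>} \<inter> (\<Inter>n. {z. \<bar>snd z 0 - real n\<bar> \<ge> 1} \<union> s -` K n)"
  note c = continuous_on_snd_coordinate
  have "continuous_on UNIV s"
    unfolding s_def case_prod_beta by (auto intro!: continuous_intros c)
  then have "closed (s -` K n)" for n
    using K(1) by (auto intro!: continuous_closed_vimage simp: continuous_on_eq_continuous_at)
  moreover have "closed ((\<lambda>z :: real \<times> (nat \<Rightarrow> real). snd z 0) -` \<nat>)"
    using c[of 0] by (intro continuous_closed_vimage) (auto simp: continuous_on_eq_continuous_at)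
  ultimately have "closed L"
    unfolding L_def vimage_def
    by (auto intro!: closed_INT closed_Int closed_Un closed_Collect_le continuous_intros c)
  moreover have mem: "(x, y) \<in> L \<longleftrightarrow> (\<exists>n. y 0 = real n \<and> (x, \<lambda>m. y (Suc m)) \<in> K n)" for x y
  proof
    assume L: "(x, y) \<in> L"
    then obtain n where "y 0 = real n" by (auto simp: L_def Nats_def)
    with L show "\<exists>n. y 0 = real n \<and> (x, \<lambda>m. y (Suc m)) \<in> K n" by (force simp: L_def s_def)
  next
    assume "\<exists>n. y 0 = real n \<and> (x, \<lambda>m. y (Suc m)) \<in> K n"
    then obtain n where n: "y 0 = real n" "(x, \<lambda>m. y (Suc m)) \<in> K n" by blast
    have "\<bar>y 0 - real k\<bar> \<ge> 1 \<or> k = n" for k using n by linarith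
    then show "(x, y) \<in> L" using n by (auto simp: L_def s_def)
  qed
  moreover have "inj_on fst L"
  proof (rule inj_onI)
    fix z w assume zw: "z \<in> L" "w \<in> L" "fst z = fst w"
    obtain x y y' where e: "z = (x, y)" "w = (x, y')" using zw(3) by (cases z; cases w) auto
    obtain n where n: "y 0 = real n" "(x, \<lambda>m. y (Suc m)) \<in> K n" using zw(1) by (auto simp: e mem)
    obtain n' where n': "y' 0 = real n'" "(x, \<lambda>m. y' (Suc m)) \<in> K n'" using zw(2) by (auto simp: e mem)
    have "x \<in> A n" "x \<in> A n'" using n(2) n'(2) K(3) by force+
    then have "n = n'" using d unfolding disjoint_family_on_def by blast
    then have "(\<lambda>m. y (Suc m)) = (\<lambda>m. y' (Suc m))"
      using inj_onD[OF K(2)[of n] _ n(2), of "(x, \<lambda>m. y' (Suc m))"] n'(2) by auto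
    then have "y i = y' i" for i using n(1) n'(1) \<open>n = n'\<close> by (cases i) (auto simp: fun_eq_iff)
    then show "z = w" by (auto simp: e)
  qed
  moreover have "fst ` L = (\<Union>n. A n)"
  proof
    show "fst ` L \<subseteq> (\<Union>n. A n)"
      using K(3) by (force simp: mem)
    show "(\<Union>n. A n) \<subseteq> fst ` L"
    proof
      fix x assume "x \<in> (\<Union>n. A n)"
      then obtain n y where y: "(x, y) \<in> K n" using K(3) by force
      have "(x, \<lambda>i. case i of 0 \<Rightarrow> real n | Suc m \<Rightarrow> y m) \<in> L"
        using y by (auto simp: mem)
      then show "x \<in> fst ` L" by force
    qed
  qed
  ultimately show ?thesis unfolding injproj_def by blast
qed

lemma injproj_closed:
  assumes "closed A" shows "injproj A"
  unfolding injproj_def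
  by (rule exI[of _ "A \<times> {\<lambda>_. 0}"]) (auto intro!: closed_Times assms inj_onI)

lemma injproj_open:
  assumes A: "open A" shows "injproj A"
\<comment> \<open>\<open>infdist\<close> to the empty set is 0 by convention, so the reciprocal
  distance describes every open set except \<open>UNIV\<close>.\<close>
proof (cases "A = UNIV")
  case True then show ?thesis using injproj_closed by auto
next
  case False
  define L :: "(real \<times> (nat \<Rightarrow> real)) set"
    where "L = {z. snd z 0 * infdist (fst z) (- A) = 1} \<inter> (\<Inter>n. {z. snd z (Suc n) = 0})"
  note c = continuous_on_snd_coordinate
  have pos: "infdist x (- A) = 0 \<longleftrightarrow> x \<notin> A" for x
    using in_closed_iff_infdist_zero[of "- A" x] A False by (auto simp: closed_def)
  have "closed L"
    unfolding L_def
    by (intro closed_Int closed_INT ballI closed_Collect_eq[OF c continuous_on_const]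
        closed_Collect_eq[OF continuous_on_mult[OF c] continuous_on_const] continuous_intros)
  moreover have "inj_on fst L"
  proof (rule inj_onI)
    fix z w assume zw: "z \<in> L" "w \<in> L" "fst z = fst w"
    then have "snd z i = snd w i" for i
      by (cases i) (auto simp: L_def, metis mult_right_cancel mult_zero_right zero_neq_one)
    then show "z = w" using zw(3) by (auto simp: prod_eq_iff)
  qed
  moreover have "fst ` L = A"
  proof
    show "fst ` L \<subseteq> A" using pos by (force simp: L_def)
    show "A \<subseteq> fst ` L"
    proof
      fix x assume x: "x \<in> A"
      then have "(x, \<lambda>i. if i = 0 then 1 / infdist x (- A) else 0) \<in> L"
        using pos[of x] by (auto simp: L_def)
      then show "x \<in> fst ` L" by force
    qed
  qed
  ultimately show ?thesis unfolding injproj_def by blast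
qed

text \<open>The class is not visibly closed under complements, so the induction carries
  \<open>- A\<close> along. This also gives access to unions: they are unions of the disjoint sets
  \<open>disjointed a n\<close>, each an intersection of \<open>a n\<close> with complements of
  earlier sets.\<close>

lemma injproj_borel:
  assumes "A \<in> sets (borel :: real measure)"
  shows "injproj A"
proof -
  have "A \<in> sigma_sets UNIV {S::real set. open S}"
    using assms by (simp add: borel_def)
  then have "injproj A \<and> injproj (- A)"
  proof induction
    case (Basic a)
    then have "open a" by simp
    then show ?case using injproj_open injproj_closed[of "- a"] by (simp add: closed_Compl)
  next
    case Empty show ?case by (auto intro!: injproj_closed)
  next
    case (Compl a) then show ?case by (auto simp: Compl_eq_Diff_UNIV[symmetric])
  next
    case (Union a)
    have "injproj (disjointed a n)" for n
    proof -
      have "disjointed a n = (\<Inter>k. if k < n then - a k else a n)"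
      proof (intro equalityI subsetI)
        fix x assume "x \<in> (\<Inter>k. if k < n then - a k else a n)"
        then have "x \<in> (if k < n then - a k else a n)" for k by blast
        from this[of n] this show "x \<in> disjointed a n"
          unfolding disjointed_def by (metis (full_types) ComplD DiffI UN_E atLeastLessThan_iff order_less_irrefl)
      qed (auto simp: disjointed_def)
      moreover have "injproj (\<Inter>k. if k < n then - a k else a n)"
        by (rule injproj_INT) (use Union in auto)
      ultimately show ?thesis by simp
    qed
    then have "injproj (\<Union>n. disjointed a n)"
      by (intro injproj_disjoint_UN disjoint_family_disjointed)
    then have "injproj (\<Union>n. a n)" by (simp add: UN_disjointed_eq)
    moreover have "injproj (- (\<Union>n. a n))"
      using Union by (auto intro!: injproj_INT simp: Compl_UN)
    ultimately show ?case by simp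
  qed
  then show ?thesis ..
qed

text \<open>\<open>S\<close> consists of the condensation points of \<open>K\<close>. The other
  points of \<open>K\<close> lie in countably many basic open sets meeting \<open>K\<close> in a
  countable set, so \<open>S\<close> is nonempty; it equals its derived set, and a nonempty perfect
  set in a complete space has at least the cardinality of the reals.\<close>

lemma uncountable_closed_lepoll:
  fixes K :: "'a::{complete_space, second_countable_topology} set"
  assumes K: "closed K" "uncountable K"
  shows "(UNIV :: nat set set) \<lesssim> K"
proof -
  define S where "S = {z \<in> K. \<forall>U. open U \<longrightarrow> z \<in> U \<longrightarrow> uncountable (U \<inter> K)}"
  obtain B :: "'a set set" where B: "countable B" "topological_basis B"
    using ex_countable_basis by blast
  have "K - S \<subseteq> (\<Union>U\<in>{U\<in>B. countable (U \<inter> K)}. U \<inter> K)"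
  proof
    fix z assume "z \<in> K - S"
    then obtain U where U: "open U" "z \<in> U" "countable (U \<inter> K)" "z \<in> K" by (auto simp: S_def)
    then obtain V where "V \<in> B" "z \<in> V" "V \<subseteq> U" using topological_basisE[OF B(2)] by metis
    then show "z \<in> (\<Union>U\<in>{U\<in>B. countable (U \<inter> K)}. U \<inter> K)"
      using U countable_subset[of "V \<inter> K" "U \<inter> K"] by (intro UN_I[of V]) auto
  qed
  then have KS: "countable (K - S)"
    by (rule countable_subset) (rule countable_UN, use B in auto)
  have ne: "S \<noteq> {}" using KS K(2) by auto
  have derived: "Met_TC.mtopology derived_set_of S = S"
  proof (intro equalityI subsetI)
    fix z assume "z \<in> Met_TC.mtopology derived_set_of S"
    then have inf: "infinite (S \<inter> ball z e)" if "e > 0" for e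
      using that unfolding Met_TC.derived_set_of_infinite_mball by auto
    have "z \<in> closure K"
      unfolding closure_approachable
    proof (intro allI impI)
      fix e :: real assume "e > 0"
      then obtain y where "y \<in> S \<inter> ball z e" using inf[of e] by (metis ex_in_conv finite.emptyI)
      then show "\<exists>y\<in>K. dist y z < e" by (auto simp: S_def dist_commute)
    qed
    then have "z \<in> K" using K by simp
    moreover have "uncountable (U \<inter> K)" if "open U" "z \<in> U" for U
    proof -
      obtain e where "e > 0" "ball z e \<subseteq> U" using openE[OF \<open>open U\<close> \<open>z \<in> U\<close>] by blast
      then obtain y where "y \<in> S" "y \<in> U" using inf[of e] by (metis IntE ex_in_conv finite.emptyI subsetD)
      then show ?thesis using that by (auto simp: S_def)
    qed
    ultimately show "z \<in> S" by (auto simp: S_def)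
  next
    fix z assume z: "z \<in> S"
    have "infinite (S \<inter> ball z e)" if "e > 0" for e
    proof
      assume "finite (S \<inter> ball z e)"
      then have "countable ((S \<inter> ball z e) \<union> (K - S))" using KS by (auto simp: countable_finite)
      moreover have "ball z e \<inter> K \<subseteq> (S \<inter> ball z e) \<union> (K - S)" by auto
      ultimately have "countable (ball z e \<inter> K)" by (meson countable_subset)
      then show False using z that by (auto simp: S_def)
    qed
    then show "z \<in> Met_TC.mtopology derived_set_of S"
      unfolding Met_TC.derived_set_of_infinite_mball by auto
  qed
  have "Met_TC.mcomplete TYPE('a)" by (simp add: complete_UNIV)
  then have "(UNIV::real set) \<lesssim> S" by (rule Met_TC.lepoll_perfect_set[OF _ derived ne])
  then have "(UNIV :: nat set set) \<lesssim> S"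
    using lepoll_trans[OF eqpoll_imp_lepoll[OF nat_sets_eqpoll_reals]] by blast
  also have "S \<lesssim> K" by (rule subset_imp_lepoll) (auto simp: S_def)
  finally show ?thesis .
qed

text \<open>
  Cantor's diagonal argument against the enumeration of all closed subsets of the Polish space
  \<open>\<real> \<times> \<real>\<^sup>\<nat>\<close> by sets of indices of basic open sets.
\<close>

lemma uncountable_borel_has_non_borel_subset:
  assumes "Q \<in> sets (borel :: real measure)" "uncountable Q"
  obtains R where "R \<subseteq> Q" "R \<notin> sets borel"
proof -
  obtain K :: "(real \<times> (nat \<Rightarrow> real)) set" where K: "closed K" "inj_on fst K" "fst ` K = Q"
    using injproj_borel[OF assms(1)] unfolding injproj_def by blast
  have "uncountable K" using assms(2) K(3) by blast
  \<comment> \<open>Distinct sets of naturals receive distinct points of \<open>K\<close> and,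
    \<open>fst\<close> being injective on \<open>K\<close>, distinct points of \<open>Q\<close>. A
    set of naturals thus serves both as a point of \<open>Q\<close> and as the code of a closed
    set.\<close>
  then obtain \<psi> :: "nat set \<Rightarrow> real \<times> (nat \<Rightarrow> real)" where \<psi>: "inj \<psi>" "range \<psi> \<subseteq> K"
    using uncountable_closed_lepoll[OF K(1)] unfolding lepoll_def by auto
  define \<phi> where "\<phi> = (\<lambda>N. fst (\<psi> N))"
  have \<phi>: "inj \<phi>" "range \<phi> \<subseteq> Q"
    using \<psi> K(3) inj_onD[OF K(2)] by (auto simp: \<phi>_def inj_def image_subset_iff) 
  obtain B :: "(real \<times> (nat \<Rightarrow> real)) set set" where B: "countable B" "topological_basis B"
    using ex_countable_basis by blast
  have "B \<noteq> {}" using B(2) by (metis UNIV_I empty_iff open_UNIV topological_basisE)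
  define b where "b = from_nat_into B"
  have b: "range b = B" using B(1) \<open>B \<noteq> {}\<close> by (simp add: b_def)
  define R where "R = {\<phi> N | N. \<phi> N \<notin> fst ` (- (\<Union>n\<in>N. b n))}"
  have "R \<notin> sets borel"
  proof
    assume "R \<in> sets borel"
    then obtain L :: "(real \<times> (nat \<Rightarrow> real)) set" where L: "closed L" "fst ` L = R"
      using injproj_borel unfolding injproj_def by blast
    define N where "N = {n. b n \<subseteq> - L}"
    have "- L = (\<Union>n\<in>N. b n)"
    proof
      show "- L \<subseteq> (\<Union>n\<in>N. b n)"
      proof
        fix z assume "z \<in> - L"
        then obtain V where "V \<in> B" "z \<in> V" "V \<subseteq> - L"
          using topological_basisE[OF B(2), of "- L" z] L(1) by (metis open_Compl)
        then show "z \<in> (\<Union>n\<in>N. b n)" using b by (auto simp: N_def)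
      qed
    qed (auto simp: N_def)
    then have "R = fst ` (- (\<Union>n\<in>N. b n))" using L(2) by auto
    moreover have "\<phi> N \<in> R \<longleftrightarrow> \<phi> N \<notin> fst ` (- (\<Union>n\<in>N. b n))"
      unfolding R_def mem_Collect_eq using injD[OF \<phi>(1)] by blast
    ultimately show False by blast
  qed
  moreover have "R \<subseteq> Q" using \<phi>(2) by (auto simp: R_def)
  ultimately show thesis using that by blast
qed

section \<open>Separated sets and the range of a Borel function\<close>

lemma maximal_separated_set:
  fixes S :: "'a::metric_space set"
  obtains M where "M \<subseteq> S" "\<And>x y. x \<in> M \<Longrightarrow> y \<in> M \<Longrightarrow> x \<noteq> y \<Longrightarrow> dist x y \<ge> e"
    "\<And>x. e > 0 \<Longrightarrow> x \<in> S \<Longrightarrow> \<exists>y\<in>M. dist y x < e"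
proof -
  define A where "A = {M. M \<subseteq> S \<and> (\<forall>x\<in>M. \<forall>y\<in>M. x \<noteq> y \<longrightarrow> dist x y \<ge> e)}"
  have "\<exists>M\<in>A. \<forall>X\<in>A. M \<subseteq> X \<longrightarrow> X = M"
  proof (rule subset_Zorn')
    fix C assume C: "subset.chain A C"
    show "\<Union>C \<in> A"
      unfolding A_def
    proof (intro CollectI conjI ballI impI)
      show "\<Union>C \<subseteq> S" using C by (auto simp: subset.chain_def A_def)
      fix x y assume xy: "x \<in> \<Union>C" "y \<in> \<Union>C" "x \<noteq> y"
      then obtain X Y where XY: "x \<in> X" "y \<in> Y" "X \<in> C" "Y \<in> C" by auto
      then have "X \<subseteq> Y \<or> Y \<subseteq> X" using C by (auto simp: subset_chain_def)
      then obtain Z where "Z \<in> C" "x \<in> Z" "y \<in> Z" using XY by blast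
      then show "dist x y \<ge> e" using C xy by (auto simp: subset.chain_def A_def)
    qed
  qed
  then obtain M where M: "M \<in> A" "\<And>X. X \<in> A \<Longrightarrow> M \<subseteq> X \<Longrightarrow> X = M" by blast
  show thesis
  proof (rule that)
    show "M \<subseteq> S" "\<And>x y. x \<in> M \<Longrightarrow> y \<in> M \<Longrightarrow> x \<noteq> y \<Longrightarrow> dist x y \<ge> e"
      using M(1) by (auto simp: A_def)
    fix x assume x: "e > 0" "x \<in> S"
    show "\<exists>y\<in>M. dist y x < e"
    proof (rule ccontr)
      assume "\<not> (\<exists>y\<in>M. dist y x < e)"
      then have far: "\<And>y. y \<in> M \<Longrightarrow> dist y x \<ge> e" by force
      then have "insert x M \<in> A" using M(1) x by (auto simp: A_def dist_commute)
      then have "x \<in> M" using M(2) by blast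
      then show False using far x by force
    qed
  qed
qed

lemma borel_function_separable_range:
  fixes f :: "real \<Rightarrow> 'a::metric_space"
  assumes f: "f \<in> borel_measurable borel"
  obtains C where "countable C" "range f \<subseteq> closure C"
proof -
  have cnt: "countable M"
    if M: "M \<subseteq> range f" "\<And>x y. x \<in> M \<Longrightarrow> y \<in> M \<Longrightarrow> x \<noteq> y \<Longrightarrow> dist x y \<ge> e" and e: "e > 0" for M e
  proof (rule ccontr)
    assume unc: "uncountable M"
    have pre: "f -` J \<in> sets borel" if "J \<subseteq> M" for J
    proof -
      have "closed J"
      proof (rule discrete_imp_closed[OF e], intro ballI impI)
        fix x y assume "x \<in> J" "y \<in> J" "dist y x < e"
        then show "y = x" using M(2)[of y x] that by force
      qed
      then show ?thesis using measurable_sets[OF f, of J] by simp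
    qed
    obtain t where t: "\<And>s. s \<in> M \<Longrightarrow> f (t s) = s" using M(1) by (metis f_inv_into_f subsetD)
    define Q where "Q = t ` M"
    \<comment> \<open>\<open>Q\<close> has to be Borel although \<open>t\<close> is an arbitrary
      choice. It is the set of fixed points of \<open>h\<close>; the value \<open>u + 1\<close>
      merely excludes fixed points off the preimage of \<open>M\<close>, and \<open>h\<close> is
      Borel because the preimage under \<open>f\<close> of every subset of \<open>M\<close>
      is.\<close>
    define h where "h = (\<lambda>u. if f u \<in> M then t (f u) else u + 1)"
    have "h \<in> borel_measurable borel"
    proof (rule borel_measurableI)
      fix U :: "real set" assume U: "open U"
      have "h -` U = f -` {s\<in>M. t s \<in> U} \<union> ((\<lambda>u. u + 1) -` U - f -` M)"
        by (auto simp: h_def split: if_splits)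
      moreover have "(\<lambda>u::real. u + 1) -` U \<in> sets borel"
        using U by (intro borel_open open_vimage continuous_intros)
      ultimately show "h -` U \<inter> space borel \<in> sets borel" using pre[of M] pre[of "{s\<in>M. t s \<in> U}"] by auto
    qed
    then have "{u\<in>space borel. h u = u} \<in> sets borel" by measurable
    moreover have "Q = {u\<in>space borel. h u = u}"
      using t unfolding Q_def h_def by (force split: if_splits)
    ultimately have Q: "Q \<in> sets borel" by simp
    have "inj_on t M" using t by (metis inj_onI)
    then have "uncountable Q" using unc by (auto simp: Q_def dest: countable_image_inj_on)
    then obtain R where R: "R \<subseteq> Q" "R \<notin> sets borel" using uncountable_borel_has_non_borel_subset[OF Q] by blast
    \<comment> \<open>\<open>f\<close> is injective on \<open>Q\<close>, since
      \<open>f (t s) = s\<close> on \<open>M\<close>; so every subset of \<open>Q\<close> is cut out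
      of it by the preimage of a subset of \<open>M\<close>.\<close>
    have "R = Q \<inter> f -` (f ` R)" using R(1) t by (auto simp: Q_def)
    moreover have "f ` R \<subseteq> M" using R(1) t by (auto simp: Q_def)
    ultimately have "R \<in> sets borel" using Q pre[of "f ` R"] by (metis sets.Int)
    then show False using R by simp
  qed
  \<comment> \<open>Maximal separated sets are nets. Those for the radii \<open>1 / Suc n\<close>,
    countable by the preceding step, together form a dense set.\<close>
  have "\<exists>M. M \<subseteq> range f \<and> countable M \<and> (\<forall>x\<in>range f. \<exists>y\<in>M. dist y x < 1 / Suc n)" for n
  proof -
    obtain M where M: "M \<subseteq> range f" "\<And>x y. x \<in> M \<Longrightarrow> y \<in> M \<Longrightarrow> x \<noteq> y \<Longrightarrow> dist x y \<ge> 1 / Suc n"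
      "\<And>x. 1 / real (Suc n) > 0 \<Longrightarrow> x \<in> range f \<Longrightarrow> \<exists>y\<in>M. dist y x < 1 / Suc n"
      by (rule maximal_separated_set[of "range f" "1 / Suc n"]) blast
    then show ?thesis using cnt[OF M(1,2)] by (intro exI[of _ M]) simp
  qed
  then obtain M where M: "\<And>n. countable (M n)" "\<And>n x. x \<in> range f \<Longrightarrow> \<exists>y\<in>M n. dist y x < 1 / Suc n"
    by metis
  have "range f \<subseteq> closure (\<Union>n. M n)"
  proof
    fix x assume x: "x \<in> range f"
    show "x \<in> closure (\<Union>n. M n)"
      unfolding closure_approachable
    proof (intro allI impI)
      fix e :: real assume "e > 0"
      then obtain n where n: "1 / real (Suc n) < e" using nat_approx_posE by auto
      obtain y where "y \<in> M n" "dist y x < 1 / Suc n" using M(2)[OF x] by blast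
      then show "\<exists>y\<in>\<Union> (range M). dist y x < e" using n by (intro bexI[of _ y]) auto
    qed
  qed
  then show thesis using M(1) by (intro that[of "\<Union>n. M n"]) auto
qed

section \<open>Mixed norms\<close>

lemma ennpowr_top [simp]: "ennpowr \<infinity> a = \<infinity>" "ennpowr top a = top"
  by (simp_all add: ennpowr_def)

lemma ennpowr_ennreal [simp]: "r \<ge> 0 \<Longrightarrow> ennpowr (ennreal r) a = ennreal (r powr a)"
  by (simp add: ennpowr_def)

lemma ennpowr_0 [simp]: "ennpowr 0 a = 0"
  by (simp add: ennpowr_def)

lemma ennpowr_mono: "x \<le> y \<Longrightarrow> a \<ge> 0 \<Longrightarrow> ennpowr x a \<le> ennpowr y a"
  by (cases x; cases y) (auto intro!: ennreal_leI powr_mono2 simp: top_unique)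

lemma ennpowr_eq_0_iff [simp]: "ennpowr x a = 0 \<longleftrightarrow> x = 0"
  by (cases x) (auto simp: ennreal_eq_0_iff)

lemma ennpowr_less_top_iff [simp]: "ennpowr x a < top \<longleftrightarrow> x < top" "ennpowr x a = top \<longleftrightarrow> x = top"
  by (cases x; simp)+

lemma ennpowr_mult: "ennpowr (x * y) a = ennpowr x a * ennpowr y a"
proof (cases "x = 0 \<or> y = 0")
  case False
  then show ?thesis
    by (cases x; cases y)
       (auto simp: ennreal_mult[symmetric] powr_mult ennreal_mult_top ennreal_top_mult)
qed auto

lemma ennpowr_ennpowr: "ennpowr (ennpowr x a) b = ennpowr x (a * b)"
  by (cases x) (auto simp: powr_powr)

lemma ennpowr_1 [simp]: "ennpowr x 1 = x"
  by (cases x) auto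

lemma ennpowr_measurable [measurable]: "(\<lambda>x. ennpowr x a) \<in> borel_measurable borel"
  unfolding ennpowr_def by measurable

text \<open>A positive power is an increasing bijection with inverse exponent \<open>1 / a\<close>,
  so it commutes with suprema.\<close>

lemma ennpowr_SUP:
  assumes "a > 0"
  shows "ennpowr (SUP i\<in>I. f i) a = (SUP i\<in>I. ennpowr (f i) a)"
proof (rule antisym)
  have "f i \<le> ennpowr (SUP i\<in>I. ennpowr (f i) a) (1 / a)" if "i \<in> I" for i
  proof -
    have "f i = ennpowr (ennpowr (f i) a) (1 / a)" using assms by (simp add: ennpowr_ennpowr)
    also have "\<dots> \<le> ennpowr (SUP i\<in>I. ennpowr (f i) a) (1 / a)"
      using that assms by (intro ennpowr_mono SUP_upper) auto
    finally show ?thesis .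
  qed
  then have "(SUP i\<in>I. f i) \<le> ennpowr (SUP i\<in>I. ennpowr (f i) a) (1 / a)"
    by (rule SUP_least)
  then have "ennpowr (SUP i\<in>I. f i) a \<le> ennpowr (ennpowr (SUP i\<in>I. ennpowr (f i) a) (1 / a)) a"
    using assms by (intro ennpowr_mono) auto
  then show "ennpowr (SUP i\<in>I. f i) a \<le> (SUP i\<in>I. ennpowr (f i) a)"
    using assms by (simp add: ennpowr_ennpowr)
qed (use assms in \<open>auto intro!: SUP_least ennpowr_mono SUP_upper\<close>)

text \<open>For positive arguments this is \<open>powr_convex\<close>; at a zero argument it reduces
  to \<open>s powr p \<le> s\<close> for \<open>s\<close> in the unit interval.\<close>

lemma convex_powr_nonneg:
  fixes p x y t :: real
  assumes p: "p \<ge> 1" and "x \<ge> 0" "y \<ge> 0" and t: "0 \<le> t" "t \<le> 1"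
  shows "((1 - t) * x + t * y) powr p \<le> (1 - t) * x powr p + t * y powr p"
proof -
  have le: "s powr p \<le> s" if "0 \<le> s" "s \<le> 1" for s
    using that p powr_le_one_le[of s p] by (cases "s = 0") auto
  consider "x = 0" | "y = 0" | "x > 0" "y > 0" using assms by linarith
  then show ?thesis
  proof cases
    case 1 then show ?thesis using le[of t] t assms by (auto simp: powr_mult intro!: mult_right_mono)
  next
    case 2 then show ?thesis using le[of "1 - t"] t assms by (auto simp: powr_mult intro!: mult_right_mono)
  next
    case 3 then show ?thesis using convex_onD[OF powr_convex[OF p] t, of x y] by simp
  qed
qed

text \<open>
  Convexity of the power with the weights \<open>a / (a + b)\<close> and \<open>b / (a + b)\<close>; integrated with
  \<open>a\<close> and \<open>b\<close> the norms of the summands it is Minkowski's inequality.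
\<close>

lemma ennpowr_add_le:
  fixes a b p :: real
  assumes p: "p \<ge> 1" and a: "a > 0" and b: "b > 0"
  shows "ennpowr (u + v) p \<le>
    ennreal ((a + b) powr (p - 1) * a powr (1 - p)) * ennpowr u p +
    ennreal ((a + b) powr (p - 1) * b powr (1 - p)) * ennpowr v p"
proof (cases "u = top \<or> v = top")
  case True
  then show ?thesis using a b by (auto simp: ennreal_mult_top)
next
  case False
  then obtain x y where xy: "u = ennreal x" "v = ennreal y" "x \<ge> 0" "y \<ge> 0"
    by (metis ennreal_cases)
  define t where "t = b / (a + b)"
  have t: "0 \<le> t" "t \<le> 1" "1 - t = a / (a + b)"
    using a b by (auto simp: t_def field_simps)
  have key: "(a + b) powr p * (s / (a + b) * (z / s) powr p) = (a + b) powr (p - 1) * s powr (1 - p) * z powr p"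
    if "s > 0" "z \<ge> 0" for s z
    using that a b by (simp add: powr_divide powr_diff)
  have "x + y = (a + b) * ((1 - t) * (x / a) + t * (y / b))"
    unfolding t(3) unfolding t_def using a b by (simp add: distrib_left)
  then have "(x + y) powr p = (a + b) powr p * ((1 - t) * (x / a) + t * (y / b)) powr p"
    using a b xy t by (simp add: powr_mult)
  also have "\<dots> \<le> (a + b) powr p * ((1 - t) * (x / a) powr p + t * (y / b) powr p)"
    using p a b xy t by (intro mult_left_mono convex_powr_nonneg) auto
  also have "\<dots> = (a + b) powr (p - 1) * a powr (1 - p) * x powr p + (a + b) powr (p - 1) * b powr (1 - p) * y powr p"
    unfolding t(3) unfolding t_def using key[OF a xy(3)] key[OF b xy(4)] by (simp only: distrib_left)
  finally show ?thesis
    using xy by (simp add: ennreal_plus[symmetric] ennreal_mult[symmetric] del: ennreal_plus)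
qed

section \<open>Norms on nonnegative functions\<close>

definition Lnorm :: "'a measure \<Rightarrow> real \<Rightarrow> ('a \<Rightarrow> ennreal) \<Rightarrow> ennreal" where
  "Lnorm M p h = ennpowr (\<integral>\<^sup>+x. ennpowr (h x) p \<partial>M) (1 / p)"

text \<open>Banach function norms with the Fatou property: the common abstraction of the integral,
  of \<open>Lnorm\<close> on the probability space and of the mixed norm. The measure
  \<open>M\<close> only provides measurability and null sets; \<open>N\<close> need not be an
  integral norm with respect to it.\<close>

locale function_norm =
  fixes M :: "'w measure" and N :: "('w \<Rightarrow> ennreal) \<Rightarrow> ennreal"
  assumes mono_AE: "(AE w in M. h w \<le> h' w) \<Longrightarrow> N h \<le> N h'"
    and cmult: "h \<in> borel_measurable M \<Longrightarrow> N (\<lambda>w. c * h w) = c * N h"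
    and add: "h \<in> borel_measurable M \<Longrightarrow> h' \<in> borel_measurable M \<Longrightarrow>
        N (\<lambda>w. h w + h' w) \<le> N h + N h'"
    and SUP: "(\<And>n. k n \<in> borel_measurable M) \<Longrightarrow> incseq k \<Longrightarrow>
        N (\<lambda>w. SUP n::nat. k n w) = (SUP n. N (k n))"
    and zeroD: "h \<in> borel_measurable M \<Longrightarrow> N h = 0 \<Longrightarrow> AE w in M. h w = 0"
begin

lemma cong_AE: "(AE w in M. h w = h' w) \<Longrightarrow> N h = N h'"
  by (intro antisym mono_AE) auto

lemma mono: "(\<And>w. w \<in> space M \<Longrightarrow> h w \<le> h' w) \<Longrightarrow> N h \<le> N h'"
  by (rule mono_AE) auto

lemma zero [simp]: "N (\<lambda>_. 0) = 0"
  using cmult[of "\<lambda>_. 0" 0] by simp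

lemma zeroI: "(AE w in M. h w = 0) \<Longrightarrow> N h = 0"
  using cong_AE[of h "\<lambda>_. 0"] by simp

lemma sum:
  assumes "finite I" "\<And>i. i \<in> I \<Longrightarrow> k i \<in> borel_measurable M"
  shows "N (\<lambda>w. \<Sum>i\<in>I. k i w) \<le> (\<Sum>i\<in>I. N (k i))"
  using assms
proof induction
  case (insert i I)
  then have "N (\<lambda>w. k i w + (\<Sum>i\<in>I. k i w)) \<le> N (k i) + N (\<lambda>w. \<Sum>i\<in>I. k i w)"
    by (intro add borel_measurable_sum) auto
  also have "\<dots> \<le> N (k i) + (\<Sum>i\<in>I. N (k i))"
    using insert by (intro add_left_mono) auto
  finally show ?case using insert by simp
qed simp

text \<open>The axiom \<open>SUP\<close> turns finite subadditivity into countable subadditivity.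
  This is Minkowski's inequality in the form needed for series of increments.\<close>

lemma suminf:
  assumes [measurable]: "\<And>n. k n \<in> borel_measurable M"
  shows "N (\<lambda>w. \<Sum>n. k n w) \<le> (\<Sum>n. N (k n))"
proof -
  have "N (\<lambda>w. \<Sum>n. k n w) = N (\<lambda>w. SUP n. \<Sum>i<n. k i w)"
    by (simp add: suminf_eq_SUP)
  also have "\<dots> = (SUP n. N (\<lambda>w. \<Sum>i<n. k i w))"
    by (rule SUP) (auto intro!: incseq_SucI le_funI)
  also have "\<dots> \<le> (SUP n. \<Sum>i<n. N (k i))"
    by (intro SUP_mono bexI) (auto intro!: sum)
  finally show ?thesis by (simp add: suminf_eq_SUP)
qed

lemma AE_finite:
  assumes [measurable]: "h \<in> borel_measurable M" and fin: "N h < \<infinity>"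
  shows "AE w in M. h w < \<infinity>"
proof -
  define k :: "'w \<Rightarrow> ennreal" where "k = indicator {w\<in>space M. h w = \<infinity>}"
  have [measurable]: "k \<in> borel_measurable M" unfolding k_def by measurable
  \<comment> \<open>Homogeneity also holds for the infinite constant: \<open>h\<close> dominates
    infinity times the indicator \<open>k\<close>, so a finite norm of \<open>h\<close> forces
    \<open>N k = 0\<close>.\<close>
  have "\<infinity> * N k = N (\<lambda>w. \<infinity> * k w)" by (rule cmult[symmetric]) measurable
  also have "\<dots> \<le> N h" by (rule mono) (auto simp: k_def indicator_def)
  finally have "N k = 0" using fin by (auto simp: ennreal_top_mult split: if_splits)
  then have "AE w in M. k w = 0" by (intro zeroD) auto
  then show ?thesis by (rule AE_mp) (auto intro!: AE_I2 simp: k_def indicator_def top.not_eq_extremum)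
qed

end

lemma function_norm_Lnorm:
  assumes p: "p \<ge> 1"
  shows "function_norm M (Lnorm M p)"
proof
  fix h h' :: "'a \<Rightarrow> ennreal" and c :: ennreal and k :: "nat \<Rightarrow> 'a \<Rightarrow> ennreal"
  have mono: "Lnorm M p h \<le> Lnorm M p h'" if "AE w in M. h w \<le> h' w" for h h'
    unfolding Lnorm_def using that p
    by (intro ennpowr_mono nn_integral_mono_AE) (auto elim!: eventually_mono intro!: ennpowr_mono)
  show "AE w in M. h w \<le> h' w \<Longrightarrow> Lnorm M p h \<le> Lnorm M p h'" by (rule mono)
  show "Lnorm M p (\<lambda>w. c * h w) = c * Lnorm M p h" if [measurable]: "h \<in> borel_measurable M"
    unfolding Lnorm_def using p by (simp add: ennpowr_mult nn_integral_cmult ennpowr_ennpowr)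
  have zero: "AE w in M. h w = 0" if [measurable]: "h \<in> borel_measurable M" "Lnorm M p h = 0" for h
    using that(2) unfolding Lnorm_def by (simp add: nn_integral_0_iff_AE)
  then show "AE w in M. h w = 0" if "h \<in> borel_measurable M" "Lnorm M p h = 0" using that by blast
  show "Lnorm M p (\<lambda>w. SUP n. k n w) = (SUP n. Lnorm M p (k n))"
    if [measurable]: "\<And>n. k n \<in> borel_measurable M" and inc: "incseq k"
  proof -
    have "incseq (\<lambda>n x. ennpowr (k n x) p)"
      using inc p by (auto simp: mono_def le_fun_def intro!: ennpowr_mono)
    then have "(\<integral>\<^sup>+x. (SUP n. ennpowr (k n x) p) \<partial>M) = (SUP n. \<integral>\<^sup>+x. ennpowr (k n x) p \<partial>M)"
      by (intro nn_integral_monotone_convergence_SUP) auto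
    then show ?thesis unfolding Lnorm_def using p by (simp add: ennpowr_SUP)
  qed
  show "Lnorm M p (\<lambda>w. h w + h' w) \<le> Lnorm M p h + Lnorm M p h'"
    if [measurable]: "h \<in> borel_measurable M" "h' \<in> borel_measurable M"
  proof -
    consider "Lnorm M p h = top \<or> Lnorm M p h' = top" | "Lnorm M p h = 0" | "Lnorm M p h' = 0"
      | a b where "Lnorm M p h = ennreal a" "Lnorm M p h' = ennreal b" "a > 0" "b > 0"
      by (cases "Lnorm M p h"; cases "Lnorm M p h'") (auto simp: less_le)
    then show ?thesis
    proof cases
      case 1 then show ?thesis by auto
    next
      case 2
      then have "AE w in M. h w = 0" by (intro zero) auto
      then have "Lnorm M p (\<lambda>w. h w + h' w) \<le> Lnorm M p h'" by (intro mono) auto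
      then show ?thesis using 2 by simp
    next
      case 3
      then have "AE w in M. h' w = 0" by (intro zero) auto
      then have "Lnorm M p (\<lambda>w. h w + h' w) \<le> Lnorm M p h" by (intro mono) auto
      then show ?thesis using 3 by simp
    next
      case 4
      let ?c = "\<lambda>s. (a + b) powr (p - 1) * s powr (1 - p)"
      have int: "(\<integral>\<^sup>+x. ennpowr (h x) p \<partial>M) = ennreal (s powr p)"
        if "Lnorm M p h = ennreal s" "s > 0" for h s
      proof -
        have "(\<integral>\<^sup>+x. ennpowr (h x) p \<partial>M) = ennpowr (Lnorm M p h) p"
          unfolding Lnorm_def using p by (simp add: ennpowr_ennpowr)
        then show ?thesis using that by simp
      qed
      have "(\<integral>\<^sup>+x. ennpowr (h x + h' x) p \<partial>M) \<le>
          (\<integral>\<^sup>+x. ennreal (?c a) * ennpowr (h x) p + ennreal (?c b) * ennpowr (h' x) p \<partial>M)"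
        using p 4 by (intro nn_integral_mono ennpowr_add_le) auto
      also have "\<dots> = ennreal (?c a) * ennreal (a powr p) + ennreal (?c b) * ennreal (b powr p)"
        using 4 by (simp add: nn_integral_add nn_integral_cmult int)
      also have "\<dots> = ennreal (?c a * a powr p + ?c b * b powr p)"
        using 4 by (simp add: ennreal_plus ennreal_mult)
      also have "?c a * a powr p + ?c b * b powr p = (a + b) powr p"
      proof -
        have *: "?c s * s powr p = (a + b) powr (p - 1) * s" if "s > 0" for s
          using that by (simp add: mult.assoc powr_add[symmetric])
        then have "?c a * a powr p + ?c b * b powr p = (a + b) powr (p - 1) * (a + b)"
          using *[of a] *[of b] 4 by (simp only: distrib_left)
        also have "\<dots> = (a + b) powr p" using 4 by (simp add: powr_diff)
        finally show ?thesis .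
      qed
      finally have "Lnorm M p (\<lambda>w. h w + h' w) \<le> ennpowr (ennreal ((a + b) powr p)) (1 / p)"
        unfolding Lnorm_def using p by (intro ennpowr_mono) auto
      also have "\<dots> = Lnorm M p h + Lnorm M p h'"
        using 4 p by (simp add: powr_powr ennreal_plus)
      finally show ?thesis .
    qed
  qed
qed

section \<open>The mixed norm over a kernel\<close>

lemma kernel_nn_integral_measurable:
  assumes k: "finite_kernel D2 D1 \<nu>1" and h: "h \<in> borel_measurable (D1 \<Otimes>\<^sub>M D2)"
  shows "(\<lambda>x2. \<integral>\<^sup>+x1. h (x1, x2) \<partial>\<nu>1 x2) \<in> borel_measurable D2"
proof -
  have s [measurable_cong]: "sets (\<nu>1 x) = sets D1" if "x \<in> space D2" for x
    using k that unfolding finite_kernel_def by auto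
  have sec: "(\<lambda>x1. h (x1, x2)) \<in> borel_measurable (\<nu>1 x2)"
    if "h \<in> borel_measurable (D1 \<Otimes>\<^sub>M D2)" "x2 \<in> space D2" for h x2
    using measurable_compose[OF measurable_Pair2'[OF that(2)] that(1)] measurable_cong_sets[OF s[OF that(2)] refl] by blast
  show ?thesis
    using h
  proof (induction rule: borel_measurable_induct)
    case (cong f g)
    have "(\<integral>\<^sup>+x1. f (x1, x2) \<partial>\<nu>1 x2) = (\<integral>\<^sup>+x1. g (x1, x2) \<partial>\<nu>1 x2)" if x: "x2 \<in> space D2" for x2
      by (rule nn_integral_cong) (use cong x sets_eq_imp_space_eq[OF s[OF x]] in \<open>auto simp: space_pair_measure\<close>)
    then show ?case using cong by (simp cong: measurable_cong)
  next
    case (set A) then show ?case using kernel_section_measurable[OF k] by simp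
  next
    case (mult u c)
    have "(\<integral>\<^sup>+x1. c * u (x1, x2) \<partial>\<nu>1 x2) = c * (\<integral>\<^sup>+x1. u (x1, x2) \<partial>\<nu>1 x2)" if "x2 \<in> space D2" for x2
      by (rule nn_integral_cmult) (rule sec[OF mult(2) that])
    then show ?case using mult by (simp cong: measurable_cong)
  next
    case (add u v)
    have "(\<integral>\<^sup>+x1. v (x1, x2) + u (x1, x2) \<partial>\<nu>1 x2) = (\<integral>\<^sup>+x1. v (x1, x2) \<partial>\<nu>1 x2) + (\<integral>\<^sup>+x1. u (x1, x2) \<partial>\<nu>1 x2)"
      if "x2 \<in> space D2" for x2
      by (intro nn_integral_add sec add that)
    then show ?case using add by (simp cong: measurable_cong)
  next
    case (seq U)
    have "(\<integral>\<^sup>+x1. (SUP i. U i) (x1, x2) \<partial>\<nu>1 x2) = (SUP i. \<integral>\<^sup>+x1. U i (x1, x2) \<partial>\<nu>1 x2)"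
      if "x2 \<in> space D2" for x2
      unfolding SUP_apply
      by (intro nn_integral_monotone_convergence_SUP sec seq that)
         (use seq in \<open>auto simp: incseq_def le_fun_def\<close>)
    then show ?case using seq by (simp cong: measurable_cong)
  qed
qed

text \<open>As an \<open>Lnorm\<close> of \<open>Lnorm\<close>s it inherits each axiom of
  \<open>function_norm\<close> by two applications. The exponent \<open>q / p\<close> in
  \<open>Lpq\<close> is the inner root followed by the outer power.\<close>

definition mixed_norm where
  "mixed_norm p q D2 \<nu>1 h = Lnorm D2 q (\<lambda>x2. Lnorm (\<nu>1 x2) p (\<lambda>x1. h (x1, x2)))"

lemma nrm_Lpq:
  assumes "p > 0"
  shows "nrm (Lpq p q D1 D2 \<nu>1 \<D> V) f = mixed_norm p q D2 \<nu>1 (\<lambda>x. nrm V (f x))"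
  using assms by (simp add: Lpq_def mixed_norm_def Lnorm_def ennpowr_ennpowr)

text \<open>The kernel measure of a set is the iterated integral of its indicator, so almost all
  sections of a null set are null.\<close>

lemma AE_kernel_measureD:
  assumes k: "finite_kernel D2 D1 \<nu>1" and D: "subalgebra (D1 \<Otimes>\<^sub>M D2) \<D>"
    and AE: "AE x in restr_to_subalg (kernel_measure D1 D2 \<nu>1) \<D>. R x"
  shows "AE x2 in D2. AE x1 in \<nu>1 x2. R (x1, x2)"
proof -
  have sub: "subalgebra (kernel_measure D1 D2 \<nu>1) \<D>"
    using D by (simp add: subalgebra_def space_pair_measure)
  from AE_restr_to_subalg[OF sub AE] obtain A where
    A: "{x \<in> space D1 \<times> space D2. \<not> R x} \<subseteq> A" "A \<in> sets (D1 \<Otimes>\<^sub>M D2)"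
      "emeasure (kernel_measure D1 D2 \<nu>1) A = 0"
    by (auto elim!: AE_E)
  have "AE x2 in D2. (\<integral>\<^sup>+x1. indicator A (x1, x2) \<partial>\<nu>1 x2) = 0"
    using A emeasure_kernel_measure[OF k A(2)] kernel_section_measurable[OF k A(2)]
    by (subst nn_integral_0_iff_AE[symmetric]) auto
  moreover have "AE x1 in \<nu>1 x2. R (x1, x2)"
    if "x2 \<in> space D2" "(\<integral>\<^sup>+x1. indicator A (x1, x2) \<partial>\<nu>1 x2) = 0" for x2
  proof -
    have s: "sets (\<nu>1 x2) = sets D1" using k that unfolding finite_kernel_def by auto
    have "(\<lambda>x1. indicator A (x1, x2) :: ennreal) \<in> borel_measurable (\<nu>1 x2)"
      using measurable_compose[OF measurable_Pair2'[OF that(1)] borel_measurable_indicator[OF A(2)]]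
        measurable_cong_sets[OF s refl] by blast
    then have "AE x1 in \<nu>1 x2. indicator A (x1, x2) = (0::ennreal)"
      using that(2) by (simp add: nn_integral_0_iff_AE)
    then show ?thesis
      by (rule AE_mp) (use A(1) that(1) sets_eq_imp_space_eq[OF s] in \<open>auto intro!: AE_I2 simp: indicator_def split: if_splits\<close>)
  qed
  ultimately show ?thesis by (auto intro: AE_mp)
qed

lemma function_norm_mixed_norm:
  assumes k: "finite_kernel D2 D1 \<nu>1" and D: "subalgebra (D1 \<Otimes>\<^sub>M D2) \<D>"
    and p: "p \<ge> 1" and q: "q \<ge> 1"
  shows "function_norm (restr_to_subalg (kernel_measure D1 D2 \<nu>1) \<D>) (mixed_norm p q D2 \<nu>1)"
    (is "function_norm ?M ?N")
proof -
  have sub: "subalgebra (kernel_measure D1 D2 \<nu>1) \<D>"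
    using D by (simp add: subalgebra_def space_pair_measure)
  have bm: "h \<in> borel_measurable (D1 \<Otimes>\<^sub>M D2)" if "h \<in> borel_measurable ?M" for h :: "_ \<Rightarrow> ennreal"
    using measurable_from_subalg[OF D] that measurable_cong_sets[OF sets_restr_to_subalg[OF sub] refl] by blast
  have s: "sets (\<nu>1 x) = sets D1" if "x \<in> space D2" for x
    using k that unfolding finite_kernel_def by auto
  have sec: "(\<lambda>x1. h (x1, x2)) \<in> borel_measurable (\<nu>1 x2)"
    if "h \<in> borel_measurable ?M" "x2 \<in> space D2" for h :: "_ \<Rightarrow> ennreal" and x2
    using measurable_compose[OF measurable_Pair2'[OF that(2)] bm[OF that(1)]] measurable_cong_sets[OF s[OF that(2)] refl] by blast
  have inner: "(\<lambda>x2. Lnorm (\<nu>1 x2) p (\<lambda>x1. h (x1, x2))) \<in> borel_measurable D2" if "h \<in> borel_measurable ?M" for h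
    using kernel_nn_integral_measurable[OF k, of "\<lambda>x. ennpowr (h x) p"] bm[OF that] unfolding Lnorm_def by measurable
  interpret O: function_norm D2 "Lnorm D2 q" by (rule function_norm_Lnorm[OF q])
  interpret I: function_norm "\<nu>1 x2" "Lnorm (\<nu>1 x2) p" for x2 by (rule function_norm_Lnorm[OF p])
  show ?thesis
  proof
    fix h h' :: "'b \<times> 'a \<Rightarrow> ennreal" and c :: ennreal and k' :: "nat \<Rightarrow> 'b \<times> 'a \<Rightarrow> ennreal"
    show "?N h \<le> ?N h'" if "AE w in ?M. h w \<le> h' w"
      unfolding mixed_norm_def using AE_kernel_measureD[OF k D that]
      by (intro O.mono_AE) (auto elim!: eventually_mono intro!: I.mono_AE)
    show "?N (\<lambda>w. c * h w) = c * ?N h" if h: "h \<in> borel_measurable ?M"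
      unfolding mixed_norm_def O.cmult[OF inner[OF h], symmetric]
      by (intro O.cong_AE AE_I2 I.cmult sec h)
    show "?N (\<lambda>w. h w + h' w) \<le> ?N h + ?N h'" if h: "h \<in> borel_measurable ?M" "h' \<in> borel_measurable ?M"
    proof -
      have "?N (\<lambda>w. h w + h' w) \<le> Lnorm D2 q (\<lambda>x2. Lnorm (\<nu>1 x2) p (\<lambda>x1. h (x1, x2)) + Lnorm (\<nu>1 x2) p (\<lambda>x1. h' (x1, x2)))"
        unfolding mixed_norm_def by (intro O.mono I.add sec h)
      also have "\<dots> \<le> ?N h + ?N h'"
        unfolding mixed_norm_def by (intro O.add inner h)
      finally show ?thesis .
    qed
    show "?N (\<lambda>w. SUP n. k' n w) = (SUP n. ?N (k' n))"
      if h: "\<And>n. k' n \<in> borel_measurable ?M" and inc: "incseq k'"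
    proof -
      have inc': "incseq (\<lambda>n x1. k' n (x1, x2))" for x2
        using inc by (auto simp: incseq_def le_fun_def)
      have "?N (\<lambda>w. SUP n. k' n w) = Lnorm D2 q (\<lambda>x2. SUP n. Lnorm (\<nu>1 x2) p (\<lambda>x1. k' n (x1, x2)))"
        unfolding mixed_norm_def by (intro O.cong_AE AE_I2 I.SUP sec h inc')
      also have "\<dots> = (SUP n. ?N (k' n))"
        unfolding mixed_norm_def
      proof (intro O.SUP inner h incseq_SucI le_funI)
        fix n x2
        show "Lnorm (\<nu>1 x2) p (\<lambda>x1. k' n (x1, x2)) \<le> Lnorm (\<nu>1 x2) p (\<lambda>x1. k' (Suc n) (x1, x2))"
          using inc by (intro I.mono) (auto simp: incseq_Suc_iff le_fun_def)
      qed
      finally show ?thesis .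
    qed
    show "AE w in ?M. h w = 0" if h: "h \<in> borel_measurable ?M" and 0: "?N h = 0"
    proof -
      have "AE x2 in D2. Lnorm (\<nu>1 x2) p (\<lambda>x1. h (x1, x2)) = 0"
        using 0 unfolding mixed_norm_def by (intro O.zeroD inner h)
      then have AE0: "AE x2 in D2. AE x1 in \<nu>1 x2. h (x1, x2) = 0"
        using AE_space by eventually_elim (intro I.zeroD sec h)
      \<comment> \<open>The way back from null sections to a null set needs a measurable set.
        \<open>A\<close> lies in \<open>\<D>\<close> because \<open>h\<close> is measurable
        there.\<close>
      define A where "A = {w \<in> space ?M. h w \<noteq> 0}"
      have A: "A \<in> sets ?M" unfolding A_def using h by measurable
      then have A': "A \<in> sets \<D>" "A \<in> sets (D1 \<Otimes>\<^sub>M D2)"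
        using D by (auto simp: sets_restr_to_subalg[OF sub] subalgebra_def)
      have "emeasure ?M A = (\<integral>\<^sup>+x2. (\<integral>\<^sup>+x1. indicator A (x1, x2) \<partial>\<nu>1 x2) \<partial>D2)"
        using A' by (simp add: emeasure_restr_to_subalg[OF sub] emeasure_kernel_measure[OF k])
      also have "\<dots> = (\<integral>\<^sup>+x2. 0 \<partial>D2)"
      proof (rule nn_integral_cong_AE, use AE0 in eventually_elim)
        fix x2 assume "AE x1 in \<nu>1 x2. h (x1, x2) = 0"
        then have "(\<integral>\<^sup>+x1. indicator A (x1, x2) \<partial>\<nu>1 x2) = (\<integral>\<^sup>+x1. 0 \<partial>\<nu>1 x2)"
          by (intro nn_integral_cong_AE) (auto elim!: eventually_mono simp: A_def indicator_def)
        then show "(\<integral>\<^sup>+x1. indicator A (x1, x2) \<partial>\<nu>1 x2) = 0" by simp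
      qed
      finally have "A \<in> null_sets ?M" using A by (auto simp: null_sets_def)
      then show ?thesis by (rule AE_I') (auto simp: A_def)
    qed
  qed
qed

section \<open>Strong measurability and seminorm topologies\<close>

text \<open>Strong measurability in the sense of Pettis, without an exceptional null set; the
  countable set may lie outside the range. Such functions are pointwise limits of countably valued
  measurable ones, which makes sums and differences measurable in nonseparable spaces, where Borel
  measurability alone may be lost.\<close>

definition strongly_measurable :: "'a measure \<Rightarrow> ('a \<Rightarrow> 'b::metric_space) \<Rightarrow> bool" where
  "strongly_measurable M f \<longleftrightarrow>
     f \<in> borel_measurable M \<and> (\<exists>C. countable C \<and> f ` space M \<subseteq> closure C)"

lemma strongly_measurableD: "strongly_measurable M f \<Longrightarrow> f \<in> borel_measurable M"
  by (simp add: strongly_measurable_def)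

lemma strongly_measurableI:
  "f \<in> borel_measurable M \<Longrightarrow> countable C \<Longrightarrow> f ` space M \<subseteq> closure C \<Longrightarrow> strongly_measurable M f"
  by (auto simp: strongly_measurable_def)

lemma strongly_measurable_compose:
  assumes "strongly_measurable M f" "g \<in> measurable N M"
  shows "strongly_measurable N (\<lambda>x. f (g x))"
  using assms measurable_space[OF assms(2)] unfolding strongly_measurable_def
  by (auto simp: image_subset_iff intro: measurable_compose)

lemma strongly_measurable_LIMSEQ:
  assumes f: "\<And>n. strongly_measurable M (f n)"
    and lim: "\<And>x. x \<in> space M \<Longrightarrow> (\<lambda>n. f n x) \<longlonglongrightarrow> g x"
  shows "strongly_measurable M g"
proof -
  obtain C where C: "\<And>n. countable (C n)" "\<And>n. f n ` space M \<subseteq> closure (C n)"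
    using f unfolding strongly_measurable_def by metis
  show ?thesis
  proof (rule strongly_measurableI)
    show "g \<in> borel_measurable M"
      using borel_measurable_LIMSEQ_metric[of f M g] f lim strongly_measurableD by blast
    show "countable (\<Union>n. C n)" using C by auto
    show "g ` space M \<subseteq> closure (\<Union>n. C n)"
    proof
      fix z assume "z \<in> g ` space M"
      then obtain x where x: "x \<in> space M" "z = g x" by auto
      have "f n x \<in> closure (\<Union>n. C n)" for n
        using C(2)[of n] x closure_mono[of "C n" "\<Union>n. C n"] by blast
      then show "z \<in> closure (\<Union>n. C n)"
        using closed_sequentially[OF closed_closure _ lim[OF x(1)]] x by auto
    qed
  qed
qed

lemma strongly_measurable_countable:
  fixes c :: "'i::countable \<Rightarrow> 'b::metric_space"
  assumes "s \<in> measurable M (count_space UNIV)"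
  shows "strongly_measurable M (\<lambda>x. c (s x))"
proof (rule strongly_measurableI)
  show "countable (range c)" by simp
  show "(\<lambda>x. c (s x)) ` space M \<subseteq> closure (range c)" using closure_subset[of "range c"] by auto
qed (rule measurable_compose[OF assms], simp)

text \<open>\<open>f x\<close> is replaced by the first member of a dense sequence within distance
  \<open>1 / Suc n\<close>. The choice is measurable, as it involves only the distances to countably
  many fixed points.\<close>

lemma strongly_measurable_approx:
  assumes f: "strongly_measurable M f"
  obtains s :: "nat \<Rightarrow> 'a \<Rightarrow> nat" and c :: "nat \<Rightarrow> 'b::metric_space"
  where "\<And>n. s n \<in> measurable M (count_space UNIV)"
    "\<And>x. x \<in> space M \<Longrightarrow> (\<lambda>n. c (s n x)) \<longlonglongrightarrow> f x"
proof -
  obtain C where C: "countable C" "f ` space M \<subseteq> closure C" and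
    [measurable]: "f \<in> borel_measurable M"
    using f unfolding strongly_measurable_def by metis
  define c where "c = from_nat_into C"
  define s where "s = (\<lambda>n x. LEAST i. dist (f x) (c i) < 1 / real (Suc n))"
  have "(\<lambda>x. dist (f x) z) \<in> borel_measurable M" for z
    by (rule measurable_compose[OF _ borel_measurable_continuous_onI[of "\<lambda>y. dist y z"]])
       (auto intro!: continuous_intros)
  then have "s n \<in> measurable M (count_space UNIV)" for n
    unfolding s_def by measurable
  moreover have "(\<lambda>n. c (s n x)) \<longlonglongrightarrow> f x" if x: "x \<in> space M" for x
  proof -
    have "C \<noteq> {}" using C(2) x by auto
    then have "range c = C" using C(1) by (simp add: c_def)
    then have "\<exists>i. dist (f x) (c i) < 1 / real (Suc n)" for n
    proof -
      have "f x \<in> closure C" using C(2) x by auto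
      then obtain z where "z \<in> C" "dist z (f x) < 1 / real (Suc n)"
        unfolding closure_approachable by (metis of_nat_0_less_iff zero_less_Suc zero_less_divide_1_iff)
      then show ?thesis using \<open>range c = C\<close> by (auto simp: dist_commute)
    qed
    then have d: "dist (f x) (c (s n x)) < 1 / real (Suc n)" for n
      unfolding s_def by (rule LeastI_ex)
    show ?thesis
    proof (rule metric_LIMSEQ_I)
      fix e :: real assume "e > 0"
      then obtain N where N: "1 / real (Suc N) < e" using nat_approx_posE by blast
      have "dist (c (s n x)) (f x) < e" if "n \<ge> N" for n
      proof -
        have "1 / real (Suc n) \<le> 1 / real (Suc N)" using that by (simp add: field_simps)
        then show ?thesis using d[of n] N by (simp add: dist_commute)
      qed
      then show "\<exists>N. \<forall>n\<ge>N. dist (c (s n x)) (f x) < e" by blast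
    qed
  qed
  ultimately show thesis by (rule that)
qed

text \<open>The Borel sets of a nonseparable product can exceed the product sigma-algebra, so
  measurability of both components may not suffice. The approximations take countably many pairs of
  values, for which any \<open>h\<close> is harmless; continuity is needed only in the
  limit.\<close>

lemma strongly_measurable_combine:
  assumes f: "strongly_measurable M f" and g: "strongly_measurable M g"
    and h: "continuous_on UNIV (\<lambda>z. h (fst z) (snd z))"
  shows "strongly_measurable M (\<lambda>x. h (f x) (g x))"
proof -
  obtain s :: "nat \<Rightarrow> 'a \<Rightarrow> nat" and c where s [measurable]: "\<And>n. s n \<in> measurable M (count_space UNIV)"
    and c: "\<And>x. x \<in> space M \<Longrightarrow> (\<lambda>n. c (s n x)) \<longlonglongrightarrow> f x"
    using strongly_measurable_approx[OF f] by metis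
  obtain t :: "nat \<Rightarrow> 'a \<Rightarrow> nat" and d where t [measurable]: "\<And>n. t n \<in> measurable M (count_space UNIV)"
    and d: "\<And>x. x \<in> space M \<Longrightarrow> (\<lambda>n. d (t n x)) \<longlonglongrightarrow> g x"
    using strongly_measurable_approx[OF g] by metis
  show ?thesis
  proof (rule strongly_measurable_LIMSEQ)
    fix n
    have "(\<lambda>x. (s n x, t n x)) \<in> measurable M (count_space UNIV)"
      by measurable
    then show "strongly_measurable M (\<lambda>x. h (c (s n x)) (d (t n x)))"
      using strongly_measurable_countable[of "\<lambda>x. (s n x, t n x)" M "\<lambda>z. h (c (fst z)) (d (snd z))"] by simp
  next
    fix x assume "x \<in> space M"
    then have "(\<lambda>n. (c (s n x), d (t n x))) \<longlonglongrightarrow> (f x, g x)" using c d by (intro tendsto_Pair)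
    moreover have "isCont (\<lambda>z. h (fst z) (snd z)) (f x, g x)"
      using h by (simp add: continuous_on_eq_continuous_at)
    ultimately show "(\<lambda>n. h (c (s n x)) (d (t n x))) \<longlonglongrightarrow> h (f x) (g x)"
      using isCont_tendsto_compose by fastforce
  qed
qed

lemma strongly_measurable_simple:
  assumes "simple_function M f" shows "strongly_measurable M f"
proof (rule strongly_measurableI)
  show "countable (f ` space M)" using simple_functionD(1)[OF assms] by (rule countable_finite)
  show "f ` space M \<subseteq> closure (f ` space M)" by (rule closure_subset)
qed (rule borel_measurable_simple_function[OF assms])

lemma strongly_measurable_const [simp]: "strongly_measurable M (\<lambda>_. c)"
  by (rule strongly_measurable_simple) simp

lemma strongly_measurable_If:
  assumes f: "strongly_measurable M f" and g: "strongly_measurable M g" and [measurable]: "Measurable.pred M P"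
  shows "strongly_measurable M (\<lambda>x. if P x then f x else g x)"
proof -
  obtain C D where C: "countable C" "f ` space M \<subseteq> closure C" "countable D" "g ` space M \<subseteq> closure D"
    using f g unfolding strongly_measurable_def by metis
  have [measurable]: "f \<in> borel_measurable M" "g \<in> borel_measurable M" using f g by (auto dest: strongly_measurableD)
  show ?thesis
  proof (rule strongly_measurableI)
    show "countable (C \<union> D)" using C by simp
    show "(\<lambda>x. if P x then f x else g x) ` space M \<subseteq> closure (C \<union> D)" using C by (auto simp: closure_Un)
  qed measurable
qed

lemma strongly_measurable_diff:
  fixes f g :: "'a \<Rightarrow> 'b::real_normed_vector"
  assumes "strongly_measurable M f" "strongly_measurable M g"
  shows "strongly_measurable M (\<lambda>x. f x - g x)"
  by (rule strongly_measurable_combine[OF assms]) (intro continuous_intros)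

lemma strongly_measurable_add:
  fixes f g :: "'a \<Rightarrow> 'b::real_normed_vector"
  assumes "strongly_measurable M f" "strongly_measurable M g"
  shows "strongly_measurable M (\<lambda>x. f x + g x)"
  by (rule strongly_measurable_combine[OF assms]) (intro continuous_intros)

lemma strongly_measurable_scaleR:
  fixes f :: "'a \<Rightarrow> 'b::real_normed_vector"
  assumes "strongly_measurable M f"
  shows "strongly_measurable M (\<lambda>x. a *\<^sub>R f x)"
  by (rule strongly_measurable_combine[OF assms assms, of "\<lambda>x y. a *\<^sub>R x"]) (intro continuous_intros)

lemma strongly_measurable_sum:
  fixes f :: "'i \<Rightarrow> 'a \<Rightarrow> 'b::real_normed_vector"
  assumes "finite I" "\<And>i. i \<in> I \<Longrightarrow> strongly_measurable M (f i)"
  shows "strongly_measurable M (\<lambda>x. \<Sum>i\<in>I. f i x)"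
  using assms by induction (auto intro: strongly_measurable_add)

lemma borel_measurable_norm_strongly:
  fixes f :: "'a \<Rightarrow> 'b::real_normed_vector"
  assumes "strongly_measurable M f"
  shows "(\<lambda>x. ennreal (norm (f x))) \<in> borel_measurable M"
proof -
  have "(\<lambda>x. norm (f x)) \<in> borel_measurable M"
    using strongly_measurableD[OF assms] borel_measurable_continuous_onI[OF continuous_on_norm_id]
    by (rule measurable_compose)
  then show ?thesis by measurable
qed

lemma borel_measurable_norm_diff_strongly:
  fixes f :: "'a \<Rightarrow> 'b::real_normed_vector"
  assumes "strongly_measurable M f" "strongly_measurable M g"
  shows "(\<lambda>x. ennreal (norm (f x - g x))) \<in> borel_measurable M"
  by (intro borel_measurable_norm_strongly strongly_measurable_diff assms)

definition ae_strongly_measurable :: "'a measure \<Rightarrow> ('a \<Rightarrow> 'b::metric_space) \<Rightarrow> bool" where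
  "ae_strongly_measurable M f \<longleftrightarrow> (\<exists>f'. strongly_measurable M f' \<and> (AE x in M. f x = f' x))"

text \<open>The axiom \<open>add\<close> asks for measurable summands, which the norm of a
  difference of Borel functions may fail to be. It is applied to strongly measurable versions, which
  \<open>N\<close> cannot distinguish from the given functions.\<close>

lemma (in function_norm) norm_triangle:
  fixes u v w :: "'w \<Rightarrow> 'b::real_normed_vector"
  assumes "ae_strongly_measurable M u" "ae_strongly_measurable M v" "ae_strongly_measurable M w"
  shows "N (\<lambda>x. ennreal (norm (u x - w x))) \<le>
    N (\<lambda>x. ennreal (norm (u x - v x))) + N (\<lambda>x. ennreal (norm (v x - w x)))"
proof -
  obtain u' v' w' where *: "strongly_measurable M u'" "strongly_measurable M v'" "strongly_measurable M w'"
    "AE x in M. u x = u' x" "AE x in M. v x = v' x" "AE x in M. w x = w' x"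
    using assms unfolding ae_strongly_measurable_def by metis
  have "N (\<lambda>x. ennreal (norm (u x - w x))) \<le> N (\<lambda>x. ennreal (norm (u' x - v' x)) + ennreal (norm (v' x - w' x)))"
    using *(4-6) by (intro mono_AE, eventually_elim)
      (metis (no_types, opaque_lifting) diff_add_cancel add_diff_eq ennreal_leI ennreal_plus norm_ge_zero norm_triangle_ineq)
  also have "\<dots> \<le> N (\<lambda>x. ennreal (norm (u' x - v' x))) + N (\<lambda>x. ennreal (norm (v' x - w' x)))"
    by (intro add borel_measurable_norm_diff_strongly *)
  also have "\<dots> = N (\<lambda>x. ennreal (norm (u x - v x))) + N (\<lambda>x. ennreal (norm (v x - w x)))"
    using *(4-6) by (intro arg_cong2[where f="(+)"] cong_AE; eventually_elim) auto
  finally show ?thesis .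
qed

text \<open>Two admissible representatives may have nonseparable values on a null set, and their
  difference may then fail to be measurable, so \<open>elems V\<close> need not be closed under
  subtraction. For this reason only the distance between elements is axiomatised.\<close>

locale pseudometric =
  fixes V :: "'v::minus seminormed"
  assumes nrm_self: "u \<in> elems V \<Longrightarrow> nrm V (u - u) = 0"
    and nrm_sym: "u \<in> elems V \<Longrightarrow> v \<in> elems V \<Longrightarrow> nrm V (u - v) = nrm V (v - u)"
    and nrm_tri: "u \<in> elems V \<Longrightarrow> v \<in> elems V \<Longrightarrow> w \<in> elems V \<Longrightarrow>
        nrm V (u - w) \<le> nrm V (u - v) + nrm V (v - w)"

text \<open>The points of \<open>C\<close> may lie outside \<open>A\<close>, so that the same
  \<open>C\<close> serves all subsets of \<open>A\<close> and unions of such sets serve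
  limits.\<close>

definition dense_in :: "'v::minus seminormed \<Rightarrow> 'v set \<Rightarrow> 'v set \<Rightarrow> bool" where
  "dense_in V C A \<longleftrightarrow> countable C \<and> C \<subseteq> elems V \<and> A \<subseteq> elems V \<and>
     (\<forall>a\<in>A. \<forall>e>0. \<exists>c\<in>C. nrm V (a - c) < e)"

lemma space_seminorm_borel [simp]: "space (seminorm_borel V) = elems V"
  unfolding seminorm_borel_def using openin_subset[of "seminorm_topology V"] by (subst space_measure_of) auto

lemma sets_seminorm_borel: "sets (seminorm_borel V) = sigma_sets (elems V) {U. openin (seminorm_topology V) U}"
  unfolding seminorm_borel_def using openin_subset[of "seminorm_topology V"] by (subst sets_measure_of) auto

lemma measurable_seminorm_borelI:
  assumes "\<And>x. x \<in> space M \<Longrightarrow> f x \<in> elems V"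
    "\<And>U. openin (seminorm_topology V) U \<Longrightarrow> f -` U \<inter> space M \<in> sets M"
  shows "f \<in> measurable M (seminorm_borel V)"
  unfolding seminorm_borel_def using openin_subset[of "seminorm_topology V"] assms
  by (intro measurable_measure_of) auto

lemma measurable_seminorm_borelD:
  assumes "f \<in> measurable M (seminorm_borel V)" "openin (seminorm_topology V) U"
  shows "f -` U \<inter> space M \<in> sets M"
  using assms by (intro measurable_sets[of f M "seminorm_borel V"]) (auto simp: sets_seminorm_borel)

lemma ennreal_two_inverse_Suc_less:
  fixes e :: ennreal
  assumes "e > 0"
  shows "\<exists>n. ennreal (1 / real (Suc n)) + ennreal (1 / real (Suc n)) < e"
proof (cases e)
  case (real r)
  then obtain n where n: "1 / real (Suc n) < r / 2" using assms nat_approx_posE[of "r / 2"] by auto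
  then have "1 / real (Suc n) + 1 / real (Suc n) < r" by linarith
  then have "ennreal (1 / real (Suc n) + 1 / real (Suc n)) < ennreal r" using real assms by (intro ennreal_lessI) auto
  then show ?thesis
    unfolding real(2) by (intro exI[of _ n]) (simp only: ennreal_plus divide_nonneg_nonneg of_nat_0_le_iff zero_le_one)
next
  case top then show ?thesis by (intro exI[of _ 0]) simp
qed

context pseudometric
begin

lemma openin_ball:
  assumes u: "u \<in> elems V"
  shows "openin (seminorm_topology V) {v \<in> elems V. nrm V (v - u) < e}"
  unfolding openin_seminorm_topology
proof (intro conjI ballI)
  fix v assume v: "v \<in> {v \<in> elems V. nrm V (v - u) < e}"
  have "w \<in> {v \<in> elems V. nrm V (v - u) < e}"
    if "w \<in> elems V" "nrm V (w - v) < e - nrm V (v - u)" for w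
  proof -
    have "nrm V (v - u) < top" using v order.strict_trans2[of _ e top] by auto
    then have "nrm V (w - v) + nrm V (v - u) < e"
      using that(2) by (simp add: less_diff_eq_ennreal)
    then show ?thesis using nrm_tri[of w v u] that(1) v u by auto
  qed
  then show "\<exists>d>0. \<forall>w\<in>elems V. nrm V (w - v) < d \<longrightarrow> w \<in> {v \<in> elems V. nrm V (v - u) < e}"
    using v by (intro exI[of _ "e - nrm V (v - u)"]) (auto simp: diff_gr0_ennreal)
qed auto

lemma nrm_diff_measurable:
  assumes "c \<in> elems V"
  shows "(\<lambda>v. nrm V (v - c)) \<in> borel_measurable (seminorm_borel V)"
proof (rule borel_measurableI_less)
  show "{v \<in> space (seminorm_borel V). nrm V (v - c) < e} \<in> sets (seminorm_borel V)" for e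
    using openin_ball[OF assms, of e] by (auto simp: sets_seminorm_borel)
qed

text \<open>\<open>separable_space\<close> asks for dense points in \<open>A\<close> itself. Each
  \<open>c\<close> is therefore replaced, for every radius \<open>1 / Suc n\<close> at which this is
  possible, by a point of \<open>A\<close> within that radius of \<open>c\<close>; this doubles the
  error.\<close>

lemma separable_inI:
  assumes "dense_in V C A" shows "separable_in V A"
proof -
  have C: "countable C" "C \<subseteq> elems V" "A \<subseteq> elems V" "\<And>a e. a \<in> A \<Longrightarrow> e > 0 \<Longrightarrow> \<exists>c\<in>C. nrm V (a - c) < e"
    using assms unfolding dense_in_def by auto
  define t where "t = (\<lambda>c n. SOME a. a \<in> A \<and> nrm V (a - c) < ennreal (1 / real (Suc n)))"
  define B where "B = {t c n | c n. c \<in> C \<and> (\<exists>a. a \<in> A \<and> nrm V (a - c) < ennreal (1 / real (Suc n)))}"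
  have t: "t c n \<in> A \<and> nrm V (t c n - c) < ennreal (1 / real (Suc n))"
    if "\<exists>a. a \<in> A \<and> nrm V (a - c) < ennreal (1 / real (Suc n))" for c n
    using someI_ex[OF that] by (simp add: t_def)
  have "B \<subseteq> (\<lambda>(c, n). t c n) ` (C \<times> UNIV)" by (auto simp: B_def)
  then have "countable B" by (rule countable_subset) (use C(1) in simp)
  moreover have BA: "B \<subseteq> A" using t by (auto simp: B_def)
  moreover have "(subtopology (seminorm_topology V) A) closure_of B = topspace (subtopology (seminorm_topology V) A)"
  proof (intro equalityI subsetI)
    fix a assume "a \<in> topspace (subtopology (seminorm_topology V) A)"
    then have a: "a \<in> A" "a \<in> elems V" by auto
    have "\<exists>b\<in>B. b \<in> U" if U: "openin (seminorm_topology V) U" "a \<in> U" for U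
    proof -
      obtain e where e: "e > 0" "\<And>v. v \<in> elems V \<Longrightarrow> nrm V (v - a) < e \<Longrightarrow> v \<in> U"
        using U unfolding openin_seminorm_topology by blast
      obtain n where n: "ennreal (1 / real (Suc n)) + ennreal (1 / real (Suc n)) < e"
        using ennreal_two_inverse_Suc_less[OF e(1)] by blast
      obtain c where c: "c \<in> C" "nrm V (a - c) < ennreal (1 / real (Suc n))" using C(4)[OF a(1), of "ennreal (1 / real (Suc n))"] by auto
      then have tc: "t c n \<in> A" "nrm V (t c n - c) < ennreal (1 / real (Suc n))" "t c n \<in> B"
        using t[of c n] a(1) by (auto simp: B_def)
      have "nrm V (t c n - a) \<le> nrm V (t c n - c) + nrm V (c - a)"
        using tc c C(2,3) a by (intro nrm_tri) auto
      also have "nrm V (c - a) = nrm V (a - c)" using c C(2) a by (intro nrm_sym) auto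
      also have "nrm V (t c n - c) + nrm V (a - c) \<le> ennreal (1 / real (Suc n)) + ennreal (1 / real (Suc n))"
        using tc c by (intro add_mono) auto
      finally have "nrm V (t c n - a) < e" using n by (rule order.strict_trans1)
      then show ?thesis using e(2)[of "t c n"] tc C(3) by blast
    qed
    then show "a \<in> (subtopology (seminorm_topology V) A) closure_of B"
      using a BA by (auto simp: in_closure_of openin_subtopology)
  qed (rule subsetD[OF closure_of_subset_topspace])
  ultimately show ?thesis
    unfolding separable_in_def separable_space_def using C(3) by (intro exI[of _ B]) auto
qed

lemma separable_inD:
  assumes "separable_in V A" "A \<subseteq> elems V"
  obtains C where "dense_in V C A" "C \<subseteq> A"
proof -
  obtain C where C: "countable C" "C \<subseteq> A"
    "(subtopology (seminorm_topology V) A) closure_of C = A"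
    using assms unfolding separable_in_def separable_space_def by (auto simp: Int_absorb1)
  have "\<exists>c\<in>C. nrm V (a - c) < e" if a: "a \<in> A" and e: "e > 0" for a e
  proof -
    have a': "a \<in> elems V" using a assms by auto
    have "openin (subtopology (seminorm_topology V) A) (A \<inter> {v \<in> elems V. nrm V (v - a) < e})"
      using openin_ball[OF a', of e] by (auto simp: openin_subtopology)
    moreover have "a \<in> A \<inter> {v \<in> elems V. nrm V (v - a) < e}" using a a' e nrm_self by auto
    moreover have "a \<in> (subtopology (seminorm_topology V) A) closure_of C" using C(3) a by simp
    ultimately have "\<exists>c. c \<in> C \<and> c \<in> A \<inter> {v \<in> elems V. nrm V (v - a) < e}"
      unfolding in_closure_of by meson
    then obtain c where c: "c \<in> C" "nrm V (c - a) < e" "c \<in> elems V" by auto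
    have "nrm V (a - c) < e" unfolding nrm_sym[OF a' c(3)] by (rule c(2))
    then show ?thesis using c(1) by blast
  qed
  then have "dense_in V C A" using C(1,2) assms(2) unfolding dense_in_def by blast
  then show thesis using C(2) by (rule that)
qed

text \<open>The preimage of an open set is a countable union of preimages of balls about points of
  \<open>C\<close>, so the distances to these points decide measurability.\<close>

lemma measurable_if_dense:
  assumes d: "dense_in V C (\<Phi> ` space M)"
    and m: "\<And>c. c \<in> C \<Longrightarrow> (\<lambda>x. nrm V (\<Phi> x - c)) \<in> borel_measurable M"
  shows "\<Phi> \<in> measurable M (seminorm_borel V)"
proof (rule measurable_seminorm_borelI)
  have C: "countable C" "C \<subseteq> elems V" "\<And>x. x \<in> space M \<Longrightarrow> \<Phi> x \<in> elems V"
      "\<And>x e. x \<in> space M \<Longrightarrow> e > 0 \<Longrightarrow> \<exists>c\<in>C. nrm V (\<Phi> x - c) < e"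
    using d unfolding dense_in_def by auto
  show "x \<in> space M \<Longrightarrow> \<Phi> x \<in> elems V" for x by (rule C)
  fix U assume U: "openin (seminorm_topology V) U"
  let ?r = "\<lambda>k. ennreal (1 / real (Suc k))"
  define I where "I = {(c, k) \<in> C \<times> UNIV. {v \<in> elems V. nrm V (v - c) < ?r k} \<subseteq> U}"
  have "\<Phi> -` U \<inter> space M = (\<Union>(c, k)\<in>I. {x \<in> space M. nrm V (\<Phi> x - c) < ?r k})"
  proof (intro equalityI subsetI)
    fix x assume x: "x \<in> \<Phi> -` U \<inter> space M"
    then obtain e where e: "e > 0" "\<And>v. v \<in> elems V \<Longrightarrow> nrm V (v - \<Phi> x) < e \<Longrightarrow> v \<in> U"
      using U unfolding openin_seminorm_topology by blast
    obtain k where k: "?r k + ?r k < e"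
      using ennreal_two_inverse_Suc_less[OF e(1)] by blast
    obtain c where c: "c \<in> C" "nrm V (\<Phi> x - c) < ?r k" using C(4)[of x "?r k"] x by auto
    have "v \<in> U" if v: "v \<in> elems V" "nrm V (v - c) < ?r k" for v
    proof (rule e(2)[OF v(1)])
      have "nrm V (v - \<Phi> x) \<le> nrm V (v - c) + nrm V (c - \<Phi> x)"
        using v c C x by (intro nrm_tri) auto
      also have "nrm V (c - \<Phi> x) = nrm V (\<Phi> x - c)" using c C x by (intro nrm_sym) auto
      also have "nrm V (v - c) + nrm V (\<Phi> x - c) \<le> ?r k + ?r k" using v c by (intro add_mono) auto
      finally show "nrm V (v - \<Phi> x) < e" using k by simp
    qed
    then have "(c, k) \<in> I" using c by (auto simp: I_def)
    then show "x \<in> (\<Union>(c, k)\<in>I. {x \<in> space M. nrm V (\<Phi> x - c) < ?r k})" using c x by auto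
  next
    fix x assume "x \<in> (\<Union>(c, k)\<in>I. {x \<in> space M. nrm V (\<Phi> x - c) < ?r k})"
    then show "x \<in> \<Phi> -` U \<inter> space M" using C(3) by (auto simp: I_def)
  qed
  moreover have "countable I"
    by (rule countable_subset[of _ "C \<times> UNIV"]) (use C(1) in \<open>auto simp: I_def\<close>)
  ultimately show "\<Phi> -` U \<inter> space M \<in> sets M"
    using m by (auto simp: I_def intro!: sets.countable_UN' borel_measurable_less)
qed

text \<open>The distance is the infimum of
  \<open>nrm V (\<Phi> x - c) + nrm V (\<Psi> x - c)\<close> over the countable set
  \<open>C\<close>, so density for the range of one of the two maps suffices.\<close>

lemma nrm_diff_measurable2:
  assumes \<Phi>: "\<Phi> \<in> measurable M (seminorm_borel V)" and \<Psi>: "\<Psi> \<in> measurable M (seminorm_borel V)"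
    and d: "dense_in V C (\<Phi> ` space M)"
  shows "(\<lambda>x. nrm V (\<Phi> x - \<Psi> x)) \<in> borel_measurable M"
proof -
  have C: "countable C" "C \<subseteq> elems V" "\<And>x. x \<in> space M \<Longrightarrow> \<Phi> x \<in> elems V"
      "\<And>x e. x \<in> space M \<Longrightarrow> e > 0 \<Longrightarrow> \<exists>c\<in>C. nrm V (\<Phi> x - c) < e"
    using d unfolding dense_in_def by auto
  have \<Psi>V: "x \<in> space M \<Longrightarrow> \<Psi> x \<in> elems V" for x using measurable_space[OF \<Psi>] by auto
  have "nrm V (\<Phi> x - \<Psi> x) = (INF c\<in>C. nrm V (\<Phi> x - c) + nrm V (\<Psi> x - c))" if x: "x \<in> space M" for x
  proof (rule antisym)
    show "nrm V (\<Phi> x - \<Psi> x) \<le> (INF c\<in>C. nrm V (\<Phi> x - c) + nrm V (\<Psi> x - c))"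
    proof (rule INF_greatest)
      fix c assume c: "c \<in> C"
      then have "c \<in> elems V" using C by auto
      then show "nrm V (\<Phi> x - \<Psi> x) \<le> nrm V (\<Phi> x - c) + nrm V (\<Psi> x - c)"
        using nrm_tri[of "\<Phi> x" c "\<Psi> x"] nrm_sym[of "\<Psi> x" c] C(3) \<Psi>V x by auto
    qed
    show "(INF c\<in>C. nrm V (\<Phi> x - c) + nrm V (\<Psi> x - c)) \<le> nrm V (\<Phi> x - \<Psi> x)"
    proof (rule ennreal_le_epsilon)
      fix e :: real assume e: "e > 0"
      obtain c where c: "c \<in> C" "nrm V (\<Phi> x - c) < ennreal (e / 2)" using C(4)[OF x, of "ennreal (e / 2)"] e by auto
      then have cV: "c \<in> elems V" using C by auto
      have "(INF c\<in>C. nrm V (\<Phi> x - c) + nrm V (\<Psi> x - c)) \<le> nrm V (\<Phi> x - c) + nrm V (\<Psi> x - c)"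
        using c by (intro INF_lower)
      also have "\<dots> \<le> nrm V (\<Phi> x - c) + (nrm V (\<Psi> x - \<Phi> x) + nrm V (\<Phi> x - c))"
        using cV C(3) \<Psi>V x by (intro add_left_mono nrm_tri) auto
      also have "nrm V (\<Psi> x - \<Phi> x) = nrm V (\<Phi> x - \<Psi> x)"
        using C(3) \<Psi>V x by (intro nrm_sym) auto
      also have "nrm V (\<Phi> x - c) + (nrm V (\<Phi> x - \<Psi> x) + nrm V (\<Phi> x - c)) \<le>
          ennreal (e / 2) + (nrm V (\<Phi> x - \<Psi> x) + ennreal (e / 2))"
        using c by (intro add_mono) auto
      also have "\<dots> = nrm V (\<Phi> x - \<Psi> x) + (ennreal (e / 2) + ennreal (e / 2))" by (simp add: ac_simps)
      also have "ennreal (e / 2) + ennreal (e / 2) = ennreal e" using e by (simp add: ennreal_plus[symmetric] del: ennreal_plus)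
      finally show "(INF c\<in>C. nrm V (\<Phi> x - c) + nrm V (\<Psi> x - c)) \<le> nrm V (\<Phi> x - \<Psi> x) + ennreal e" .
    qed
  qed
  moreover have "(\<lambda>x. INF c\<in>C. nrm V (\<Phi> x - c) + nrm V (\<Psi> x - c)) \<in> borel_measurable M"
    using C by (intro borel_measurable_INF borel_measurable_add)
      (auto intro!: measurable_compose[OF \<Phi> nrm_diff_measurable] measurable_compose[OF \<Psi> nrm_diff_measurable])
  ultimately show ?thesis by (simp cong: measurable_cong)
qed

lemma nrm_diff_tendsto:
  assumes lim: "(\<lambda>n. nrm V (u n - v)) \<longlonglongrightarrow> 0" and u: "\<And>n. u n \<in> elems V" and v: "v \<in> elems V" and c: "c \<in> elems V"
  shows "(\<lambda>n. nrm V (u n - c)) \<longlonglongrightarrow> nrm V (v - c)"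
proof (rule tendsto_sandwich)
  show "\<forall>\<^sub>F n in sequentially. nrm V (v - c) - nrm V (u n - v) \<le> nrm V (u n - c)"
    using order_tendstoD(2)[OF lim, of 1, simplified]
  proof eventually_elim
    fix n
    assume "nrm V (u n - v) < 1"
    then have "nrm V (u n - v) < top" by (rule less_trans) simp
    moreover have "nrm V (v - c) \<le> nrm V (u n - v) + nrm V (u n - c)"
      using nrm_tri[OF v u c, of n] nrm_sym[OF v u, of n] by simp
    ultimately show "nrm V (v - c) - nrm V (u n - v) \<le> nrm V (u n - c)" by (auto simp: ennreal_minus_le_iff)
  qed
  show "\<forall>\<^sub>F n in sequentially. nrm V (u n - c) \<le> nrm V (u n - v) + nrm V (v - c)"
    using nrm_tri[OF u v c] by (intro always_eventually) auto
  show "(\<lambda>n. nrm V (u n - v) + nrm V (v - c)) \<longlonglongrightarrow> nrm V (v - c)"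
    using tendsto_add[OF lim tendsto_const[of "nrm V (v - c)"]] by simp
  show "(\<lambda>n. nrm V (v - c) - nrm V (u n - v)) \<longlonglongrightarrow> nrm V (v - c)"
    using tendsto_diff_ennreal_general[OF tendsto_const lim] by simp
qed

lemma dense_in_LIMSEQ:
  assumes lim: "\<And>x. x \<in> S \<Longrightarrow> (\<lambda>n. nrm V (\<Phi> n x - \<Psi> x)) \<longlonglongrightarrow> 0"
    and \<Psi>: "\<And>x. x \<in> S \<Longrightarrow> \<Psi> x \<in> elems V"
    and d: "\<And>n. dense_in V (C n) (\<Phi> n ` S)"
  shows "dense_in V (\<Union>n. C n) (\<Psi> ` S)"
proof -
  have "\<exists>c\<in>\<Union> (range C). nrm V (\<Psi> x - c) < e" if x: "x \<in> S" and e: "e > 0" for x e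
  proof -
    have \<Phi>: "\<Phi> n x \<in> elems V" for n using d[of n] x by (auto simp: dense_in_def)
    obtain n where n: "nrm V (\<Phi> n x - \<Psi> x) < e"
      using order_tendstoD(2)[OF lim[OF x] e] eventually_sequentially by auto
    obtain c where c: "c \<in> C n" "nrm V (\<Phi> n x - c) < e - nrm V (\<Phi> n x - \<Psi> x)" "c \<in> elems V"
      using d[of n] x n unfolding dense_in_def by (metis diff_gr0_ennreal image_eqI subsetD)
    have "nrm V (\<Psi> x - c) \<le> nrm V (\<Phi> n x - \<Psi> x) + nrm V (\<Phi> n x - c)"
      using nrm_tri[OF \<Psi>[OF x] \<Phi> c(3), of n] nrm_sym[OF \<Psi>[OF x] \<Phi>, of n] by simp
    also have "\<dots> < e"
    proof -
      have "nrm V (\<Phi> n x - \<Psi> x) < top" using n order.strict_trans2[of _ e top] by auto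
      then show ?thesis using c(2) by (simp add: less_diff_eq_ennreal add.commute)
    qed
    finally show ?thesis using c(1) by auto
  qed
  moreover have "countable (\<Union>n. C n)" "(\<Union>n. C n) \<subseteq> elems V" using d unfolding dense_in_def by blast+
  ultimately show ?thesis using \<Psi> by (auto simp: dense_in_def)
qed

text \<open>Distances to fixed points pass to the limit, and the union of the sets
  \<open>C n\<close> is dense for the range of the limit.\<close>

lemma measurable_LIMSEQ:
  assumes lim: "\<And>x. x \<in> space M \<Longrightarrow> (\<lambda>n. nrm V (\<Phi> n x - \<Psi> x)) \<longlonglongrightarrow> 0"
    and \<Psi>: "\<And>x. x \<in> space M \<Longrightarrow> \<Psi> x \<in> elems V"
    and m: "\<And>n. \<Phi> n \<in> measurable M (seminorm_borel V)"
    and d: "\<And>n. dense_in V (C n) (\<Phi> n ` space M)"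
  shows "\<Psi> \<in> measurable M (seminorm_borel V)"
proof (rule measurable_if_dense[OF dense_in_LIMSEQ[OF lim \<Psi> d]])
  fix c assume "c \<in> (\<Union>n. C n)"
  then have c: "c \<in> elems V" using d unfolding dense_in_def by blast
  show "(\<lambda>x. nrm V (\<Psi> x - c)) \<in> borel_measurable M"
  proof (rule borel_measurable_LIMSEQ_order)
    show "(\<lambda>n. nrm V (\<Phi> n x - c)) \<longlonglongrightarrow> nrm V (\<Psi> x - c)" if "x \<in> space M" for x
      using that lim \<Psi> measurable_space[OF m] c by (intro nrm_diff_tendsto) auto
    show "(\<lambda>x. nrm V (\<Phi> n x - c)) \<in> borel_measurable M" for n
      by (rule measurable_compose[OF m nrm_diff_measurable[OF c]])
  qed
qed

end

lemma dense_in_subset: "dense_in V C A \<Longrightarrow> B \<subseteq> A \<Longrightarrow> dense_in V C B"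
  by (auto simp: dense_in_def)

lemma (in pseudometric) dense_in_insert:
  assumes "dense_in V C A" "z \<in> elems V"
  shows "dense_in V (insert z C) (insert z A)"
  unfolding dense_in_def
proof (intro conjI ballI allI impI)
  fix a and e :: ennreal assume "a \<in> insert z A" "0 < e"
  then show "\<exists>c\<in>insert z C. nrm V (a - c) < e"
    using assms nrm_self[of z] unfolding dense_in_def by auto
qed (use assms in \<open>auto simp: dense_in_def\<close>)

lemma elems_normed_type [simp]: "elems normed_type = UNIV"
  and nrm_normed_type [simp]: "nrm normed_type v = ennreal (norm v)"
  by (simp_all add: normed_type_def)

lemma measurable_normed_type: "measurable M (seminorm_borel normed_type) = borel_measurable M"
  by (rule measurable_cong_sets) (simp_all add: sets_seminorm_borel_normed_type)

interpretation normed_type: pseudometric "normed_type :: 'v::real_normed_vector seminormed"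
  by standard (simp_all add: norm_minus_commute ennreal_plus[symmetric] ennreal_leI norm_triangle_ineq
      norm_diff_triangle_ineq del: ennreal_plus,
      metis diff_add_cancel add_diff_eq norm_triangle_ineq)

lemma separable_in_normed_typeD:
  assumes "separable_in normed_type A"
  obtains C where "countable C" "A \<subseteq> closure C"
proof -
  obtain C where C: "dense_in normed_type C A" using normed_type.separable_inD[OF assms] by auto
  have "A \<subseteq> closure C"
  proof
    fix a assume a: "a \<in> A"
    show "a \<in> closure C"
      unfolding closure_approachable
    proof (intro allI impI)
      fix e :: real assume "e > 0"
      then obtain c where "c \<in> C" "ennreal (norm (a - c)) < ennreal e"
        using C a unfolding dense_in_def by (metis ennreal_less_zero_iff nrm_normed_type)
      then show "\<exists>c\<in>C. dist c a < e" by (auto simp: dist_norm norm_minus_commute ennreal_less_iff)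
    qed
  qed
  then show thesis using C that by (auto simp: dense_in_def)
qed

lemma separable_in_normed_typeI:
  assumes "countable C" "A \<subseteq> closure C"
  shows "separable_in normed_type A"
proof (rule normed_type.separable_inI)
  show "dense_in normed_type C A"
    unfolding dense_in_def
  proof (intro conjI ballI allI impI)
    fix a and e :: ennreal assume a: "a \<in> A" "e > 0"
    then obtain d :: real where d: "d > 0" "ennreal d < e"
    proof -
      obtain z where "0 < z" "z < e" using dense[OF a(2)] by blast
      then show thesis using that[of "enn2real z"] by (cases z) auto
    qed
    moreover have "a \<in> closure C" using assms(2) a by auto
    ultimately obtain c where c: "c \<in> C" "dist c a < d" unfolding closure_approachable by blast
    have "ennreal (norm (a - c)) < ennreal d"
      using c(2) d(1) by (intro ennreal_lessI) (auto simp: dist_norm norm_minus_commute)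
    then show "\<exists>c\<in>C. nrm normed_type (a - c) < e"
      using c(1) d(2) by (intro bexI[of _ c]) auto
  qed (use assms in auto)
qed

text \<open>Open sets do not separate points at distance zero, so both maps have the same preimages
  of open sets. This allows a change of representatives without any separability.\<close>

lemma measurable_seminorm_borel_saturated:
  assumes \<Phi>: "\<Phi> \<in> measurable M (seminorm_borel V)"
    and eq: "\<And>x. x \<in> space M \<Longrightarrow> \<Psi> x \<in> elems V \<and> nrm V (\<Psi> x - \<Phi> x) = 0 \<and> nrm V (\<Phi> x - \<Psi> x) = 0"
  shows "\<Psi> \<in> measurable M (seminorm_borel V)"
proof (rule measurable_seminorm_borelI)
  show "x \<in> space M \<Longrightarrow> \<Psi> x \<in> elems V" for x using eq by blast
  fix U assume U: "openin (seminorm_topology V) U"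
  have "\<Psi> x \<in> U \<longleftrightarrow> \<Phi> x \<in> U" if x: "x \<in> space M" for x
    using U eq[OF x] measurable_space[OF \<Phi> x] unfolding openin_seminorm_topology by force
  then have "\<Psi> -` U \<inter> space M = \<Phi> -` U \<inter> space M" by auto
  then show "\<Psi> -` U \<inter> space M \<in> sets M" using measurable_seminorm_borelD[OF \<Phi> U] by simp
qed

section \<open>Functions of a simple parameter\<close>

lemma measurable_simple_function_range:
  assumes "simple_function M t"
  shows "t \<in> measurable M (count_space (t ` space M))"
  unfolding measurable_count_space_eq2[OF simple_functionD(1)[OF assms]]
  by (intro conjI ballI simple_functionD(2)[OF assms]) simp

text \<open>No structure on the space of parameters is involved: \<open>t\<close> takes finitely
  many values, and on each piece the function is a measurable \<open>h v\<close>. In this way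
  expressions in the step functions become jointly measurable.\<close>

lemma measurable_simple_param:
  assumes t: "simple_function M t" and h: "\<And>v. v \<in> t ` space M \<Longrightarrow> (\<lambda>x. h v x) \<in> measurable M N"
  shows "(\<lambda>x. h (t x) x) \<in> measurable M N"
  by (rule measurable_compose_countable'[OF h measurable_simple_function_range[OF t]
      countable_finite[OF simple_functionD(1)[OF t]]])

lemma strongly_measurable_simple_param:
  assumes t: "simple_function M t" and h: "\<And>v. v \<in> t ` space M \<Longrightarrow> strongly_measurable M (\<lambda>x. h v x)"
  shows "strongly_measurable M (\<lambda>x. h (t x) x)"
proof -
  obtain C where C: "\<And>v. v \<in> t ` space M \<Longrightarrow> countable (C v) \<and> h v ` space M \<subseteq> closure (C v)"
    using h unfolding strongly_measurable_def by metis
  show ?thesis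
  proof (rule strongly_measurableI)
    show "(\<lambda>x. h (t x) x) \<in> borel_measurable M"
      by (rule measurable_simple_param[OF t strongly_measurableD[OF h]])
    show "countable (\<Union>v\<in>t ` space M. C v)"
      by (rule countable_UN[OF countable_finite[OF simple_functionD(1)[OF t]]]) (use C in blast)
    show "(\<lambda>x. h (t x) x) ` space M \<subseteq> closure (\<Union>v\<in>t ` space M. C v)"
    proof
      fix z assume "z \<in> (\<lambda>x. h (t x) x) ` space M"
      then obtain x where x: "x \<in> space M" "z = h (t x) x" by auto
      have "closure (C (t x)) \<subseteq> closure (\<Union>v\<in>t ` space M. C v)"
        using x by (intro closure_mono) auto
      then show "z \<in> closure (\<Union>v\<in>t ` space M. C v)" using C[of "t x"] x by auto
    qed
  qed
qed

lemma simple_function_comp_measurable: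
  assumes t: "simple_function M t" and f: "f \<in> measurable N M"
  shows "simple_function N (\<lambda>x. t (f x))"
proof -
  have "finite ((\<lambda>x. t (f x)) ` space N)"
    by (rule finite_subset[OF image_subsetI simple_functionD(1)[OF t]]) (intro imageI measurable_space[OF f])
  moreover have "(\<lambda>x. t (f x)) -` {v} \<inter> space N \<in> sets N" for v
  proof -
    have "(\<lambda>x. t (f x)) -` {v} \<inter> space N = f -` (t -` {v} \<inter> space M) \<inter> space N"
      using measurable_space[OF f] by auto
    then show ?thesis using measurable_sets[OF f simple_functionD(2)[OF t]] by simp
  qed
  ultimately show ?thesis by (simp add: simple_function_def)
qed

lemma nn_integral_simple_compose:
  assumes t: "simple_function M t"
  shows "(\<integral>\<^sup>+y. h (t y) \<partial>M) = (\<Sum>v\<in>t ` space M. h v * emeasure M {y \<in> space M. t y = v})"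
proof -
  have "(\<integral>\<^sup>+y. h (t y) \<partial>M) = integral\<^sup>S M (\<lambda>y. h (t y))"
    by (rule nn_integral_eq_simple_integral[OF simple_function_compose1[OF t]])
  also have "\<dots> = (\<Sum>v\<in>t ` space M. h v * emeasure M {y \<in> space M. t y = v})"
    by (rule simple_function_partition[OF simple_function_compose1[OF t] t]) auto
  finally show ?thesis .
qed

text \<open>Minkowski's integral inequality when \<open>y\<close> enters through finitely many
  values: the integral is a finite sum with constant weights, possibly infinite, so
  \<open>sum\<close> and \<open>cmult\<close> suffice.\<close>

lemma (in function_norm) nn_integral_step:
  assumes t: "simple_function G t" and h: "\<And>v. v \<in> t ` space G \<Longrightarrow> h v \<in> borel_measurable M"
  shows "(\<lambda>w. \<integral>\<^sup>+y. h (t y) w \<partial>G) \<in> borel_measurable M"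
    and "N (\<lambda>w. \<integral>\<^sup>+y. h (t y) w \<partial>G) \<le> (\<integral>\<^sup>+y. N (h (t y)) \<partial>G)"
proof -
  have eq: "(\<integral>\<^sup>+y. h (t y) w \<partial>G) = (\<Sum>v\<in>t ` space G. emeasure G {y \<in> space G. t y = v} * h v w)" for w
    using nn_integral_simple_compose[OF t, of "\<lambda>v. h v w"] by (simp add: mult.commute)
  show "(\<lambda>w. \<integral>\<^sup>+y. h (t y) w \<partial>G) \<in> borel_measurable M"
    unfolding eq using h by (intro borel_measurable_sum borel_measurable_times) auto
  have "N (\<lambda>w. \<integral>\<^sup>+y. h (t y) w \<partial>G) \<le> (\<Sum>v\<in>t ` space G. N (\<lambda>w. emeasure G {y \<in> space G. t y = v} * h v w))"
    unfolding eq using h t by (intro sum borel_measurable_times) (auto dest: simple_functionD)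
  also have "\<dots> = (\<Sum>v\<in>t ` space G. N (h v) * emeasure G {y \<in> space G. t y = v})"
    by (intro sum.cong refl) (subst cmult[OF h], auto simp: mult.commute)
  also have "\<dots> = (\<integral>\<^sup>+y. N (h (t y)) \<partial>G)"
    by (rule nn_integral_simple_compose[OF t, symmetric])
  finally show "N (\<lambda>w. \<integral>\<^sup>+y. h (t y) w \<partial>G) \<le> (\<integral>\<^sup>+y. N (h (t y)) \<partial>G)" .
qed

lemma (in function_norm) nn_integral_suminf_step:
  fixes t :: "nat \<Rightarrow> 'y \<Rightarrow> 'i"
  assumes t: "\<And>m. simple_function G (t m)"
    and h: "\<And>m v. v \<in> t m ` space G \<Longrightarrow> h v \<in> borel_measurable M"
    and Gm: "\<And>m w. (\<lambda>y. h (t m y) w) \<in> borel_measurable G"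
  shows "(\<lambda>w. \<integral>\<^sup>+y. (\<Sum>m. h (t m y) w) \<partial>G) \<in> borel_measurable M"
    and "N (\<lambda>w. \<integral>\<^sup>+y. (\<Sum>m. h (t m y) w) \<partial>G) \<le> (\<Sum>m. \<integral>\<^sup>+y. N (h (t m y)) \<partial>G)"
proof -
  have eq: "(\<integral>\<^sup>+y. (\<Sum>m. h (t m y) w) \<partial>G) = (\<Sum>m. \<integral>\<^sup>+y. h (t m y) w \<partial>G)" for w
    by (rule nn_integral_suminf[OF Gm])
  show "(\<lambda>w. \<integral>\<^sup>+y. (\<Sum>m. h (t m y) w) \<partial>G) \<in> borel_measurable M"
    unfolding eq using nn_integral_step(1)[OF t h] by measurable
  have "N (\<lambda>w. \<integral>\<^sup>+y. (\<Sum>m. h (t m y) w) \<partial>G) \<le> (\<Sum>m. N (\<lambda>w. \<integral>\<^sup>+y. h (t m y) w \<partial>G))"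
    unfolding eq by (intro suminf nn_integral_step(1)[OF t h])
  also have "\<dots> \<le> (\<Sum>m. \<integral>\<^sup>+y. N (h (t m y)) \<partial>G)"
    by (intro suminf_le nn_integral_step(2)[OF t h]) auto
  finally show "N (\<lambda>w. \<integral>\<^sup>+y. (\<Sum>m. h (t m y) w) \<partial>G) \<le> (\<Sum>m. \<integral>\<^sup>+y. N (h (t m y)) \<partial>G)" .
qed

section \<open>Bochner integrals in arbitrary Banach spaces\<close>

lemma ennreal_suminf_tail:
  fixes a :: "nat \<Rightarrow> ennreal"
  assumes "(\<Sum>m. a m) < \<infinity>"
  shows "(\<lambda>n. \<Sum>m. a (m + n)) \<longlonglongrightarrow> 0"
proof -
  have "a m < \<infinity>" for m
    using sum_le_suminf[of a "{m}"] assms by (auto intro: le_less_trans)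
  then have b: "a m = ennreal (b m)" "b m \<ge> 0" if "b = (\<lambda>m. enn2real (a m))" for m b
    using that by auto
  define b where "b = (\<lambda>m. enn2real (a m))"
  note b = b[OF b_def]
  have s: "summable b" using assms b by (intro summable_suminf_not_top) auto
  have "(\<lambda>n. suminf b - (\<Sum>m<n. b m)) \<longlonglongrightarrow> suminf b - suminf b"
    by (intro tendsto_diff tendsto_const summable_LIMSEQ s)
  then have "(\<lambda>n. \<Sum>m. b (m + n)) \<longlonglongrightarrow> 0" using suminf_minus_initial_segment[OF s] by simp
  then have "(\<lambda>n. ennreal (\<Sum>m. b (m + n))) \<longlonglongrightarrow> ennreal 0" by (intro tendsto_ennrealI)
  moreover have "(\<Sum>m. a (m + n)) = ennreal (\<Sum>m. b (m + n))" for n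
    unfolding b(1) using b(2) summable_ignore_initial_segment[OF s, of n] by (intro suminf_ennreal2) auto
  ultimately show ?thesis by simp
qed

text \<open>Completeness gives convergence from absolutely summable increments. The tail bound is
  kept as a series in \<open>ennreal\<close>, the form in which it is integrated later.\<close>

lemma LIMSEQ_if_suminf_norm:
  fixes u :: "nat \<Rightarrow> 'e::banach"
  assumes fin: "(\<Sum>m. ennreal (norm (u (Suc m) - u m))) < \<infinity>"
  shows "u \<longlonglongrightarrow> lim u"
    and "ennreal (norm (lim u - u n)) \<le> (\<Sum>m. ennreal (norm (u (Suc (m + n)) - u (m + n))))"
proof -
  have "summable (\<lambda>m. norm (u (Suc m) - u m))"
    using fin by (intro summable_suminf_not_top) auto
  then have "summable (\<lambda>m. u (Suc m) - u m)" by (rule summable_norm_cancel)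
  then have "(\<lambda>n. (\<Sum>m<n. u (Suc m) - u m) + u 0) \<longlonglongrightarrow> suminf (\<lambda>m. u (Suc m) - u m) + u 0"
    by (intro tendsto_add tendsto_const summable_LIMSEQ)
  then have "convergent u" by (auto simp: sum_lessThan_telescope convergent_def)
  then show u: "u \<longlonglongrightarrow> lim u" by (simp add: convergent_LIMSEQ_iff)
  have "(\<lambda>k. ennreal (norm (u (k + n) - u n))) \<longlonglongrightarrow> ennreal (norm (lim u - u n))"
    by (intro tendsto_ennrealI tendsto_norm tendsto_diff tendsto_const LIMSEQ_ignore_initial_segment u)
  then show "ennreal (norm (lim u - u n)) \<le> (\<Sum>m. ennreal (norm (u (Suc (m + n)) - u (m + n))))"
  proof (rule LIMSEQ_le_const2, intro exI allI impI)
    fix k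
    have "u (k + n) - u n = (\<Sum>m<k. u (Suc (m + n)) - u (m + n))"
      using sum_lessThan_telescope[of "\<lambda>m. u (m + n)" k] by simp
    then have "ennreal (norm (u (k + n) - u n)) \<le> ennreal (\<Sum>m<k. norm (u (Suc (m + n)) - u (m + n)))"
      by (simp only: ennreal_leI norm_sum)
    also have "\<dots> = (\<Sum>m<k. ennreal (norm (u (Suc (m + n)) - u (m + n))))" by (simp add: sum_ennreal)
    also have "\<dots> \<le> (\<Sum>m. ennreal (norm (u (Suc (m + n)) - u (m + n))))" by (intro sum_le_suminf) auto
    finally show "ennreal (norm (u (k + n) - u n)) \<le> (\<Sum>m. ennreal (norm (u (Suc (m + n)) - u (m + n))))" .
  qed
qed

lemma elems_L1_normed_type_iff:
  "f \<in> elems (L1 M normed_type) \<longleftrightarrow> f \<in> borel_measurable M \<and>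
     (\<exists>s. (\<forall>i::nat. simple_function M (s i)) \<and> (\<lambda>i. \<integral>\<^sup>+y. ennreal (norm (f y - s i y)) \<partial>M) \<longlonglongrightarrow> 0)"
  unfolding L1_def measurable_normed_type by auto

lemma nrm_L1: "nrm (L1 M V) f = (\<integral>\<^sup>+y. nrm V (f y) \<partial>M)"
  by (simp add: L1_def)

lemma function_norm_nn_integral: "function_norm M (nn_integral M)"
proof -
  have "Lnorm M 1 = nn_integral M" by (simp add: Lnorm_def fun_eq_iff)
  then show ?thesis using function_norm_Lnorm[of 1 M] by simp
qed

text \<open>\<open>f\<close> is merely Borel, and a difference of Borel functions can fail to be
  Borel; here a constant is subtracted on each of finitely many pieces.\<close>

lemma borel_measurable_norm_diff_simple:
  fixes f :: "'a \<Rightarrow> 'b::real_normed_vector"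
  assumes f: "f \<in> borel_measurable M" and s: "simple_function M s"
  shows "(\<lambda>y. ennreal (norm (f y - s y))) \<in> borel_measurable M"
proof (rule measurable_simple_param[OF s])
  fix v
  have "(\<lambda>y. norm (f y - v)) \<in> borel_measurable M"
    by (rule measurable_compose[OF f borel_measurable_continuous_onI]) (intro continuous_intros)
  then show "(\<lambda>y. ennreal (norm (f y - v))) \<in> borel_measurable M" by measurable
qed

lemma LIMSEQ_zero_select:
  fixes a :: "nat \<Rightarrow> ennreal" and c :: "nat \<Rightarrow> ennreal"
  assumes "a \<longlonglongrightarrow> 0" "\<And>k. c k > 0"
  obtains r :: "nat \<Rightarrow> nat" where "\<And>k. a (r k) < c k"
proof -
  have "\<exists>n. a n < c k" for k
    using order_tendstoD(2)[OF assms(1,2), of k] by (auto simp: eventually_sequentially)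
  then show thesis using that by metis
qed

lemma suminf_half_power: "(\<Sum>k. ennreal ((1 / 2) ^ k)) = 2"
proof -
  have "(\<Sum>k. (1 / 2 :: real) ^ k) = 2" by (subst suminf_geometric) auto
  then show ?thesis by (subst suminf_ennreal2) (auto simp: summable_geometric)
qed

text \<open>A subsequence of the approximating simple functions with geometric errors converges
  almost everywhere by monotone convergence. On the measurable set \<open>A\<close> of convergence
  the limit has separable range; elsewhere it is replaced by zero.\<close>

lemma elems_L1_ae_strongly:
  fixes f :: "'a \<Rightarrow> 'b::real_normed_vector"
  assumes f: "f \<in> elems (L1 M normed_type)"
  shows "ae_strongly_measurable M f"
proof -
  obtain s where fm: "f \<in> borel_measurable M" and s: "\<And>i::nat. simple_function M (s i)"
    and lim: "(\<lambda>i. \<integral>\<^sup>+y. ennreal (norm (f y - s i y)) \<partial>M) \<longlonglongrightarrow> 0"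
    using f unfolding elems_L1_normed_type_iff by blast
  obtain r where r: "\<And>k. (\<integral>\<^sup>+y. ennreal (norm (f y - s (r k) y)) \<partial>M) < ennreal ((1 / 2) ^ k)"
    using LIMSEQ_zero_select[OF lim, of "\<lambda>k. ennreal ((1 / 2) ^ k)"] by auto
  note [measurable] = borel_measurable_norm_diff_simple[OF fm s]
  define A where "A = {y \<in> space M. (\<Sum>k. ennreal (norm (f y - s (r k) y))) < \<infinity>}"
  have "(\<integral>\<^sup>+y. (\<Sum>k. ennreal (norm (f y - s (r k) y))) \<partial>M) = (\<Sum>k. \<integral>\<^sup>+y. ennreal (norm (f y - s (r k) y)) \<partial>M)"
    by (rule nn_integral_suminf) measurable
  also have "\<dots> \<le> (\<Sum>k. ennreal ((1 / 2) ^ k))"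
    using r by (intro suminf_le) (auto intro: less_imp_le)
  finally have "(\<integral>\<^sup>+y. (\<Sum>k. ennreal (norm (f y - s (r k) y))) \<partial>M) \<noteq> \<infinity>"
    unfolding suminf_half_power by (auto simp: top_unique)
  then have "AE y in M. (\<Sum>k. ennreal (norm (f y - s (r k) y))) \<noteq> \<infinity>"
    by (intro nn_integral_PInf_AE) auto
  then have AE: "AE y in M. y \<in> A"
    using AE_space by eventually_elim (auto simp: A_def less_top)
  have Am [measurable]: "Measurable.pred M (\<lambda>y. y \<in> A)" unfolding A_def by measurable
  define f' where "f' = (\<lambda>y. if y \<in> A then f y else 0)"
  have "strongly_measurable M f'"
  proof (rule strongly_measurable_LIMSEQ)
    show "strongly_measurable M (\<lambda>y. if y \<in> A then s (r k) y else 0)" for k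
      by (intro strongly_measurable_If strongly_measurable_simple s strongly_measurable_const Am)
    fix y assume "y \<in> space M"
    show "(\<lambda>k. if y \<in> A then s (r k) y else 0) \<longlonglongrightarrow> f' y"
    proof (cases "y \<in> A")
      case True
      then have "summable (\<lambda>k. norm (f y - s (r k) y))"
        by (intro summable_suminf_not_top) (auto simp: A_def)
      then have "(\<lambda>k. norm (f y - s (r k) y)) \<longlonglongrightarrow> 0" by (rule summable_LIMSEQ_zero)
      then have "(\<lambda>k. f y - s (r k) y) \<longlonglongrightarrow> 0" by (rule tendsto_norm_zero_cancel)
      then have "(\<lambda>k. f y - (f y - s (r k) y)) \<longlonglongrightarrow> f y - 0" by (intro tendsto_intros)
      then show ?thesis using True by (simp add: f'_def)
    qed (simp add: f'_def)
  qed
  then show ?thesis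
    using AE unfolding ae_strongly_measurable_def by (intro exI[of _ f']) (auto simp: f'_def elim: eventually_mono)
qed

interpretation L1_normed: pseudometric "L1 M (normed_type :: 'v::real_normed_vector seminormed)" for M
proof -
  interpret function_norm M "nn_integral M" by (rule function_norm_nn_integral)
  show "pseudometric (L1 M (normed_type :: 'v seminormed))"
    by standard (auto simp: nrm_L1 norm_minus_commute intro!: norm_triangle elems_L1_ae_strongly)
qed

section \<open>Existence and continuity of the integral\<close>

lemma simple_bochner_integrable_finite_measure:
  assumes "finite_measure M" "simple_function M s"
  shows "Bochner_Integration.simple_bochner_integrable M s"
proof -
  interpret finite_measure M by fact
  show ?thesis using assms(2) by (auto simp: Bochner_Integration.simple_bochner_integrable.simps)
qed

lemma simple_bochner_integral_diff_le:
  fixes f :: "'a \<Rightarrow> 'b::real_normed_vector"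
  assumes f: "f \<in> borel_measurable M"
    and s: "Bochner_Integration.simple_bochner_integrable M s"
    and t: "Bochner_Integration.simple_bochner_integrable M t"
  shows "ennreal (norm (Bochner_Integration.simple_bochner_integral M s - Bochner_Integration.simple_bochner_integral M t))
    \<le> (\<integral>\<^sup>+x. ennreal (norm (f x - s x)) \<partial>M) + (\<integral>\<^sup>+x. ennreal (norm (f x - t x)) \<partial>M)"
proof -
  have st: "simple_function M s" "simple_function M t"
    using s t by (auto elim: Bochner_Integration.simple_bochner_integrable.cases)
  have d: "Bochner_Integration.simple_bochner_integrable M (\<lambda>x. s x - t x)"
    by (rule Bochner_Integration.simple_bochner_integrable_compose2[where p="\<lambda>x y. x - y", OF _ s t]) simp
  have d': "Bochner_Integration.simple_bochner_integrable M (\<lambda>x. norm (s x - t x))"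
    by (rule Bochner_Integration.simple_bochner_integrable_compose2[where p="\<lambda>x y. norm (x - y)", OF _ s t]) simp
  have "ennreal (norm (Bochner_Integration.simple_bochner_integral M s - Bochner_Integration.simple_bochner_integral M t))
      \<le> ennreal (Bochner_Integration.simple_bochner_integral M (\<lambda>x. norm (s x - t x)))"
    using Bochner_Integration.simple_bochner_integral_norm_bound[OF d]
    by (simp add: Bochner_Integration.simple_bochner_integral_diff[OF s t] ennreal_leI)
  also have "\<dots> = (\<integral>\<^sup>+x. ennreal (norm (s x - t x)) \<partial>M)"
    by (rule Bochner_Integration.simple_bochner_integral_eq_nn_integral[OF d']) simp
  also have "\<dots> \<le> (\<integral>\<^sup>+x. ennreal (norm (f x - s x)) + ennreal (norm (f x - t x)) \<partial>M)"
  proof (rule nn_integral_mono)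
    fix x
    have "norm (s x - t x) \<le> norm (f x - s x) + norm (f x - t x)"
      by (metis norm_diff_triangle_le norm_minus_commute order_refl)
    then show "ennreal (norm (s x - t x)) \<le> ennreal (norm (f x - s x)) + ennreal (norm (f x - t x))"
      by (simp add: ennreal_plus[symmetric] ennreal_leI del: ennreal_plus)
  qed
  also have "\<dots> = (\<integral>\<^sup>+x. ennreal (norm (f x - s x)) \<partial>M) + (\<integral>\<^sup>+x. ennreal (norm (f x - t x)) \<partial>M)"
    by (intro nn_integral_add borel_measurable_norm_diff_simple f st)
  finally show ?thesis .
qed

text \<open>This justifies the definite description in \<open>bochner_integral\<close>: the
  integrals of the approximations form a Cauchy sequence, and any other admissible sequence has the
  same limit by comparison through \<open>f\<close>.\<close>

lemma bochner_integral_LIMSEQ: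
  fixes f :: "'a \<Rightarrow> 'b::banach"
  assumes M: "finite_measure M" and f: "f \<in> borel_measurable M" and s: "\<And>i::nat. simple_function M (s i)"
    and lim: "(\<lambda>i. \<integral>\<^sup>+y. ennreal (norm (f y - s i y)) \<partial>M) \<longlonglongrightarrow> 0"
  shows "(\<lambda>i. Bochner_Integration.simple_bochner_integral M (s i)) \<longlonglongrightarrow> bochner_integral M f"
proof -
  let ?I = "Bochner_Integration.simple_bochner_integral M"
  let ?ok = "\<lambda>s z. (\<forall>i::nat. Bochner_Integration.simple_bochner_integrable M (s i)) \<and>
     (\<lambda>i. \<integral>\<^sup>+y. norm (f y - s i y) \<partial>M) \<longlonglongrightarrow> 0 \<and> (\<lambda>i. ?I (s i)) \<longlonglongrightarrow> z"
  have sb: "Bochner_Integration.simple_bochner_integrable M (s i)" for i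
    by (rule simple_bochner_integrable_finite_measure[OF M s])
  let ?a = "\<lambda>i. \<integral>\<^sup>+y. ennreal (norm (f y - s i y)) \<partial>M"
  have "Cauchy (\<lambda>i. ?I (s i))"
  proof (rule metric_CauchyI)
    fix e :: real assume e: "e > 0"
    then obtain n where n: "\<And>i. i \<ge> n \<Longrightarrow> ?a i < ennreal (e / 2)"
      using order_tendstoD(2)[OF lim, of "ennreal (e / 2)"] by (auto simp: eventually_sequentially)
    have "dist (?I (s i)) (?I (s j)) < e" if "i \<ge> n" "j \<ge> n" for i j
    proof -
      have "ennreal (norm (?I (s i) - ?I (s j))) \<le> ?a i + ?a j"
        by (rule simple_bochner_integral_diff_le[OF f sb sb])
      also have "\<dots> < ennreal (e / 2) + ennreal (e / 2)" using n that by (intro add_strict_mono) auto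
      also have "\<dots> = ennreal e" using e by (simp add: ennreal_plus[symmetric] del: ennreal_plus)
      finally show ?thesis by (simp add: dist_norm ennreal_less_iff)
    qed
    then show "\<exists>n. \<forall>i\<ge>n. \<forall>j\<ge>n. dist (?I (s i)) (?I (s j)) < e" by blast
  qed
  then obtain z where z: "(\<lambda>i. ?I (s i)) \<longlonglongrightarrow> z" by (auto simp: Cauchy_convergent_iff convergent_def)
  have uniq: "z' = z" if "?ok s' z'" for s' z'
  proof -
    have "(\<lambda>i. ennreal (norm (?I (s' i) - ?I (s i)))) \<longlonglongrightarrow> 0"
    proof (rule tendsto_sandwich[OF _ _ tendsto_const])
      have "(\<lambda>i. (\<integral>\<^sup>+y. ennreal (norm (f y - s' i y)) \<partial>M) + ?a i) \<longlonglongrightarrow> 0 + 0"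
        using that lim by (intro tendsto_add) auto
      then show "(\<lambda>i. (\<integral>\<^sup>+y. ennreal (norm (f y - s' i y)) \<partial>M) + ?a i) \<longlonglongrightarrow> 0" by simp
    qed (use that in \<open>auto intro!: always_eventually simple_bochner_integral_diff_le[OF f] sb\<close>)
    moreover have "(\<lambda>i. ennreal (norm (?I (s' i) - ?I (s i)))) \<longlonglongrightarrow> ennreal (norm (z' - z))"
      using that z by (intro tendsto_intros) auto
    ultimately have "ennreal (norm (z' - z)) = 0" using LIMSEQ_unique by blast
    then show ?thesis by (simp add: ennreal_eq_0_iff)
  qed
  have "bochner_integral M f = z"
    unfolding bochner_integral_def
    by (rule the_equality) (use sb lim z uniq in blast)+
  then show ?thesis using z by simp
qed

lemma bochner_integral_diff_le:
  fixes f :: "'a \<Rightarrow> 'b::banach"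
  assumes M: "finite_measure M" and f: "f \<in> elems (L1 M normed_type)" and t: "simple_function M t"
  shows "ennreal (norm (bochner_integral M f - Bochner_Integration.simple_bochner_integral M t))
    \<le> (\<integral>\<^sup>+y. ennreal (norm (f y - t y)) \<partial>M)"
proof -
  let ?I = "Bochner_Integration.simple_bochner_integral M"
  obtain s where fm: "f \<in> borel_measurable M" and s: "\<And>i::nat. simple_function M (s i)"
    and lim: "(\<lambda>i. \<integral>\<^sup>+y. ennreal (norm (f y - s i y)) \<partial>M) \<longlonglongrightarrow> 0"
    using f unfolding elems_L1_normed_type_iff by blast
  show ?thesis
  proof (rule LIMSEQ_le)
    show "(\<lambda>i. ennreal (norm (?I (s i) - ?I t))) \<longlonglongrightarrow> ennreal (norm (bochner_integral M f - ?I t))"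
      by (intro tendsto_intros bochner_integral_LIMSEQ[OF M fm s lim])
    show "(\<lambda>i. (\<integral>\<^sup>+y. ennreal (norm (f y - s i y)) \<partial>M) + (\<integral>\<^sup>+y. ennreal (norm (f y - t y)) \<partial>M))
        \<longlonglongrightarrow> (\<integral>\<^sup>+y. ennreal (norm (f y - t y)) \<partial>M)"
      using tendsto_add[OF lim tendsto_const[of "\<integral>\<^sup>+y. ennreal (norm (f y - t y)) \<partial>M"]] by simp
    show "\<exists>N. \<forall>n\<ge>N. ennreal (norm (?I (s n) - ?I t)) \<le>
        (\<integral>\<^sup>+y. ennreal (norm (f y - s n y)) \<partial>M) + (\<integral>\<^sup>+y. ennreal (norm (f y - t y)) \<partial>M)"
      by (intro exI allI impI simple_bochner_integral_diff_le[OF fm] simple_bochner_integrable_finite_measure[OF M] s t)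
  qed
qed

lemma norm_bochner_integral_le:
  fixes f :: "'a \<Rightarrow> 'b::banach"
  assumes "finite_measure M" "f \<in> elems (L1 M normed_type)"
  shows "ennreal (norm (bochner_integral M f)) \<le> (\<integral>\<^sup>+y. ennreal (norm (f y)) \<partial>M)"
proof -
  have "Bochner_Integration.simple_bochner_integral M (\<lambda>_. 0 :: 'b) = 0"
    unfolding Bochner_Integration.simple_bochner_integral_def by (intro sum.neutral) auto
  then show ?thesis using bochner_integral_diff_le[OF assms, of "\<lambda>_. 0"] by simp
qed

lemma bochner_integral_cong_AE:
  assumes "AE y in M. f y = g y"
  shows "bochner_integral M f = bochner_integral M g"
proof -
  have "(\<integral>\<^sup>+y. ennreal (norm (f y - t y)) \<partial>M) = (\<integral>\<^sup>+y. ennreal (norm (g y - t y)) \<partial>M)" for t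
    using assms by (intro nn_integral_cong_AE) auto
  then show ?thesis unfolding bochner_integral_def by simp
qed

lemma elems_L1_normed_type_cong_AE:
  assumes "f \<in> elems (L1 M normed_type)" "AE y in M. f y = g y" "g \<in> borel_measurable M"
  shows "g \<in> elems (L1 M normed_type)"
proof -
  have "(\<integral>\<^sup>+y. ennreal (norm (f y - t y)) \<partial>M) = (\<integral>\<^sup>+y. ennreal (norm (g y - t y)) \<partial>M)" for t
    using assms by (intro nn_integral_cong_AE) auto
  then show ?thesis using assms unfolding elems_L1_normed_type_iff by simp
qed

section \<open>Limits of step functions\<close>

text \<open>Used twice: with \<open>K\<close> the identity for the integrand, and with
  \<open>K\<close> a choice of versions of the image processes. Membership in \<open>Z0\<close> and
  \<open>G0\<close> is tested in the definition of the limit, which is zero elsewhere, so that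
  measurability and integrability hold at every point.\<close>

locale step_limit =
  fixes G :: "'g measure" and M :: "'z measure" and s :: "nat \<Rightarrow> 'g \<Rightarrow> 'i"
    and K :: "'i \<Rightarrow> 'z \<Rightarrow> 'e::banach" and Z0 :: "'z set" and G0 :: "'g set"
  assumes finite_G: "finite_measure G"
    and simple: "\<And>n. simple_function G (s n)"
    and K: "\<And>n y. y \<in> space G \<Longrightarrow> strongly_measurable M (K (s n y))"
    and Z0: "Z0 \<in> sets M" and G0: "G0 \<in> sets G" and AE_G0: "AE y in G. y \<in> G0"
    and finite_variation: "\<And>z. z \<in> Z0 \<Longrightarrow>
      (\<integral>\<^sup>+y. (\<Sum>m. ennreal (norm (K (s (Suc m) y) z - K (s m y) z))) \<partial>G) < \<infinity>"
begin

definition variation :: "'z \<Rightarrow> 'g \<Rightarrow> ennreal" where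
  "variation z y = (\<Sum>m. ennreal (norm (K (s (Suc m) y) z - K (s m y) z)))"

definition step_lim :: "'z \<Rightarrow> 'g \<Rightarrow> 'e" where
  "step_lim z y = (if z \<in> Z0 \<and> y \<in> G0 \<and> variation z y < \<infinity> then lim (\<lambda>n. K (s n y) z) else 0)"

lemma simple_pair: "simple_function (M \<Otimes>\<^sub>M G) (\<lambda>p. s n (snd p))"
  by (rule simple_function_comp_measurable[OF simple measurable_snd])

lemma strongly_pair: "strongly_measurable (M \<Otimes>\<^sub>M G) (\<lambda>p. K (s n (snd p)) (fst p))"
proof (rule strongly_measurable_simple_param[OF simple_pair])
  fix v assume "v \<in> (\<lambda>p. s n (snd p)) ` space (M \<Otimes>\<^sub>M G)"
  then obtain p where "p \<in> space (M \<Otimes>\<^sub>M G)" "v = s n (snd p)" by (rule imageE)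
  then have "strongly_measurable M (K v)"
    using K[of "snd p" n] by (simp add: space_pair_measure mem_Times_iff)
  then show "strongly_measurable (M \<Otimes>\<^sub>M G) (\<lambda>p. K v (fst p))"
    by (rule strongly_measurable_compose[OF _ measurable_fst])
qed

lemma variation_measurable: "(\<lambda>p. variation (fst p) (snd p)) \<in> borel_measurable (M \<Otimes>\<^sub>M G)"
  unfolding variation_def
  by (intro borel_measurable_suminf_order borel_measurable_norm_diff_strongly strongly_pair)

lemma section_measurable:
  assumes "z \<in> space M"
  shows "(\<lambda>y. (z, y)) \<in> measurable G (M \<Otimes>\<^sub>M G)"
  by (rule measurable_Pair1'[OF assms])

lemma Z0_space: "z \<in> Z0 \<Longrightarrow> z \<in> space M"
  using sets.sets_into_space[OF Z0] by blast

lemma good_pred: "Measurable.pred (M \<Otimes>\<^sub>M G) (\<lambda>p. fst p \<in> Z0 \<and> snd p \<in> G0 \<and> variation (fst p) (snd p) < \<infinity>)"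
proof -
  note [measurable] = variation_measurable Z0 G0
  show ?thesis by measurable
qed

lemma step_lim_tendsto:
  assumes "z \<in> Z0" "y \<in> G0" "variation z y < \<infinity>"
  shows "(\<lambda>n. K (s n y) z) \<longlonglongrightarrow> step_lim z y"
    and "ennreal (norm (step_lim z y - K (s n y) z)) \<le>
      (\<Sum>m. ennreal (norm (K (s (Suc (m + n)) y) z - K (s (m + n) y) z)))"
proof -
  have eq: "step_lim z y = lim (\<lambda>n. K (s n y) z)"
    unfolding step_lim_def using assms by (simp only: if_True simp_thms)
  show "(\<lambda>n. K (s n y) z) \<longlonglongrightarrow> step_lim z y"
    unfolding eq by (rule LIMSEQ_if_suminf_norm(1)) (rule assms(3)[unfolded variation_def])
  show "ennreal (norm (step_lim z y - K (s n y) z)) \<le>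
      (\<Sum>m. ennreal (norm (K (s (Suc (m + n)) y) z - K (s (m + n) y) z)))"
    unfolding eq by (rule LIMSEQ_if_suminf_norm(2)) (rule assms(3)[unfolded variation_def])
qed

lemma strongly_step_lim: "strongly_measurable (M \<Otimes>\<^sub>M G) (\<lambda>p. step_lim (fst p) (snd p))"
proof (rule strongly_measurable_LIMSEQ)
  let ?good = "\<lambda>p. fst p \<in> Z0 \<and> snd p \<in> G0 \<and> variation (fst p) (snd p) < \<infinity>"
  show "strongly_measurable (M \<Otimes>\<^sub>M G) (\<lambda>p. if ?good p then K (s n (snd p)) (fst p) else 0)" for n
    by (rule strongly_measurable_If[OF strongly_pair strongly_measurable_const good_pred])
  show "(\<lambda>n. if ?good p then K (s n (snd p)) (fst p) else 0) \<longlonglongrightarrow> step_lim (fst p) (snd p)" for p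
  proof (cases "?good p")
    case True
    then show ?thesis using step_lim_tendsto(1)[of "fst p" "snd p"] by simp
  next
    case False
    then show ?thesis unfolding step_lim_def by (simp only: if_False tendsto_const)
  qed
qed

lemma strongly_step_lim1: "z \<in> space M \<Longrightarrow> strongly_measurable G (step_lim z)"
  using strongly_measurable_compose[OF strongly_step_lim section_measurable] by simp

lemma strongly_step_lim2: "y \<in> space G \<Longrightarrow> strongly_measurable M (\<lambda>z. step_lim z y)"
  using strongly_measurable_compose[OF strongly_step_lim measurable_Pair2'] by simp

lemma AE_variation:
  assumes z: "z \<in> Z0"
  shows "AE y in G. y \<in> G0 \<and> variation z y < \<infinity>"
proof -
  have "(\<lambda>y. variation z y) \<in> borel_measurable G"
    using measurable_compose[OF section_measurable[OF Z0_space[OF z]] variation_measurable] by simp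
  then have "AE y in G. variation z y \<noteq> \<infinity>"
    using finite_variation[OF z] unfolding variation_def[symmetric] by (intro nn_integral_PInf_AE) auto
  then show ?thesis using AE_G0 by eventually_elim (auto simp: less_top)
qed

lemma simple_K: "simple_function G (\<lambda>y. K (s n y) z)"
  by (rule simple_function_compose1[OF simple])

lemma diff_measurable:
  "(\<lambda>y. ennreal (norm (K (s (Suc m) y) z - K (s m y) z))) \<in> borel_measurable G"
  by (intro borel_measurable_norm_diff_strongly strongly_measurable_simple simple_K)

lemma integral_diff_le:
  assumes z: "z \<in> Z0"
  shows "(\<integral>\<^sup>+y. ennreal (norm (step_lim z y - K (s n y) z)) \<partial>G) \<le>
    (\<Sum>m. \<integral>\<^sup>+y. ennreal (norm (K (s (Suc (m + n)) y) z - K (s (m + n) y) z)) \<partial>G)"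
proof -
  have "(\<integral>\<^sup>+y. ennreal (norm (step_lim z y - K (s n y) z)) \<partial>G) \<le>
      (\<integral>\<^sup>+y. (\<Sum>m. ennreal (norm (K (s (Suc (m + n)) y) z - K (s (m + n) y) z))) \<partial>G)"
    using AE_variation[OF z] by (intro nn_integral_mono_AE, eventually_elim) (auto intro: step_lim_tendsto z)
  also have "\<dots> = (\<Sum>m. \<integral>\<^sup>+y. ennreal (norm (K (s (Suc (m + n)) y) z - K (s (m + n) y) z)) \<partial>G)"
    by (intro nn_integral_suminf diff_measurable)
  finally show ?thesis .
qed

lemma integral_diff_tendsto:
  assumes z: "z \<in> Z0"
  shows "(\<lambda>n. \<integral>\<^sup>+y. ennreal (norm (step_lim z y - K (s n y) z)) \<partial>G) \<longlonglongrightarrow> 0"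
proof (rule tendsto_sandwich[OF _ _ tendsto_const])
  have "(\<Sum>m. \<integral>\<^sup>+y. ennreal (norm (K (s (Suc m) y) z - K (s m y) z)) \<partial>G) < \<infinity>"
    unfolding nn_integral_suminf[OF diff_measurable, symmetric] by (rule finite_variation[OF z])
  then show "(\<lambda>n. \<Sum>m. \<integral>\<^sup>+y. ennreal (norm (K (s (Suc (m + n)) y) z - K (s (m + n) y) z)) \<partial>G) \<longlonglongrightarrow> 0"
    by (rule ennreal_suminf_tail)
  show "\<forall>\<^sub>F n in sequentially. (\<integral>\<^sup>+y. ennreal (norm (step_lim z y - K (s n y) z)) \<partial>G) \<le>
    (\<Sum>m. \<integral>\<^sup>+y. ennreal (norm (K (s (Suc (m + n)) y) z - K (s (m + n) y) z)) \<partial>G)"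
    by (intro always_eventually allI integral_diff_le z)
qed simp

lemma step_lim_outside: "z \<notin> Z0 \<Longrightarrow> step_lim z = (\<lambda>_. 0)"
  by (simp add: step_lim_def fun_eq_iff)

lemma step_lim_L1:
  assumes z: "z \<in> space M"
  shows "step_lim z \<in> elems (L1 G normed_type)"
proof (cases "z \<in> Z0")
  case True
  then have "\<exists>t. (\<forall>i::nat. simple_function G (t i)) \<and>
      (\<lambda>i. \<integral>\<^sup>+y. ennreal (norm (step_lim z y - t i y)) \<partial>G) \<longlonglongrightarrow> 0"
    by (intro exI[of _ "\<lambda>i y. K (s i y) z"] conjI allI simple_K integral_diff_tendsto)
  then show ?thesis
    unfolding elems_L1_normed_type_iff
    using strongly_measurableD[OF strongly_step_lim1[OF z]] by blast
next
  case False
  have "\<exists>t. (\<forall>i::nat. simple_function G (t i)) \<and>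
      (\<lambda>i. \<integral>\<^sup>+y. ennreal (norm ((0::'e) - t i y)) \<partial>G) \<longlonglongrightarrow> 0"
    by (rule exI[of _ "\<lambda>_ _. 0"]) simp
  then show ?thesis
    unfolding elems_L1_normed_type_iff step_lim_outside[OF False] by simp
qed

lemma simple_L1:
  fixes f :: "'g \<Rightarrow> 'e"
  assumes "simple_function G f"
  shows "f \<in> elems (L1 G normed_type)"
proof -
  have "\<exists>t. (\<forall>i::nat. simple_function G (t i)) \<and>
      (\<lambda>i. \<integral>\<^sup>+y. ennreal (norm (f y - t i y)) \<partial>G) \<longlonglongrightarrow> 0"
    by (rule exI[of _ "\<lambda>_. f"]) (simp add: assms)
  then show ?thesis
    unfolding elems_L1_normed_type_iff using borel_measurable_simple_function[OF assms] by blast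
qed

text \<open>Only finitely many values \<open>v\<close> of \<open>s n\<close> occur, and the range of
  each \<open>K v\<close> lies in the closure of a countable \<open>D v\<close>. Functions
  \<open>\<phi> (s n y)\<close> with \<open>\<phi>\<close> in the countable product of the
  \<open>D v\<close> approximate uniformly in \<open>y\<close>, hence in \<open>L1\<close>, as
  \<open>G\<close> is finite. Simplicity is recorded because distances to these functions must be
  measurable.\<close>

lemma dense_in_steps:
  obtains C where "dense_in (L1 G normed_type) C ((\<lambda>z y. K (s n y) z) ` space M)"
    "\<And>c. c \<in> C \<Longrightarrow> simple_function G c"
proof -
  let ?R = "s n ` space G"
  have "\<exists>D. countable D \<and> K v ` space M \<subseteq> closure D" if "v \<in> ?R" for v
    using that K unfolding strongly_measurable_def by auto
  then obtain D where D: "\<And>v. v \<in> ?R \<Longrightarrow> countable (D v) \<and> K v ` space M \<subseteq> closure (D v)" by metis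
  define C where "C = (\<lambda>\<phi> y. \<phi> (s n y)) ` (PiE ?R D)"
  have fin: "finite ?R" by (rule simple_functionD(1)[OF simple])
  have "countable C"
    unfolding C_def by (intro countable_image countable_PiE fin) (use D in blast)
  moreover have C: "simple_function G c" if c: "c \<in> C" for c
  proof -
    obtain \<phi> where "c = (\<lambda>y. \<phi> (s n y))" using c unfolding C_def by (rule imageE)
    then show ?thesis using simple_function_compose1[OF simple] by simp
  qed
  moreover have "\<exists>c\<in>C. nrm (L1 G normed_type) ((\<lambda>y. K (s n y) z) - c) < e" if z: "z \<in> space M" and e: "e > 0" for z e
  proof -
    interpret finite_measure G by (rule finite_G)
    obtain d where d: "d > 0" "ennreal d * emeasure G (space G) < e"
    proof -
      obtain e' where e': "0 < e'" "e' < e" using dense[OF e] by blast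
      then have f: "e' < top" by (auto simp: less_top[symmetric] intro: order.strict_trans2)
      let ?m = "measure G (space G)"
      \<comment> \<open>\<open>e'\<close> is finite, whereas \<open>e\<close> may be infinite; the
        \<open>+ 1\<close> keeps the quotient meaningful when \<open>G\<close> has measure
        zero.\<close>
      define d where "d = enn2real e' / (?m + 1)"
      have m: "?m \<ge> 0" by simp
      have pos: "enn2real e' > 0" using e' f by (simp add: enn2real_positive_iff)
      have d: "d > 0" unfolding d_def using pos m by (intro divide_pos_pos) linarith+
      have "d * ?m \<le> d * (?m + 1)" using d by (intro mult_left_mono) auto
      also have "\<dots> = enn2real e'" using m unfolding d_def by (intro nonzero_eq_divide_eq[THEN iffD1] refl) linarith
      finally have "d * ?m \<le> enn2real e'" .
      then have "ennreal (d * measure G (space G)) \<le> e'"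
        using f by (metis ennreal_enn2real ennreal_leI)
      then have "ennreal d * emeasure G (space G) \<le> e'"
        using d by (simp add: emeasure_eq_measure ennreal_mult)
      then have "ennreal d * emeasure G (space G) < e" using e'(2) by (rule order.strict_trans1)
      with d show thesis by (rule that)
    qed
    have "\<exists>c\<in>D v. dist c (K v z) < d" if v: "v \<in> ?R" for v
    proof -
      have "K v z \<in> closure (D v)" using D[OF v] z by blast
      then show ?thesis using d(1) unfolding closure_approachable by blast
    qed
    then have "\<forall>v\<in>?R. \<exists>c. c \<in> D v \<and> dist c (K v z) < d" by blast
    from bchoice[OF this] obtain \<phi> where \<phi>: "\<And>v. v \<in> ?R \<Longrightarrow> \<phi> v \<in> D v \<and> dist (\<phi> v) (K v z) < d"
      by blast
    define c where "c = (\<lambda>y. restrict \<phi> ?R (s n y))"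
    have "restrict \<phi> ?R \<in> PiE ?R D" using \<phi> by simp
    then have "c \<in> C" unfolding c_def C_def by (rule imageI)
    moreover have "nrm (L1 G normed_type) ((\<lambda>y. K (s n y) z) - c) < e"
    proof -
      have "nrm (L1 G normed_type) ((\<lambda>y. K (s n y) z) - c) \<le> (\<integral>\<^sup>+y. ennreal d \<partial>G)"
        unfolding nrm_L1
      proof (rule nn_integral_mono)
        fix y assume y: "y \<in> space G"
        have "norm (K (s n y) z - c y) \<le> d"
          using \<phi>[of "s n y"] y by (simp add: c_def dist_norm norm_minus_commute less_imp_le)
        then show "nrm normed_type (((\<lambda>y. K (s n y) z) - c) y) \<le> ennreal d"
          by (simp add: ennreal_leI)
      qed
      also have "\<dots> < e" using d(2) by simp
      finally show ?thesis .
    qed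
    ultimately show ?thesis by blast
  qed
  ultimately have "dense_in (L1 G normed_type) C ((\<lambda>z y. K (s n y) z) ` space M)"
    unfolding dense_in_def using simple_L1 simple_K by blast
  then show thesis using C that by blast
qed

lemma dense_in_step_lim:
  obtains C where "dense_in (L1 G normed_type) C (step_lim ` space M)"
    "\<And>c. c \<in> C \<Longrightarrow> simple_function G c"
proof -
  have "\<forall>n. \<exists>C. dense_in (L1 G normed_type) C ((\<lambda>z y. K (s n y) z) ` space M) \<and>
      (\<forall>c\<in>C. simple_function G c)"
  proof
    fix n show "\<exists>C. dense_in (L1 G normed_type) C ((\<lambda>z y. K (s n y) z) ` space M) \<and>
      (\<forall>c\<in>C. simple_function G c)"
      by (rule dense_in_steps[of n]) blast
  qed
  from choice[OF this] obtain C where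
    C: "\<And>n. dense_in (L1 G normed_type) (C n) ((\<lambda>z y. K (s n y) z) ` space M)"
    "\<And>n c. c \<in> C n \<Longrightarrow> simple_function G c"
    by blast
  have "dense_in (L1 G normed_type) (\<Union>n. C n) (step_lim ` Z0)"
  proof (rule L1_normed.dense_in_LIMSEQ)
    show "dense_in (L1 G normed_type) (C n) ((\<lambda>z y. K (s n y) z) ` Z0)" for n
      using sets.sets_into_space[OF Z0] by (intro dense_in_subset[OF C(1)] image_mono)
    show "z \<in> Z0 \<Longrightarrow> step_lim z \<in> elems (L1 G normed_type)" for z
      using step_lim_L1 Z0_space by blast
    show "(\<lambda>n. nrm (L1 G normed_type) ((\<lambda>y. K (s n y) z) - step_lim z)) \<longlonglongrightarrow> 0" if "z \<in> Z0" for z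
      using integral_diff_tendsto[OF that] by (simp add: nrm_L1 norm_minus_commute)
  qed
  then have "dense_in (L1 G normed_type) (insert (\<lambda>_. 0) (\<Union>n. C n)) (insert (\<lambda>_. 0) (step_lim ` Z0))"
    by (rule L1_normed.dense_in_insert) (rule simple_L1, simp)
  moreover have "step_lim ` space M \<subseteq> insert (\<lambda>_. 0) (step_lim ` Z0)"
    using step_lim_outside by blast
  ultimately have "dense_in (L1 G normed_type) (insert (\<lambda>_. 0) (\<Union>n. C n)) (step_lim ` space M)"
    by (rule dense_in_subset)
  then show thesis
  proof (rule that)
    fix c assume "c \<in> insert (\<lambda>_. 0) (\<Union>n. C n)"
    then show "simple_function G c" using C(2) by auto
  qed
qed

text \<open>\<open>L1\<close> may be nonseparable, but distances suffice: for each simple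
  \<open>c\<close> of the dense set the distance is an integral over \<open>y\<close> of a jointly
  measurable function, hence measurable in \<open>z\<close> by Fubini.\<close>

lemma step_lim_measurable: "step_lim \<in> measurable M (seminorm_borel (L1 G normed_type))"
proof -
  interpret finite_measure G by (rule finite_G)
  obtain C where C: "dense_in (L1 G normed_type) C (step_lim ` space M)"
    "\<And>c. c \<in> C \<Longrightarrow> simple_function G c"
    by (rule dense_in_step_lim) blast
  show ?thesis
  proof (rule L1_normed.measurable_if_dense[OF C(1)])
    fix c assume "c \<in> C"
    then have "strongly_measurable (M \<Otimes>\<^sub>M G) (\<lambda>p. c (snd p))"
      by (intro strongly_measurable_simple simple_function_comp_measurable[OF C(2) measurable_snd])
    then have "(\<lambda>p. ennreal (norm (step_lim (fst p) (snd p) - c (snd p)))) \<in> borel_measurable (M \<Otimes>\<^sub>M G)"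
      by (intro borel_measurable_norm_diff_strongly strongly_step_lim)
    then have "(\<lambda>z. \<integral>\<^sup>+y. ennreal (norm (step_lim z y - c y)) \<partial>G) \<in> borel_measurable M"
      by (intro borel_measurable_nn_integral) (simp add: case_prod_beta)
    then show "(\<lambda>z. nrm (L1 G normed_type) (step_lim z - c)) \<in> borel_measurable M"
      by (simp add: nrm_L1)
  qed
qed

section \<open>The integral of the limit over \<open>G\<close>\<close>

lemma integral_norm_le:
  assumes z: "z \<in> space M"
  shows "(\<integral>\<^sup>+y. ennreal (norm (step_lim z y)) \<partial>G) \<le>
    (\<integral>\<^sup>+y. ennreal (norm (K (s 0 y) z)) \<partial>G) + (\<integral>\<^sup>+y. variation z y \<partial>G)"
proof (cases "z \<in> Z0")
  case True
  have m: "(\<lambda>y. variation z y) \<in> borel_measurable G"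
    using measurable_compose[OF section_measurable[OF z] variation_measurable] by simp
  have "(\<integral>\<^sup>+y. ennreal (norm (step_lim z y)) \<partial>G) \<le>
      (\<integral>\<^sup>+y. ennreal (norm (K (s 0 y) z)) + variation z y \<partial>G)"
  proof (intro nn_integral_mono_AE, use AE_variation[OF True] in eventually_elim)
    fix y assume y: "y \<in> G0 \<and> variation z y < \<infinity>"
    have "ennreal (norm (step_lim z y)) \<le> ennreal (norm (K (s 0 y) z)) + ennreal (norm (step_lim z y - K (s 0 y) z))"
      by (simp add: ennreal_plus[symmetric] ennreal_leI norm_triangle_sub del: ennreal_plus)
    also have "ennreal (norm (step_lim z y - K (s 0 y) z)) \<le> variation z y"
      using step_lim_tendsto(2)[OF True conjunct1[OF y] conjunct2[OF y], of 0]
      by (simp only: variation_def add_0_right)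
    finally show "ennreal (norm (step_lim z y)) \<le> ennreal (norm (K (s 0 y) z)) + variation z y"
      by (simp add: add_left_mono)
  qed
  also have "\<dots> = (\<integral>\<^sup>+y. ennreal (norm (K (s 0 y) z)) \<partial>G) + (\<integral>\<^sup>+y. variation z y \<partial>G)"
    by (intro nn_integral_add m borel_measurable_norm_strongly strongly_measurable_simple simple_K)
  finally show ?thesis .
qed (simp add: step_lim_outside)

text \<open>The integral of a step function, grouped by the values of \<open>s n\<close> instead of
  those of \<open>K (s n y) z\<close>. The weights then do not depend on \<open>z\<close>, and with
  \<open>K\<close> the identity the sum is a linear combination of functions, to which the operator
  can be applied.\<close>

definition step_sum :: "nat \<Rightarrow> 'z \<Rightarrow> 'e" where
  "step_sum n z = (\<Sum>v\<in>s n ` space G. measure G {y \<in> space G. s n y = v} *\<^sub>R K v z)"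

lemma step_sum_eq: "step_sum n z = Bochner_Integration.simple_bochner_integral G (\<lambda>y. K (s n y) z)"
  unfolding step_sum_def
  by (rule Bochner_Integration.simple_bochner_integral_partition[symmetric, OF
      simple_bochner_integrable_finite_measure[OF finite_G simple_K] simple]) auto

lemma bochner_integral_diff_step_sum:
  assumes "z \<in> space M"
  shows "ennreal (norm (bochner_integral G (step_lim z) - step_sum n z)) \<le>
    (\<integral>\<^sup>+y. ennreal (norm (step_lim z y - K (s n y) z)) \<partial>G)"
  unfolding step_sum_eq by (rule bochner_integral_diff_le[OF finite_G step_lim_L1[OF assms] simple_K])

lemma step_sum_tendsto:
  assumes z: "z \<in> Z0"
  shows "(\<lambda>n. step_sum n z) \<longlonglongrightarrow> bochner_integral G (step_lim z)"
  unfolding step_sum_eq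
  by (rule bochner_integral_LIMSEQ[OF finite_G strongly_measurableD[OF strongly_step_lim1[OF Z0_space[OF z]]]
      simple_K integral_diff_tendsto[OF z]])

lemma strongly_step_sum: "strongly_measurable M (step_sum n)"
  unfolding step_sum_def
proof (intro strongly_measurable_sum strongly_measurable_scaleR)
  show "finite (s n ` space G)" by (rule simple_functionD(1)[OF simple])
  fix v assume "v \<in> s n ` space G"
  then show "strongly_measurable M (K v)" using K by blast
qed

lemma strongly_bochner_integral: "strongly_measurable M (\<lambda>z. bochner_integral G (step_lim z))"
proof (rule strongly_measurable_LIMSEQ)
  have [measurable]: "Measurable.pred M (\<lambda>z. z \<in> Z0)" using Z0 by measurable
  show "strongly_measurable M (\<lambda>z. if z \<in> Z0 then step_sum n z else 0)" for n
    by (intro strongly_measurable_If strongly_step_sum strongly_measurable_const) measurable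
  show "(\<lambda>n. if z \<in> Z0 then step_sum n z else 0) \<longlonglongrightarrow> bochner_integral G (step_lim z)" for z
  proof (cases "z \<in> Z0")
    case False
    have "bochner_integral G (\<lambda>_. 0 :: 'e) = 0"
      using norm_bochner_integral_le[OF finite_G simple_L1[of "\<lambda>_. 0"]] by (simp add: ennreal_eq_0_iff)
    then show ?thesis using False by (simp add: step_lim_outside)
  qed (simp add: step_sum_tendsto)
qed

end

section \<open>Integrands and processes\<close>

locale mixed_space =
  fixes p q :: real and D1 :: "'a measure" and D2 :: "'b measure" and \<nu>1 :: "'b \<Rightarrow> 'a measure"
    and \<D> :: "('a \<times> 'b) measure"
  assumes kernel: "finite_kernel D2 D1 \<nu>1" and sub: "subalgebra (D1 \<Otimes>\<^sub>M D2) \<D>"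
    and p: "p \<ge> 1" and q: "q \<ge> 1"
begin

abbreviation MD :: "('a \<times> 'b) measure" where
  "MD \<equiv> restr_to_subalg (kernel_measure D1 D2 \<nu>1) \<D>"

abbreviation NN :: "('a \<times> 'b \<Rightarrow> ennreal) \<Rightarrow> ennreal" where
  "NN \<equiv> mixed_norm p q D2 \<nu>1"

sublocale MD: function_norm MD NN
  by (rule function_norm_mixed_norm[OF kernel sub p q])

lemma sub_kernel: "subalgebra (kernel_measure D1 D2 \<nu>1) \<D>"
  using sub by (simp add: subalgebra_def space_pair_measure)

lemma space_D: "space \<D> = space D1 \<times> space D2"
  using sub by (simp add: subalgebra_def space_pair_measure)

lemma sets_MD: "sets MD = sets \<D>"
  by (rule sets_restr_to_subalg[OF sub_kernel])

lemma space_MD: "space MD = space \<D>"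
  by (rule sets_eq_imp_space_eq[OF sets_MD])

lemma measurable_MD: "measurable MD N = measurable \<D> N"
  by (rule measurable_cong_sets[OF sets_MD refl])

lemma strongly_measurable_MD: "strongly_measurable MD f \<longleftrightarrow> strongly_measurable \<D> f"
  by (simp add: strongly_measurable_def measurable_MD space_MD)

lemma nrm_Lpq_eq: "nrm (Lpq p q D1 D2 \<nu>1 \<D> V) f = NN (\<lambda>x. nrm V (f x))"
  using p by (intro nrm_Lpq) simp

lemma elems_Lpq_iff: "f \<in> elems (Lpq p q D1 D2 \<nu>1 \<D> V) \<longleftrightarrow>
   f \<in> measurable \<D> (seminorm_borel V) \<and>
   (\<exists>A\<in>sets \<D>. emeasure (kernel_measure D1 D2 \<nu>1) A = 0 \<and> separable_in V (f ` (space \<D> - A))) \<and>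
   NN (\<lambda>x. nrm V (f x)) < \<infinity>"
  unfolding nrm_Lpq_eq[symmetric] by (simp add: Lpq_def Let_def)

lemma elems_LpqI:
  assumes "f \<in> measurable \<D> (seminorm_borel V)" "separable_in V (f ` space \<D>)" "NN (\<lambda>x. nrm V (f x)) < \<infinity>"
  shows "f \<in> elems (Lpq p q D1 D2 \<nu>1 \<D> V)"
  unfolding elems_Lpq_iff using assms by (intro conjI bexI[of _ "{}"]) auto

lemma strongly_elems_Lpq:
  fixes f :: "'a \<times> 'b \<Rightarrow> 'e::real_normed_vector"
  assumes f: "strongly_measurable \<D> f" and fin: "NN (\<lambda>x. ennreal (norm (f x))) < \<infinity>"
  shows "f \<in> elems (Lpq p q D1 D2 \<nu>1 \<D> normed_type)"
proof (rule elems_LpqI)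
  show "f \<in> measurable \<D> (seminorm_borel normed_type)"
    unfolding measurable_normed_type by (rule strongly_measurableD[OF f])
  obtain C where "countable C" "f ` space \<D> \<subseteq> closure C"
    using f unfolding strongly_measurable_def by blast
  then show "separable_in normed_type (f ` space \<D>)" by (rule separable_in_normed_typeI)
qed (use fin in simp)

text \<open>The exceptional set belongs to \<open>\<D>\<close>, so putting \<open>f\<close> equal to
  zero there keeps it measurable and makes its whole range separable.\<close>

lemma strongly_representative:
  fixes f :: "'a \<times> 'b \<Rightarrow> 'e::real_normed_vector"
  assumes f: "f \<in> elems (Lpq p q D1 D2 \<nu>1 \<D> normed_type)"
  obtains f' where "strongly_measurable \<D> f'" "f' \<in> elems (Lpq p q D1 D2 \<nu>1 \<D> normed_type)"
    "AE x in MD. f x = f' x"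
proof -
  obtain A where A: "A \<in> sets \<D>" "emeasure (kernel_measure D1 D2 \<nu>1) A = 0" "separable_in normed_type (f ` (space \<D> - A))"
    and fm: "f \<in> borel_measurable \<D>" and fin: "NN (\<lambda>x. ennreal (norm (f x))) < \<infinity>"
    using f unfolding elems_Lpq_iff measurable_normed_type by auto
  obtain C where C: "countable C" "f ` (space \<D> - A) \<subseteq> closure C"
    by (rule separable_in_normed_typeD[OF A(3)])
  define f' where "f' = (\<lambda>x. if x \<in> A then 0 else f x)"
  have f': "strongly_measurable \<D> f'"
  proof (rule strongly_measurableI)
    have [measurable]: "Measurable.pred \<D> (\<lambda>x. x \<in> A)" using A(1) by measurable
    show "f' \<in> borel_measurable \<D>" unfolding f'_def using fm by measurable
    show "countable (insert 0 C)" using C(1) by simp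
    have "closure C \<subseteq> closure (insert 0 C)" by (rule closure_mono) blast
    moreover have "0 \<in> closure (insert 0 C)" using closure_subset[of "insert 0 C"] by blast
    ultimately show "f' ` space \<D> \<subseteq> closure (insert 0 C)"
      using C(2) by (auto simp: f'_def)
  qed
  have "A \<in> null_sets MD"
    using A(1,2) by (intro null_setsI) (simp_all add: sets_MD emeasure_restr_to_subalg[OF sub_kernel])
  then have AE: "AE x in MD. f x = f' x" by (rule AE_I') (auto simp: f'_def)
  then have "AE x in MD. ennreal (norm (f x)) = ennreal (norm (f' x))" by eventually_elim simp
  then have "NN (\<lambda>x. ennreal (norm (f' x))) < \<infinity>" using fin by (simp only: MD.cong_AE)
  with f' AE show thesis using strongly_elems_Lpq that by blast
qed

lemma elems_Lpq_ae_strongly: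
  fixes f :: "'a \<times> 'b \<Rightarrow> 'e::real_normed_vector"
  assumes f: "f \<in> elems (Lpq p q D1 D2 \<nu>1 \<D> normed_type)"
  shows "ae_strongly_measurable MD f"
  by (rule strongly_representative[OF f]) (auto simp: ae_strongly_measurable_def strongly_measurable_MD)

sublocale Lpq_normed: pseudometric "Lpq p q D1 D2 \<nu>1 \<D> (normed_type :: 'e::real_normed_vector seminormed)"
  by standard (simp_all add: nrm_Lpq_eq norm_minus_commute MD.norm_triangle elems_Lpq_ae_strongly)

end

section \<open>Path space and regular processes\<close>

lemma SUP_zero_ennreal [simp]: "(SUP t\<in>I. 0 :: ennreal) = 0"
  using SUP_bot[where 'a = ennreal] by (simp add: bot_ennreal)

interpretation path_space: pseudometric "path_space T (TT :: (real \<Rightarrow> 'f::banach) set)" for T TT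
proof
  have nrm: "nrm (path_space T TT) x = (SUP t\<in>{0..T}. ennreal (norm (x t)))" for x :: "real \<Rightarrow> 'f"
    by (simp add: path_space_def Bb_def)
  fix u v w :: "real \<Rightarrow> 'f"
  show "nrm (path_space T TT) (u - u) = 0" by (simp add: nrm)
  show "nrm (path_space T TT) (u - v) = nrm (path_space T TT) (v - u)" by (simp add: nrm norm_minus_commute)
  show "nrm (path_space T TT) (u - w) \<le> nrm (path_space T TT) (u - v) + nrm (path_space T TT) (v - w)"
    unfolding nrm
  proof (rule SUP_least)
    fix t assume t: "t \<in> {0..T}"
    have "ennreal (norm ((u - w) t)) \<le> ennreal (norm ((u - v) t)) + ennreal (norm ((v - w) t))"
      using norm_triangle_ineq[of "u t - v t" "v t - w t"]
      by (simp add: ennreal_plus[symmetric] ennreal_leI del: ennreal_plus)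
    also have "\<dots> \<le> (SUP t\<in>{0..T}. ennreal (norm ((u - v) t))) + (SUP t\<in>{0..T}. ennreal (norm ((v - w) t)))"
      using t by (intro add_mono SUP_upper)
    finally show "ennreal (norm ((u - w) t)) \<le>
        (SUP t\<in>{0..T}. ennreal (norm ((u - v) t))) + (SUP t\<in>{0..T}. ennreal (norm ((v - w) t)))" .
  qed
qed

lemma elems_path_space [simp]: "elems (path_space T TT) = TT"
  by (simp add: path_space_def)

lemma nrm_path_space: "nrm (path_space T TT) x = (SUP t\<in>{0..T}. ennreal (norm (x t)))"
  by (simp add: path_space_def Bb_def)

lemma norm_le_nrm_path_space: "t \<in> {0..T} \<Longrightarrow> ennreal (norm (x t)) \<le> nrm (path_space T TT) x"
  unfolding nrm_path_space by (rule SUP_upper)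

lemma path_diff: "path T (X - Y) \<omega> = path T X \<omega> - path T Y \<omega>"
  by (auto simp: path_def fun_eq_iff)

locale process_setup =
  fixes P FT :: "'o measure" and T :: real and PP :: "('o \<times> real) measure"
    and TT :: "(real \<Rightarrow> 'f::banach) set" and r :: real
  assumes complete: "complete_measure P" and FT: "subalgebra P FT" and null_FT: "null_sets P \<subseteq> sets FT"
    and TT: "closed_path_subspace T TT"
    and PP: "subalgebra (FT \<Otimes>\<^sub>M restrict_space borel {0..T}) PP"
    and null_PP: "\<And>A. A \<in> sets FT \<Longrightarrow> emeasure P A = 0 \<Longrightarrow> A \<times> {0..T} \<in> sets PP"
    and r: "r \<ge> 1"
begin

abbreviation "path_nrm \<equiv> nrm (path_space T TT)"
abbreviation "Lr \<equiv> Lr_process r P FT T PP TT"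

sublocale LP: function_norm P "Lnorm P r"
  by (rule function_norm_Lnorm[OF r])

lemma space_FT: "space FT = space P"
  using FT by (simp add: subalgebra_def)

lemma space_PP: "space PP = space P \<times> {0..T}"
  using PP by (simp add: subalgebra_def space_pair_measure space_restrict_space space_FT)

lemma measurable_FT: "f \<in> measurable FT N \<Longrightarrow> f \<in> measurable P N"
  by (rule measurable_from_subalg[OF FT])

lemma zero_TT: "(\<lambda>t. 0) \<in> TT"
  using TT by (simp add: closed_path_subspace_def)

lemma TT_Bb: "TT \<subseteq> elems (Bb T)"
  using TT closedin_subset unfolding closed_path_subspace_def by force

text \<open>Completeness makes the exceptional outcomes a null set of \<open>FT\<close>, and the
  assumption on null cylinders carries it over to \<open>PP\<close>. Changes of a process on such
  outcomes therefore preserve measurability for \<open>PP\<close>.\<close>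

lemma AE_imp_sets_FT:
  assumes "AE \<omega> in P. Q \<omega>"
  shows "{\<omega> \<in> space P. \<not> Q \<omega>} \<in> null_sets P" "{\<omega> \<in> space P. Q \<omega>} \<in> sets FT"
    "{\<omega> \<in> space P. Q \<omega>} \<times> {0..T} \<in> sets PP"
proof -
  obtain A where A: "{\<omega> \<in> space P. \<not> Q \<omega>} \<subseteq> A" "A \<in> null_sets P"
    using assms by (auto elim!: AE_E)
  interpret complete_measure P by (rule complete)
  show n: "{\<omega> \<in> space P. \<not> Q \<omega>} \<in> null_sets P" by (rule complete2[OF A])
  then have F: "{\<omega> \<in> space P. \<not> Q \<omega>} \<in> sets FT" using null_FT by blast
  have "space FT - {\<omega> \<in> space P. \<not> Q \<omega>} \<in> sets FT" using F by blast
  moreover have "space FT - {\<omega> \<in> space P. \<not> Q \<omega>} = {\<omega> \<in> space P. Q \<omega>}" by (auto simp: space_FT)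
  ultimately show "{\<omega> \<in> space P. Q \<omega>} \<in> sets FT" by simp
  have "space PP - {\<omega> \<in> space P. \<not> Q \<omega>} \<times> {0..T} \<in> sets PP"
    using null_PP[OF F] n by (intro sets.compl_sets) (auto simp: null_sets_def)
  moreover have "space PP - {\<omega> \<in> space P. \<not> Q \<omega>} \<times> {0..T} = {\<omega> \<in> space P. Q \<omega>} \<times> {0..T}"
    by (auto simp: space_PP)
  ultimately show "{\<omega> \<in> space P. Q \<omega>} \<times> {0..T} \<in> sets PP" by simp
qed

text \<open>Exceptional outcomes and nonseparable values are what makes elements of
  \<open>Lr\<close> hard to combine. Each of them has a version free of both, and for such versions
  distances of paths are measurable and uniform limits stay in the class.\<close>

definition regular :: "('o \<times> real \<Rightarrow> 'f) \<Rightarrow> bool" where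
  "regular X \<longleftrightarrow> strongly_measurable PP X \<and> (\<forall>\<omega>\<in>space P. path T X \<omega> \<in> TT) \<and>
     path T X \<in> measurable FT (seminorm_borel (path_space T TT)) \<and>
     (\<exists>C. dense_in (path_space T TT) C (path T X ` space P))"

lemma regular_TT: "regular X \<Longrightarrow> \<omega> \<in> space P \<Longrightarrow> path T X \<omega> \<in> TT"
  by (simp add: regular_def)

text \<open>Extended by zero, the path is a Borel function on the whole line, to which
  \<open>borel_function_separable_range\<close> applies.\<close>

lemma path_separable_range:
  assumes "x \<in> TT"
  obtains C where "countable C" "range x \<subseteq> closure C"
proof -
  have x: "x \<in> borel_measurable (restrict_space borel {0..T})" "\<And>t. t \<notin> {0..T} \<Longrightarrow> x t = 0"
    using assms TT_Bb by (auto simp: Bb_def)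
  have "(\<lambda>t. if t \<in> {0..T} then x t else 0) \<in> borel_measurable borel"
    using x(1) by (intro measurable_restrict_space_iff[THEN iffD1]) auto
  moreover have "(\<lambda>t. if t \<in> {0..T} then x t else 0) = x" using x(2) by auto
  ultimately show thesis using borel_function_separable_range that by metis
qed

text \<open>Bad outcomes get the zero path. For the values, \<open>C\<close> is a countable set of
  paths dense in the supremum norm, and each \<open>c\<close> has its range in the closure of a
  countable \<open>B c\<close>; every value of the process is close to a value of some
  \<open>c\<close> and hence to a point of \<open>B c\<close>. Here the separability of ranges of
  Borel functions is indispensable to the argument.\<close>

lemma regular_representative:
  assumes X: "X \<in> elems Lr"
  obtains X' where "regular X'" "AE \<omega> in P. path T X' \<omega> = path T X \<omega>"
proof -
  let ?\<Omega> = "path_dom P T TT X"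
  have X1: "X \<in> borel_measurable PP" "AE \<omega> in P. \<omega> \<in> ?\<Omega>"
    "path T X \<in> measurable (restrict_space FT ?\<Omega>) (seminorm_borel (path_space T TT))"
    "separable_in (path_space T TT) (path T X ` ?\<Omega>)"
    using X by (auto simp: Lr_process_def L0_process_def Let_def)
  have \<Omega>: "?\<Omega> \<in> sets FT" "?\<Omega> \<times> {0..T} \<in> sets PP"
    using AE_imp_sets_FT[OF X1(2)] by (simp_all add: path_dom_def)
  have \<Omega>TT: "path T X \<omega> \<in> TT" if "\<omega> \<in> ?\<Omega>" for \<omega> using that by (simp add: path_dom_def)
  then have "path T X ` ?\<Omega> \<subseteq> elems (path_space T TT)" by auto
  then obtain C where C: "dense_in (path_space T TT) C (path T X ` ?\<Omega>)"
    by (rule path_space.separable_inD[OF X1(4)])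
  define X' where "X' = (\<lambda>z. if z \<in> ?\<Omega> \<times> {0..T} then X z else 0)"
  have path': "path T X' \<omega> = (if \<omega> \<in> ?\<Omega> then path T X \<omega> else (\<lambda>t. 0))" for \<omega>
    by (auto simp: path_def X'_def fun_eq_iff)
  have "\<forall>c\<in>C. \<exists>B. countable B \<and> range c \<subseteq> closure B"
    using C path_separable_range unfolding dense_in_def by (metis elems_path_space subsetD)
  from bchoice[OF this] obtain B where B': "\<forall>c\<in>C. countable (B c) \<and> range c \<subseteq> closure (B c)" ..
  have B: "countable (B c)" "c t \<in> closure (B c)" if "c \<in> C" for c t
    using bspec[OF B' that] by blast+
  have "regular X'"
    unfolding regular_def
  proof (intro conjI ballI)
    show "path T X' \<omega> \<in> TT" for \<omega>
      unfolding path' using \<Omega>TT[of \<omega>] zero_TT by (simp split: if_split)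
    show "strongly_measurable PP X'"
    proof (rule strongly_measurableI)
      have [measurable]: "Measurable.pred PP (\<lambda>z. z \<in> ?\<Omega> \<times> {0..T})" using \<Omega>(2) by measurable
      show "X' \<in> borel_measurable PP" unfolding X'_def using X1(1) by measurable
      show "countable (insert 0 (\<Union>c\<in>C. B c))" using B(1) C by (simp add: dense_in_def)
      show "X' ` space PP \<subseteq> closure (insert 0 (\<Union>c\<in>C. B c))"
      proof (rule image_subsetI)
        fix z
        show "X' z \<in> closure (insert 0 (\<Union>c\<in>C. B c))"
        proof (cases "z \<in> ?\<Omega> \<times> {0..T}")
          case False
          then show ?thesis using closure_subset[of "insert 0 (\<Union>c\<in>C. B c)"] by (simp add: X'_def subset_iff)
        next
          case True
          then obtain \<omega> t where z: "z = (\<omega>, t)" "\<omega> \<in> ?\<Omega>" "t \<in> {0..T}" by blast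
          show ?thesis
            unfolding closure_approachable
          proof (intro allI impI)
            fix e :: real assume e: "e > 0"
            obtain c where c: "c \<in> C" "path_nrm (path T X \<omega> - c) < ennreal (e / 2)"
              using C z(2) e unfolding dense_in_def by (metis ennreal_less_zero_iff half_gt_zero imageI)
            have "ennreal (norm (X z - c t)) < ennreal (e / 2)"
              using norm_le_nrm_path_space[OF z(3), of "path T X \<omega> - c" TT] c(2) z
              by (simp add: path_def)
            then have 1: "dist (c t) (X z) < e / 2" by (simp add: dist_norm norm_minus_commute ennreal_less_iff)
            obtain b where b: "b \<in> B c" "dist b (c t) < e / 2"
              using B(2)[OF c(1)] e unfolding closure_approachable by (meson half_gt_zero)
            have "dist b (X' z) < e"
              using dist_triangle[of b "X z" "c t"] 1 b True by (simp add: X'_def)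
            then show "\<exists>y\<in>insert 0 (\<Union>c\<in>C. B c). dist y (X' z) < e" using b c(1) by blast
          qed
        qed
      qed
    qed
    have "(\<lambda>\<omega>. if \<omega> \<in> ?\<Omega> then path T X \<omega> else (\<lambda>t. 0)) \<in> measurable FT (seminorm_borel (path_space T TT))"
      using X1(3) \<Omega>(1) zero_TT by (subst measurable_restrict_space_iff[symmetric]) auto
    then show "path T X' \<in> measurable FT (seminorm_borel (path_space T TT))"
      unfolding path'[abs_def] by (simp add: path' fun_eq_iff cong: measurable_cong)
    have "dense_in (path_space T TT) (insert (\<lambda>t. 0) C) (insert (\<lambda>t. 0) (path T X ` ?\<Omega>))"
      by (rule path_space.dense_in_insert[OF C]) (simp add: zero_TT)
    then have "dense_in (path_space T TT) (insert (\<lambda>t. 0) C) (path T X' ` space P)"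
      by (rule dense_in_subset) (auto simp: path')
    then show "\<exists>C. dense_in (path_space T TT) C (path T X' ` space P)" by blast
  qed
  moreover have "AE \<omega> in P. path T X' \<omega> = path T X \<omega>" using X1(2) by eventually_elim (simp add: path')
  ultimately show thesis by (rule that)
qed

lemma nrm_Lr: "nrm Lr X = Lnorm P r (\<lambda>\<omega>. path_nrm (path T X \<omega>))"
  by (simp add: Lr_process_def Let_def Lnorm_def)

lemma nrm_Lr_diff: "nrm Lr (X - Y) = Lnorm P r (\<lambda>\<omega>. path_nrm (path T X \<omega> - path T Y \<omega>))"
  by (simp add: nrm_Lr path_diff)

lemma regular_elems:
  assumes X: "regular X" and fin: "Lnorm P r (\<lambda>\<omega>. path_nrm (path T X \<omega>)) < \<infinity>"
  shows "X \<in> elems Lr"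
proof -
  have dom: "path_dom P T TT X = space P" using X by (auto simp: path_dom_def regular_def)
  have "path T X \<in> measurable (restrict_space FT (space P)) (seminorm_borel (path_space T TT))"
    using X by (intro measurable_restrict_space1) (simp add: regular_def)
  moreover have "separable_in (path_space T TT) (path T X ` space P)"
    using X path_space.separable_inI unfolding regular_def by blast
  moreover have "X \<in> borel_measurable PP" using X strongly_measurableD unfolding regular_def by blast
  ultimately show ?thesis
    using fin unfolding nrm_Lr[symmetric] by (simp add: Lr_process_def Let_def L0_process_def dom)
qed

lemma regular_dist_measurable:
  assumes "regular X" "regular Y"
  shows "(\<lambda>\<omega>. path_nrm (path T X \<omega> - path T Y \<omega>)) \<in> borel_measurable FT"
proof -
  obtain C where "dense_in (path_space T TT) C (path T X ` space FT)"
    using assms unfolding regular_def space_FT by blast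
  then show ?thesis
    by (intro path_space.nrm_diff_measurable2) (use assms in \<open>auto simp: regular_def\<close>)
qed

lemma Lnorm_triangle:
  assumes "X \<in> elems Lr" "Y \<in> elems Lr" "Z \<in> elems Lr"
  shows "nrm Lr (X - Z) \<le> nrm Lr (X - Y) + nrm Lr (Y - Z)"
proof -
  obtain X' where X': "regular X'" "AE \<omega> in P. path T X' \<omega> = path T X \<omega>"
    using regular_representative[OF assms(1)] by blast
  obtain Y' where Y': "regular Y'" "AE \<omega> in P. path T Y' \<omega> = path T Y \<omega>"
    using regular_representative[OF assms(2)] by blast
  obtain Z' where Z': "regular Z'" "AE \<omega> in P. path T Z' \<omega> = path T Z \<omega>"
    using regular_representative[OF assms(3)] by blast
  have "nrm Lr (X - Z) \<le> Lnorm P r (\<lambda>\<omega>. path_nrm (path T X' \<omega> - path T Y' \<omega>) + path_nrm (path T Y' \<omega> - path T Z' \<omega>))"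
    unfolding nrm_Lr_diff
  proof (rule LP.mono_AE, use X'(2) Z'(2) AE_space in eventually_elim)
    fix \<omega> assume w: "path T X' \<omega> = path T X \<omega>" "path T Z' \<omega> = path T Z \<omega>" "\<omega> \<in> space P"
    show "path_nrm (path T X \<omega> - path T Z \<omega>) \<le>
        path_nrm (path T X' \<omega> - path T Y' \<omega>) + path_nrm (path T Y' \<omega> - path T Z' \<omega>)"
      unfolding w(1,2)[symmetric] using X' Y' Z' w(3)
      by (intro path_space.nrm_tri) (simp_all only: elems_path_space regular_TT)
  qed
  also have "\<dots> \<le> Lnorm P r (\<lambda>\<omega>. path_nrm (path T X' \<omega> - path T Y' \<omega>)) + Lnorm P r (\<lambda>\<omega>. path_nrm (path T Y' \<omega> - path T Z' \<omega>))"
    by (intro LP.add measurable_FT regular_dist_measurable X' Y' Z')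
  also have "Lnorm P r (\<lambda>\<omega>. path_nrm (path T X' \<omega> - path T Y' \<omega>)) = nrm Lr (X - Y)"
    unfolding nrm_Lr_diff by (rule LP.cong_AE) (use X'(2) Y'(2) in \<open>eventually_elim, simp\<close>)
  also have "Lnorm P r (\<lambda>\<omega>. path_nrm (path T Y' \<omega> - path T Z' \<omega>)) = nrm Lr (Y - Z)"
    unfolding nrm_Lr_diff by (rule LP.cong_AE) (use Y'(2) Z'(2) in \<open>eventually_elim, simp\<close>)
  finally show ?thesis .
qed

sublocale Lr: pseudometric Lr
proof
  fix X Y Z assume XYZ: "X \<in> elems Lr" "Y \<in> elems Lr" "Z \<in> elems Lr"
  show "nrm Lr (X - X) = 0"
    unfolding nrm_Lr_diff by (rule LP.zeroI) (simp add: nrm_path_space)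
  have "path_nrm (path T X \<omega> - path T Y \<omega>) = path_nrm (path T Y \<omega> - path T X \<omega>)" for \<omega>
    by (simp add: nrm_path_space norm_minus_commute)
  then show "nrm Lr (X - Y) = nrm Lr (Y - X)" unfolding nrm_Lr_diff by simp
  show "nrm Lr (X - Z) \<le> nrm Lr (X - Y) + nrm Lr (Y - Z)" by (rule Lnorm_triangle[OF XYZ])
qed

text \<open>\<open>TT\<close> is closed relative to the bounded Borel functions, so \<open>y\<close>
  is first shown to be one: Borel as a pointwise limit, bounded because it is uniformly within 1 of
  some \<open>x n0\<close>.\<close>

lemma TT_uniform_limit:
  assumes x: "\<And>n. x n \<in> TT" and lim: "(\<lambda>n. path_nrm (x n - y)) \<longlonglongrightarrow> 0"
    and y: "\<And>t. t \<notin> {0..T} \<Longrightarrow> y t = 0"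
  shows "y \<in> TT"
proof -
  have xB: "x n \<in> borel_measurable (restrict_space borel {0..T})" "bounded (x n ` {0..T})" for n
    using x[of n] TT_Bb by (auto simp: Bb_def)
  have ptw: "(\<lambda>n. x n t) \<longlonglongrightarrow> y t" if t: "t \<in> {0..T}" for t
  proof -
    have "(\<lambda>n. ennreal (norm (x n t - y t))) \<longlonglongrightarrow> 0"
    proof (rule tendsto_sandwich[OF _ _ tendsto_const lim])
      show "\<forall>\<^sub>F n in sequentially. ennreal (norm (x n t - y t)) \<le> path_nrm (x n - y)"
        unfolding fun_diff_def by (intro always_eventually allI norm_le_nrm_path_space[OF t])
    qed simp
    then have "(\<lambda>n. norm (x n t - y t)) \<longlonglongrightarrow> 0"
      by (intro tendsto_ennrealD[where x = 0]) (simp_all)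
    then have "(\<lambda>n. x n t - y t) \<longlonglongrightarrow> 0" by (rule tendsto_norm_zero_cancel)
    then show ?thesis by (rule LIM_zero_cancel)
  qed
  have ym: "y \<in> borel_measurable (restrict_space borel {0..T})"
    by (rule borel_measurable_LIMSEQ_metric[OF xB(1)]) (use ptw in \<open>simp add: space_restrict_space\<close>)
  obtain n0 where n0: "path_nrm (x n0 - y) < 1"
    using order_tendstoD(2)[OF lim, of 1] by (auto simp: eventually_sequentially)
  obtain b where b: "\<And>t. t \<in> {0..T} \<Longrightarrow> norm (x n0 t) \<le> b"
    using xB(2)[of n0] unfolding bounded_iff by blast
  have "norm (y t) \<le> b + 1" if t: "t \<in> {0..T}" for t
  proof -
    have "ennreal (norm ((x n0 - y) t)) < 1"
      by (rule le_less_trans[OF norm_le_nrm_path_space[OF t] n0])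
    then have "norm (x n0 t - y t) < 1" by (simp add: ennreal_less_one_iff)
    then show ?thesis using b[OF t] norm_triangle_ineq2[of "y t" "x n0 t"] by (simp add: norm_minus_commute)
  qed
  then have "bounded (y ` {0..T})" unfolding bounded_iff by blast
  then have yB: "y \<in> elems (Bb T)" using ym y by (auto simp: Bb_def)
  have nrmB: "nrm (Bb T) = path_nrm" by (simp add: path_space_def)
  show ?thesis
  proof (rule ccontr)
    assume "y \<notin> TT"
    have "closedin (seminorm_topology (Bb T)) TT" using TT by (simp add: closed_path_subspace_def)
    then have "openin (seminorm_topology (Bb T)) (elems (Bb T) - TT)" by (simp add: closedin_def)
    then obtain e where e: "e > 0" "\<And>v. v \<in> elems (Bb T) \<Longrightarrow> path_nrm (v - y) < e \<Longrightarrow> v \<in> elems (Bb T) - TT"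
      using yB \<open>y \<notin> TT\<close> unfolding openin_seminorm_topology nrmB by blast
    obtain n where "path_nrm (x n - y) < e"
      using order_tendstoD(2)[OF lim e(1)] by (auto simp: eventually_sequentially)
    then show False using e(2)[of "x n"] x[of n] TT_Bb by blast
  qed
qed

lemma regular_LIMSEQ:
  assumes X: "\<And>n. regular (X n)" and lim: "\<And>\<omega>. \<omega> \<in> space P \<Longrightarrow> (\<lambda>n. path_nrm (path T (X n) \<omega> - path T Y \<omega>)) \<longlonglongrightarrow> 0"
    and Y: "strongly_measurable PP Y"
  shows "regular Y"
proof -
  have TTY: "path T Y \<omega> \<in> TT" if w: "\<omega> \<in> space P" for \<omega>
    by (rule TT_uniform_limit[OF _ lim[OF w]]) (use X w in \<open>auto simp: regular_def path_def\<close>)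
  have "\<forall>n. \<exists>C. dense_in (path_space T TT) C (path T (X n) ` space P)" using X by (simp add: regular_def)
  from choice[OF this] obtain C where C: "\<And>n. dense_in (path_space T TT) (C n) (path T (X n) ` space P)" by blast
  have "dense_in (path_space T TT) (\<Union>n. C n) (path T Y ` space P)"
    by (rule path_space.dense_in_LIMSEQ[OF lim _ C]) (use TTY in auto)
  moreover have "path T Y \<in> measurable FT (seminorm_borel (path_space T TT))"
    by (rule path_space.measurable_LIMSEQ[of FT T TT "\<lambda>n. path T (X n)" _ C])
      (use lim TTY X C in \<open>auto simp: space_FT regular_def\<close>)
  ultimately show ?thesis using Y TTY unfolding regular_def by blast
qed

end

section \<open>Linear combinations of integrands\<close>

context mixed_space
begin

lemma norm_measurable_MD:
  fixes f :: "'a \<times> 'b \<Rightarrow> 'e::real_normed_vector"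
  assumes "strongly_measurable \<D> f"
  shows "(\<lambda>x. ennreal (norm (f x))) \<in> borel_measurable MD"
  unfolding measurable_MD by (rule borel_measurable_norm_strongly[OF assms])

lemma elems_Lpq_finite:
  "f \<in> elems (Lpq p q D1 D2 \<nu>1 \<D> normed_type) \<Longrightarrow> NN (\<lambda>x. ennreal (norm (f x))) < \<infinity>"
  unfolding elems_Lpq_iff by simp

lemma zero_elems_Lpq: "(\<lambda>_. 0 :: 'e::real_normed_vector) \<in> elems (Lpq p q D1 D2 \<nu>1 \<D> normed_type)"
  by (rule strongly_elems_Lpq) simp_all

lemma scaleR_elems_Lpq:
  fixes f :: "'a \<times> 'b \<Rightarrow> 'e::real_normed_vector"
  assumes f: "strongly_measurable \<D> f" "NN (\<lambda>x. ennreal (norm (f x))) < \<infinity>"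
  shows "(\<lambda>x. c *\<^sub>R f x) \<in> elems (Lpq p q D1 D2 \<nu>1 \<D> normed_type)"
    and "NN (\<lambda>x. ennreal (norm (c *\<^sub>R f x))) = ennreal \<bar>c\<bar> * NN (\<lambda>x. ennreal (norm (f x)))"
proof -
  have "(\<lambda>x. ennreal (norm (f x))) \<in> borel_measurable MD"
    unfolding measurable_MD by (rule borel_measurable_norm_strongly[OF f(1)])
  then have "NN (\<lambda>x. ennreal \<bar>c\<bar> * ennreal (norm (f x))) = ennreal \<bar>c\<bar> * NN (\<lambda>x. ennreal (norm (f x)))"
    by (rule MD.cmult)
  then show eq: "NN (\<lambda>x. ennreal (norm (c *\<^sub>R f x))) = ennreal \<bar>c\<bar> * NN (\<lambda>x. ennreal (norm (f x)))"
    by (simp add: ennreal_mult)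
  show "(\<lambda>x. c *\<^sub>R f x) \<in> elems (Lpq p q D1 D2 \<nu>1 \<D> normed_type)"
  proof (rule strongly_elems_Lpq)
    show "NN (\<lambda>x. ennreal (norm (c *\<^sub>R f x))) < \<infinity>"
      unfolding eq using f(2) by (simp add: ennreal_mult_less_top)
  qed (rule strongly_measurable_scaleR[OF f(1)])
qed

lemma add_elems_Lpq:
  fixes f h :: "'a \<times> 'b \<Rightarrow> 'e::real_normed_vector"
  assumes f: "strongly_measurable \<D> f" "NN (\<lambda>x. ennreal (norm (f x))) < \<infinity>"
    and h: "strongly_measurable \<D> h" "NN (\<lambda>x. ennreal (norm (h x))) < \<infinity>"
  shows "(\<lambda>x. f x + h x) \<in> elems (Lpq p q D1 D2 \<nu>1 \<D> normed_type)"
proof (rule strongly_elems_Lpq)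
  have "NN (\<lambda>x. ennreal (norm (f x + h x))) \<le> NN (\<lambda>x. ennreal (norm (f x)) + ennreal (norm (h x)))"
    by (rule MD.mono) (simp add: ennreal_plus[symmetric] ennreal_leI norm_triangle_ineq del: ennreal_plus)
  also have "\<dots> \<le> NN (\<lambda>x. ennreal (norm (f x))) + NN (\<lambda>x. ennreal (norm (h x)))"
    by (rule MD.add[OF norm_measurable_MD[OF f(1)] norm_measurable_MD[OF h(1)]])
  also have "\<dots> < \<infinity>" using f(2) h(2) by simp
  finally show "NN (\<lambda>x. ennreal (norm (f x + h x))) < \<infinity>" .
qed (rule strongly_measurable_add[OF f(1) h(1)])

lemma AE_eq_if_nrm_zero:
  fixes f h :: "'a \<times> 'b \<Rightarrow> 'e::real_normed_vector"
  assumes "f \<in> elems (Lpq p q D1 D2 \<nu>1 \<D> normed_type)" "h \<in> elems (Lpq p q D1 D2 \<nu>1 \<D> normed_type)"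
    and 0: "NN (\<lambda>x. ennreal (norm (f x - h x))) = 0"
  shows "AE x in MD. f x = h x"
proof -
  obtain f' where f': "strongly_measurable \<D> f'" "AE x in MD. f x = f' x"
    using strongly_representative[OF assms(1)] by blast
  obtain h' where h': "strongly_measurable \<D> h'" "AE x in MD. h x = h' x"
    using strongly_representative[OF assms(2)] by blast
  have "AE x in MD. ennreal (norm (f' x - h' x)) = ennreal (norm (f x - h x))"
    using f'(2) h'(2) by eventually_elim simp
  then have "NN (\<lambda>x. ennreal (norm (f' x - h' x))) = 0"
    unfolding 0[symmetric] by (rule MD.cong_AE)
  then have "AE x in MD. ennreal (norm (f' x - h' x)) = 0"
    by (rule MD.zeroD[OF norm_measurable_MD[OF strongly_measurable_diff[OF f'(1) h'(1)]]])
  then show ?thesis using f'(2) h'(2) by eventually_elim (simp add: ennreal_eq_0_iff)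
qed

text \<open>The pointwise difference of two elements may fail to be an element; the difference of
  strongly measurable versions is one. Through \<open>k\<close> the operator bound passes from
  single elements to differences.\<close>

lemma diff_representative:
  fixes f h :: "'a \<times> 'b \<Rightarrow> 'e::real_normed_vector"
  assumes "f \<in> elems (Lpq p q D1 D2 \<nu>1 \<D> normed_type)" "h \<in> elems (Lpq p q D1 D2 \<nu>1 \<D> normed_type)"
  obtains k where "strongly_measurable \<D> k" "k \<in> elems (Lpq p q D1 D2 \<nu>1 \<D> normed_type)"
    "AE x in MD. k x = f x - h x"
proof -
  obtain f' where f': "strongly_measurable \<D> f'" "f' \<in> elems (Lpq p q D1 D2 \<nu>1 \<D> normed_type)" "AE x in MD. f x = f' x"
    using strongly_representative[OF assms(1)] by blast
  obtain h' where h': "strongly_measurable \<D> h'" "h' \<in> elems (Lpq p q D1 D2 \<nu>1 \<D> normed_type)" "AE x in MD. h x = h' x"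
    using strongly_representative[OF assms(2)] by blast
  have "strongly_measurable \<D> (\<lambda>x. - 1 *\<^sub>R h' x)" by (rule strongly_measurable_scaleR[OF h'(1)])
  then have "(\<lambda>x. f' x + - 1 *\<^sub>R h' x) \<in> elems (Lpq p q D1 D2 \<nu>1 \<D> normed_type)"
    by (intro add_elems_Lpq f' elems_Lpq_finite scaleR_elems_Lpq h')
  then have "(\<lambda>x. f' x - h' x) \<in> elems (Lpq p q D1 D2 \<nu>1 \<D> normed_type)" by simp
  moreover have "AE x in MD. f' x - h' x = f x - h x" using f'(3) h'(3) by eventually_elim simp
  ultimately show thesis by (rule that[OF strongly_measurable_diff[OF f'(1) h'(1)]])
qed

end

section \<open>Scaling and almost sure modification of processes\<close>

context process_setup
begin

lemma nrm_path_space_scaleR: "path_nrm (\<lambda>t. c *\<^sub>R x t) = ennreal \<bar>c\<bar> * path_nrm x"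
proof -
  have "path_nrm (\<lambda>t. c *\<^sub>R x t) = (SUP t\<in>{0..T}. ennreal \<bar>c\<bar> * ennreal (norm (x t)))"
    unfolding nrm_path_space by (simp add: ennreal_mult)
  also have "\<dots> = ennreal \<bar>c\<bar> * path_nrm x"
    unfolding nrm_path_space by (rule SUP_mult_left_ennreal[symmetric])
  finally show ?thesis .
qed

lemma path_zero: "path T (\<lambda>_. 0) \<omega> = (\<lambda>t. 0)"
  by (auto simp: path_def)

lemma regular_zero: "regular (\<lambda>_. 0)"
proof -
  have "dense_in (path_space T TT) {\<lambda>t. 0} (path T (\<lambda>_. 0) ` space P)"
    using zero_TT unfolding dense_in_def by (auto simp: path_zero nrm_path_space)
  moreover have "path T (\<lambda>_. 0) \<in> measurable FT (seminorm_borel (path_space T TT))"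
    unfolding path_zero[abs_def] using zero_TT by (simp add: path_zero[abs_def] measurable_const cong: measurable_cong)
  ultimately show ?thesis using zero_TT unfolding regular_def by (auto simp: path_zero)
qed

lemma regular_nrm_measurable:
  assumes "regular X"
  shows "(\<lambda>\<omega>. path_nrm (path T X \<omega>)) \<in> borel_measurable FT"
proof -
  have "path T X \<omega> - path T (\<lambda>_. 0) \<omega> = path T X \<omega>" for \<omega> by (simp add: path_zero fun_eq_iff)
  then show ?thesis using regular_dist_measurable[OF assms regular_zero] by simp
qed

text \<open>An almost sure event is a set of \<open>FT\<close>, and its cylinder is a set of
  \<open>PP\<close>, so switching the process off outside it preserves every part of
  regularity.\<close>

lemma regular_If:
  assumes X: "regular X" and Q: "AE \<omega> in P. Q \<omega>"
  shows "regular (\<lambda>z. if Q (fst z) then X z else 0)"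
proof -
  let ?\<Omega> = "{\<omega> \<in> space P. Q \<omega>}"
  note \<Omega> = AE_imp_sets_FT(2,3)[OF Q]
  have path': "path T (\<lambda>z. if Q (fst z) then X z else 0) \<omega> = (if Q \<omega> then path T X \<omega> else path T (\<lambda>_. 0) \<omega>)" for \<omega>
    by (auto simp: path_def fun_eq_iff)
  obtain C where C: "dense_in (path_space T TT) C (path T X ` space P)" using X unfolding regular_def by blast
  have "{z \<in> space PP. Q (fst z)} = ?\<Omega> \<times> {0..T}" by (auto simp: space_PP)
  then have "Measurable.pred PP (\<lambda>z. Q (fst z))" using \<Omega>(2) by (simp add: pred_def)
  moreover have "strongly_measurable PP X" using X by (simp add: regular_def)
  ultimately have "strongly_measurable PP (\<lambda>z. if Q (fst z) then X z else 0)"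
    by (intro strongly_measurable_If) simp_all
  moreover have "path T (\<lambda>z. if Q (fst z) then X z else 0) \<in> measurable FT (seminorm_borel (path_space T TT))"
  proof -
    have "{\<omega> \<in> space FT. Q \<omega>} \<in> sets FT" using \<Omega>(1) by (simp add: space_FT)
    then have "(\<lambda>\<omega>. if Q \<omega> then path T X \<omega> else path T (\<lambda>_. 0) \<omega>) \<in> measurable FT (seminorm_borel (path_space T TT))"
      using X regular_zero unfolding regular_def by (intro measurable_If) blast+
    then show ?thesis unfolding path'[symmetric] .
  qed
  moreover have "path T (\<lambda>z. if Q (fst z) then X z else 0) \<omega> \<in> TT" if "\<omega> \<in> space P" for \<omega>
    unfolding path' using regular_TT[OF X that] zero_TT by (simp add: path_zero)
  moreover have "dense_in (path_space T TT) (insert (\<lambda>t. 0) C) (path T (\<lambda>z. if Q (fst z) then X z else 0) ` space P)"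
  proof (rule dense_in_subset[OF path_space.dense_in_insert[OF C]])
    show "path T (\<lambda>z. if Q (fst z) then X z else 0) ` space P \<subseteq> insert (\<lambda>t. 0) (path T X ` space P)"
      by (auto simp: path' path_zero)
  qed (simp add: zero_TT)
  ultimately show ?thesis unfolding regular_def by blast
qed

end

section \<open>Continuous linear operators\<close>

text \<open>Linearity refers to a third element \<open>h\<close>, equal to the combination almost
  everywhere, because the pointwise combination of two representatives may fail to be an element.
  For \<open>a = 1\<close> and \<open>b = 0\<close> it also says that \<open>LL\<close> respects
  equality almost everywhere.\<close>

locale operator = mixed_space p q D1 D2 \<nu>1 \<D> + process_setup P FT T PP TT r
  for p q :: real and D1 :: "'a measure" and D2 :: "'b measure" and \<nu>1 and \<D>
    and P FT :: "'o measure" and T :: real and PP and TT :: "(real \<Rightarrow> 'f::banach) set" and r +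
  fixes LL :: "('a \<times> 'b \<Rightarrow> 'e::banach) \<Rightarrow> ('o \<times> real \<Rightarrow> 'f)"
  assumes continuous:
      "continuous_map (seminorm_topology (Lpq p q D1 D2 \<nu>1 \<D> normed_type)) (seminorm_topology Lr) LL"
    and linear: "\<And>f1 f2 h a b. \<lbrakk>f1 \<in> elems (Lpq p q D1 D2 \<nu>1 \<D> normed_type);
       f2 \<in> elems (Lpq p q D1 D2 \<nu>1 \<D> normed_type); h \<in> elems (Lpq p q D1 D2 \<nu>1 \<D> normed_type);
       AE x in restr_to_subalg (kernel_measure D1 D2 \<nu>1) \<D>. h x = a *\<^sub>R f1 x + b *\<^sub>R f2 x\<rbrakk> \<Longrightarrow>
       AE \<omega> in P. \<forall>t\<in>{0..T}. LL h (\<omega>, t) = a *\<^sub>R LL f1 (\<omega>, t) + b *\<^sub>R LL f2 (\<omega>, t)"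
begin

abbreviation "Epq \<equiv> (Lpq p q D1 D2 \<nu>1 \<D> normed_type :: ('a \<times> 'b \<Rightarrow> 'e) seminormed)"

lemma LL_elems: "f \<in> elems Epq \<Longrightarrow> LL f \<in> elems Lr"
  using continuous_map_funspace[OF continuous] by auto

lemma linear_path:
  assumes "f1 \<in> elems Epq" "f2 \<in> elems Epq" "h \<in> elems Epq" "AE x in MD. h x = a *\<^sub>R f1 x + b *\<^sub>R f2 x"
  shows "AE \<omega> in P. path T (LL h) \<omega> = (\<lambda>t. a *\<^sub>R path T (LL f1) \<omega> t + b *\<^sub>R path T (LL f2) \<omega> t)"
  using linear[OF assms] by eventually_elim (auto simp: path_def)

lemma LL_zero: "AE \<omega> in P. path T (LL (\<lambda>_. 0)) \<omega> = (\<lambda>t. 0)"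
  using linear_path[OF zero_elems_Lpq zero_elems_Lpq zero_elems_Lpq, of 0 0] by simp

lemma bounded_near_zero:
  obtains d :: real where "d > 0"
    "\<And>h. h \<in> elems Epq \<Longrightarrow> NN (\<lambda>x. ennreal (norm (h x))) < ennreal d \<Longrightarrow> nrm Lr (LL h) < 1"
proof -
  let ?U = "{X \<in> elems Lr. nrm Lr (X - LL (\<lambda>_. 0)) < 1}"
  have z: "(\<lambda>_. 0) \<in> elems Epq" by (rule zero_elems_Lpq)
  have "openin (seminorm_topology Epq) {f \<in> elems Epq. LL f \<in> ?U}"
    using openin_continuous_map_preimage[OF continuous Lr.openin_ball[OF LL_elems[OF z], of 1]] by simp
  moreover have "(\<lambda>_. 0) \<in> {f \<in> elems Epq. LL f \<in> ?U}"
    using z LL_elems[OF z] Lr.nrm_self[OF LL_elems[OF z]] by simp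
  ultimately obtain e where e: "e > 0"
    "\<And>h. h \<in> elems Epq \<Longrightarrow> nrm Epq (h - (\<lambda>_. 0)) < e \<Longrightarrow> LL h \<in> ?U"
    unfolding openin_seminorm_topology by blast
  obtain d' where d': "0 < d'" "d' < e" using dense[OF e(1)] by blast
  define d where "d = enn2real d'"
  have top: "d' < top" using d'(2) by (rule order.strict_trans2) simp
  have d: "d > 0" "ennreal d = d'"
    unfolding d_def using d' top by (simp_all add: enn2real_positive_iff)
  show thesis
  proof (rule that[OF d(1)])
    fix h assume h: "h \<in> elems Epq" "NN (\<lambda>x. ennreal (norm (h x))) < ennreal d"
    have "nrm Epq (h - (\<lambda>_. 0)) < e"
      using h(2) d'(2) unfolding d(2) nrm_Lpq_eq by simp
    then have "nrm Lr (LL h - LL (\<lambda>_. 0)) < 1" using e(2)[OF h(1)] by simp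
    moreover have "nrm Lr (LL h - LL (\<lambda>_. 0)) = nrm Lr (LL h)"
      unfolding nrm_Lr_diff unfolding nrm_Lr
      by (rule LP.cong_AE, use LL_zero in eventually_elim) (simp add: fun_diff_def)
    ultimately show "nrm Lr (LL h) < 1" by simp
  qed
qed

lemma bounded:
  obtains C :: real where
    "\<And>f1 f2. f1 \<in> elems Epq \<Longrightarrow> f2 \<in> elems Epq \<Longrightarrow>
       nrm Lr (LL f1 - LL f2) \<le> ennreal C * NN (\<lambda>x. ennreal (norm (f1 x - f2 x)))"
proof -
  obtain d :: real where d: "d > 0"
    "\<And>h. h \<in> elems Epq \<Longrightarrow> NN (\<lambda>x. ennreal (norm (h x))) < ennreal d \<Longrightarrow> nrm Lr (LL h) < 1"
    by (rule bounded_near_zero) blast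
  have h: "nrm Lr (LL h) \<le> ennreal (2 / d) * NN (\<lambda>x. ennreal (norm (h x)))"
    if h: "h \<in> elems Epq" "strongly_measurable \<D> h" for h
  proof -
    obtain a where a: "NN (\<lambda>x. ennreal (norm (h x))) = ennreal a" "a \<ge> 0"
      using elems_Lpq_finite[OF h(1)] by (cases "NN (\<lambda>x. ennreal (norm (h x)))") auto
    have scale: "ennreal c * nrm Lr (LL h) < 1" if c: "c > 0" "c * a < d" for c
    proof -
      note sc = scaleR_elems_Lpq[OF h(2) elems_Lpq_finite[OF h(1)], of c]
      have "ennreal c * NN (\<lambda>x. ennreal (norm (h x))) < ennreal d"
        unfolding a(1) using c a(2) d(1) by (simp add: ennreal_mult[symmetric] ennreal_less_iff)
      then have "nrm Lr (LL (\<lambda>x. c *\<^sub>R h x)) < 1" using sc c(1) by (intro d(2)) simp_all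
      moreover have "nrm Lr (LL (\<lambda>x. c *\<^sub>R h x)) = Lnorm P r (\<lambda>\<omega>. ennreal c * path_nrm (path T (LL h) \<omega>))"
        unfolding nrm_Lr
      proof (rule LP.cong_AE)
        have "AE \<omega> in P. path T (LL (\<lambda>x. c *\<^sub>R h x)) \<omega> = (\<lambda>t. c *\<^sub>R path T (LL h) \<omega> t + 0 *\<^sub>R path T (LL h) \<omega> t)"
          by (rule linear_path[OF h(1) h(1) sc(1)]) simp
        then show "AE \<omega> in P. path_nrm (path T (LL (\<lambda>x. c *\<^sub>R h x)) \<omega>) = ennreal c * path_nrm (path T (LL h) \<omega>)"
        proof eventually_elim
          fix \<omega> assume "path T (LL (\<lambda>x. c *\<^sub>R h x)) \<omega> = (\<lambda>t. c *\<^sub>R path T (LL h) \<omega> t + 0 *\<^sub>R path T (LL h) \<omega> t)"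
          then have "path T (LL (\<lambda>x. c *\<^sub>R h x)) \<omega> = (\<lambda>t. c *\<^sub>R path T (LL h) \<omega> t)" by simp
          then show "path_nrm (path T (LL (\<lambda>x. c *\<^sub>R h x)) \<omega>) = ennreal c * path_nrm (path T (LL h) \<omega>)"
            using c(1) by (simp only: nrm_path_space_scaleR abs_of_pos)
        qed
      qed
      moreover have "Lnorm P r (\<lambda>\<omega>. ennreal c * path_nrm (path T (LL h) \<omega>)) = ennreal c * nrm Lr (LL h)"
      proof -
        obtain X where X: "regular X" "AE \<omega> in P. path T X \<omega> = path T (LL h) \<omega>"
          by (rule regular_representative[OF LL_elems[OF h(1)]])
        have "Lnorm P r (\<lambda>\<omega>. ennreal c * path_nrm (path T (LL h) \<omega>)) = Lnorm P r (\<lambda>\<omega>. ennreal c * path_nrm (path T X \<omega>))"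
          by (rule LP.cong_AE) (use X(2) in \<open>eventually_elim, simp\<close>)
        also have "\<dots> = ennreal c * Lnorm P r (\<lambda>\<omega>. path_nrm (path T X \<omega>))"
          by (rule LP.cmult[OF measurable_FT[OF regular_nrm_measurable[OF X(1)]]])
        also have "Lnorm P r (\<lambda>\<omega>. path_nrm (path T X \<omega>)) = nrm Lr (LL h)"
          unfolding nrm_Lr by (rule LP.cong_AE) (use X(2) in \<open>eventually_elim, simp\<close>)
        finally show ?thesis .
      qed
      ultimately show ?thesis by simp
    qed
    have "nrm Lr (LL h) < top"
    proof -
      \<comment> \<open>The factor \<open>d / (a + 1)\<close> is admissible also when
        \<open>a = 0\<close>; it serves only to show that the norm of the image is finite.\<close>
      have "d / (a + 1) * a < d" using d(1) a(2) by (simp add: field_simps)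
      then have "ennreal (d / (a + 1)) * nrm Lr (LL h) < 1" using d(1) a(2) by (intro scale) auto
      moreover have "d / (a + 1) > 0" using d(1) a(2) by simp
      ultimately show ?thesis
        by (cases "nrm Lr (LL h)") (auto simp: ennreal_mult_top ennreal_eq_0_iff simp flip: not_less)
    qed
    then obtain n where n: "nrm Lr (LL h) = ennreal n" "n \<ge> 0" by (cases "nrm Lr (LL h)") auto
    have scale': "c * n < 1" if "c > 0" "c * a < d" for c
      using scale[OF that] n that(1) by (simp add: ennreal_mult[symmetric] ennreal_less_one_iff)
    \<comment> \<open>For \<open>a > 0\<close> the factor \<open>d / (2 * a)\<close> produces the
      constant \<open>2 / d\<close>. For \<open>a = 0\<close> every positive factor is admissible,
      and \<open>2 / n\<close> would contradict \<open>scale'\<close>.\<close>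
    have "n \<le> 2 / d * a"
    proof (cases "a = 0")
      case True
      have "n = 0"
      proof (rule ccontr)
        assume "n \<noteq> 0"
        then show False using scale'[of "2 / n"] n(2) True d(1) by auto
      qed
      then show ?thesis using True by simp
    next
      case False
      then show ?thesis using scale'[of "d / (2 * a)"] a(2) d(1) by (simp add: field_simps)
    qed
    then show ?thesis unfolding n(1) a(1) using d(1) a(2) by (simp add: ennreal_mult[symmetric] ennreal_leI)
  qed
  show thesis
  proof (rule that[of "2 / d"])
    fix f1 f2 assume f: "f1 \<in> elems Epq" "f2 \<in> elems Epq"
    obtain k where k: "strongly_measurable \<D> k" "k \<in> elems Epq" "AE x in MD. k x = f1 x - f2 x"
      by (rule diff_representative[OF f])
    have "AE x in MD. k x = 1 *\<^sub>R f1 x + (- 1) *\<^sub>R f2 x" using k(3) by eventually_elim simp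
    then have "AE \<omega> in P. path T (LL k) \<omega> = (\<lambda>t. 1 *\<^sub>R path T (LL f1) \<omega> t + (- 1) *\<^sub>R path T (LL f2) \<omega> t)"
      by (rule linear_path[OF f k(2)])
    then have "AE \<omega> in P. path_nrm (path T (LL f1) \<omega> - path T (LL f2) \<omega>) = path_nrm (path T (LL k) \<omega>)"
      by eventually_elim (simp add: fun_diff_def)
    then have "nrm Lr (LL f1 - LL f2) = nrm Lr (LL k)"
      unfolding nrm_Lr path_diff by (rule LP.cong_AE)
    also have "\<dots> \<le> ennreal (2 / d) * NN (\<lambda>x. ennreal (norm (k x)))" by (rule h[OF k(2,1)])
    also have "NN (\<lambda>x. ennreal (norm (k x))) = NN (\<lambda>x. ennreal (norm (f1 x - f2 x)))"
      by (rule MD.cong_AE) (use k(3) in \<open>eventually_elim, simp\<close>)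
    finally show "nrm Lr (LL f1 - LL f2) \<le> ennreal (2 / d) * NN (\<lambda>x. ennreal (norm (f1 x - f2 x)))" .
  qed
qed

text \<open>An arbitrary choice of a regular version for each \<open>f\<close>, with no claim about
  its dependence on \<open>f\<close>. This is harmless along a step function, which has finitely
  many values.\<close>

definition LR :: "('a \<times> 'b \<Rightarrow> 'e) \<Rightarrow> 'o \<times> real \<Rightarrow> 'f" where
  "LR f = (SOME X. regular X \<and> (AE \<omega> in P. path T X \<omega> = path T (LL f) \<omega>))"

lemma LR:
  assumes "f \<in> elems Epq"
  shows "regular (LR f)" "AE \<omega> in P. path T (LR f) \<omega> = path T (LL f) \<omega>"
proof -
  obtain X where "regular X" "AE \<omega> in P. path T X \<omega> = path T (LL f) \<omega>"
    by (rule regular_representative[OF LL_elems[OF assms]])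
  then have "\<exists>X. regular X \<and> (AE \<omega> in P. path T X \<omega> = path T (LL f) \<omega>)" by blast
  from someI_ex[OF this, folded LR_def]
  show "regular (LR f)" "AE \<omega> in P. path T (LR f) \<omega> = path T (LL f) \<omega>" by blast+
qed

text \<open>The pair is a single argument, so that along a simple function of consecutive steps the
  distance depends on \<open>y\<close> through finitely many values.\<close>

definition pdist :: "('a \<times> 'b \<Rightarrow> 'e) \<times> ('a \<times> 'b \<Rightarrow> 'e) \<Rightarrow> 'o \<Rightarrow> ennreal" where
  "pdist v \<omega> = path_nrm (path T (LR (fst v)) \<omega> - path T (LR (snd v)) \<omega>)"

lemma pdist_measurable:
  assumes "fst v \<in> elems Epq" "snd v \<in> elems Epq"
  shows "pdist v \<in> borel_measurable FT"
  unfolding pdist_def[abs_def] by (intro regular_dist_measurable LR assms)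

lemma norm_le_pdist:
  assumes "t \<in> {0..T}"
  shows "ennreal (norm (LR f1 (\<omega>, t) - LR f2 (\<omega>, t))) \<le> pdist (f1, f2) \<omega>"
  using norm_le_nrm_path_space[OF assms, of "path T (LR f1) \<omega> - path T (LR f2) \<omega>" TT] assms
  by (simp add: pdist_def path_def)

definition op_bound :: real where
  "op_bound = (SOME C. \<forall>f1\<in>elems Epq. \<forall>f2\<in>elems Epq.
     nrm Lr (LL f1 - LL f2) \<le> ennreal C * NN (\<lambda>x. ennreal (norm (f1 x - f2 x))))"

lemma pdist_bounded:
  assumes f: "f1 \<in> elems Epq" "f2 \<in> elems Epq"
  shows "Lnorm P r (pdist (f1, f2)) \<le> ennreal op_bound * nrm Epq (f1 - f2)"
proof -
  have "\<exists>C. \<forall>f1\<in>elems Epq. \<forall>f2\<in>elems Epq.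
     nrm Lr (LL f1 - LL f2) \<le> ennreal C * NN (\<lambda>x. ennreal (norm (f1 x - f2 x)))"
    by (rule bounded) blast
  from someI_ex[OF this, folded op_bound_def]
  have "nrm Lr (LL f1 - LL f2) \<le> ennreal op_bound * NN (\<lambda>x. ennreal (norm (f1 x - f2 x)))"
    using f by blast
  moreover have "Lnorm P r (pdist (f1, f2)) = nrm Lr (LL f1 - LL f2)"
    unfolding nrm_Lr_diff pdist_def[abs_def]
    by (rule LP.cong_AE) (use LR(2)[OF f(1)] LR(2)[OF f(2)] in \<open>eventually_elim, simp\<close>)
  ultimately show ?thesis by (simp add: nrm_Lpq_eq)
qed

lemma LR_AE_eq:
  assumes "f \<in> elems Epq"
  shows "AE \<omega> in P. \<forall>t\<in>{0..T}. LR f (\<omega>, t) = LL f (\<omega>, t)"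
  using LR(2)[OF assms]
proof eventually_elim
  fix \<omega> assume "path T (LR f) \<omega> = path T (LL f) \<omega>"
  then show "\<forall>t\<in>{0..T}. LR f (\<omega>, t) = LL f (\<omega>, t)"
    by (auto simp: path_def fun_eq_iff split: if_splits)
qed

text \<open>Linearity for a finite combination, up to one null set of outcomes that serves all
  times. Strong measurability keeps the partial sums in \<open>elems Epq\<close>, which sums of
  arbitrary elements may leave.\<close>

lemma LR_sum:
  assumes I: "finite I" and f: "\<And>v. v \<in> I \<Longrightarrow> f v \<in> elems Epq" "\<And>v. v \<in> I \<Longrightarrow> strongly_measurable \<D> (f v)"
  shows "(\<lambda>x. \<Sum>v\<in>I. c v *\<^sub>R f v x) \<in> elems Epq \<and>
    (AE \<omega> in P. \<forall>t\<in>{0..T}. LR (\<lambda>x. \<Sum>v\<in>I. c v *\<^sub>R f v x) (\<omega>, t) = (\<Sum>v\<in>I. c v *\<^sub>R LR (f v) (\<omega>, t)))"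
  using I f
proof induction
  case empty
  have "AE \<omega> in P. \<forall>t\<in>{0..T}. LR (\<lambda>x. 0) (\<omega>, t) = 0"
    using LR_AE_eq[OF zero_elems_Lpq] LL_zero
  proof eventually_elim
    fix \<omega> assume w: "\<forall>t\<in>{0..T}. LR (\<lambda>_. 0) (\<omega>, t) = LL (\<lambda>_. 0) (\<omega>, t)" "path T (LL (\<lambda>_. 0)) \<omega> = (\<lambda>t. 0)"
    show "\<forall>t\<in>{0..T}. LR (\<lambda>x. 0) (\<omega>, t) = 0"
    proof
      fix t assume t: "t \<in> {0..T}"
      have "path T (LL (\<lambda>_. 0)) \<omega> t = 0" using w(2) by simp
      then show "LR (\<lambda>x. 0) (\<omega>, t) = 0" using w(1) t by (simp add: path_def)
    qed
  qed
  then show ?case using zero_elems_Lpq by simp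
next
  case (insert i I)
  let ?S = "\<lambda>x. \<Sum>v\<in>I. c v *\<^sub>R f v x"
  have IH: "?S \<in> elems Epq" "AE \<omega> in P. \<forall>t\<in>{0..T}. LR ?S (\<omega>, t) = (\<Sum>v\<in>I. c v *\<^sub>R LR (f v) (\<omega>, t))"
    using insert by auto
  have fi: "f i \<in> elems Epq" "strongly_measurable \<D> (f i)" using insert.prems by auto
  have "strongly_measurable \<D> ?S"
    by (intro strongly_measurable_sum strongly_measurable_scaleR insert.hyps) (use insert.prems in auto)
  then have "(\<lambda>x. c i *\<^sub>R f i x + ?S x) \<in> elems Epq"
    by (intro add_elems_Lpq elems_Lpq_finite IH scaleR_elems_Lpq strongly_measurable_scaleR fi)
  then have mem: "(\<lambda>x. \<Sum>v\<in>insert i I. c v *\<^sub>R f v x) \<in> elems Epq" using insert.hyps by simp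
  have "AE x in MD. (\<Sum>v\<in>insert i I. c v *\<^sub>R f v x) = c i *\<^sub>R f i x + 1 *\<^sub>R ?S x"
    using insert.hyps by simp
  from linear[OF fi(1) IH(1) mem this]
  have "AE \<omega> in P. \<forall>t\<in>{0..T}. LL (\<lambda>x. \<Sum>v\<in>insert i I. c v *\<^sub>R f v x) (\<omega>, t) =
      c i *\<^sub>R LL (f i) (\<omega>, t) + 1 *\<^sub>R LL ?S (\<omega>, t)" .
  then have "AE \<omega> in P. \<forall>t\<in>{0..T}. LR (\<lambda>x. \<Sum>v\<in>insert i I. c v *\<^sub>R f v x) (\<omega>, t) =
      (\<Sum>v\<in>insert i I. c v *\<^sub>R LR (f v) (\<omega>, t))"
    using LR_AE_eq[OF mem] LR_AE_eq[OF fi(1)] LR_AE_eq[OF IH(1)] IH(2)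
    by eventually_elim (use insert.hyps in simp)
  with mem show ?case by blast
qed

end

section \<open>The Fubini theorem\<close>

text \<open>A subsequence of the approximating simple functions has geometric errors. Passing to
  strongly measurable versions by a function \<open>\<rho>\<close> of the value keeps the functions
  simple and changes no distance.\<close>

lemma (in mixed_space) step_approximation:
  fixes g :: "'g \<Rightarrow> ('a \<times> 'b \<Rightarrow> 'e::banach)"
  assumes g: "g \<in> elems (L1 G (Lpq p q D1 D2 \<nu>1 \<D> normed_type))"
  obtains s :: "nat \<Rightarrow> 'g \<Rightarrow> ('a \<times> 'b \<Rightarrow> 'e)" where "\<And>n. simple_function G (s n)"
    "\<And>n y. y \<in> space G \<Longrightarrow> s n y \<in> elems (Lpq p q D1 D2 \<nu>1 \<D> normed_type)"
    "\<And>n y. y \<in> space G \<Longrightarrow> strongly_measurable \<D> (s n y)"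
    "\<And>n. (\<integral>\<^sup>+y. nrm (Lpq p q D1 D2 \<nu>1 \<D> normed_type) (g y - s n y) \<partial>G) \<le> ennreal ((1 / 2) ^ n)"
proof -
  let ?V = "Lpq p q D1 D2 \<nu>1 \<D> normed_type :: ('a \<times> 'b \<Rightarrow> 'e) seminormed"
  obtain s where s: "\<And>i::nat. simple_function G (s i)" "\<And>i. s i \<in> space G \<rightarrow> elems ?V"
    and lim: "(\<lambda>i. \<integral>\<^sup>+y. nrm ?V (g y - s i y) \<partial>G) \<longlonglongrightarrow> 0"
    using g unfolding L1_def by auto
  obtain k where k: "\<And>n. (\<integral>\<^sup>+y. nrm ?V (g y - s (k n) y) \<partial>G) < ennreal ((1 / 2) ^ n)"
    by (rule LIMSEQ_zero_select[OF lim, of "\<lambda>n. ennreal ((1 / 2) ^ n)"]) auto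
  have "\<forall>f\<in>elems ?V. \<exists>f'. strongly_measurable \<D> f' \<and> f' \<in> elems ?V \<and> (AE x in MD. f x = f' x)"
  proof
    fix f assume "f \<in> elems ?V"
    then show "\<exists>f'. strongly_measurable \<D> f' \<and> f' \<in> elems ?V \<and> (AE x in MD. f x = f' x)"
      by (rule strongly_representative) blast
  qed
  from bchoice[OF this] obtain \<rho> where
    \<rho>: "\<forall>f\<in>elems ?V. strongly_measurable \<D> (\<rho> f) \<and> \<rho> f \<in> elems ?V \<and> (AE x in MD. f x = \<rho> f x)" ..
  have mem: "s i y \<in> elems ?V" if "y \<in> space G" for i y using s(2)[of i] that by blast
  show thesis
  proof (rule that)
    show "simple_function G (\<lambda>y. \<rho> (s (k n) y))" for n by (rule simple_function_compose1[OF s(1)])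
    show "\<rho> (s (k n) y) \<in> elems ?V" "strongly_measurable \<D> (\<rho> (s (k n) y))" if "y \<in> space G" for n y
      using bspec[OF \<rho> mem[OF that]] by blast+
    show "(\<integral>\<^sup>+y. nrm ?V (g y - \<rho> (s (k n) y)) \<partial>G) \<le> ennreal ((1 / 2) ^ n)" for n
    proof -
      have "(\<integral>\<^sup>+y. nrm ?V (g y - \<rho> (s (k n) y)) \<partial>G) = (\<integral>\<^sup>+y. nrm ?V (g y - s (k n) y) \<partial>G)"
      proof (rule nn_integral_cong)
        fix y assume "y \<in> space G"
        then have "AE x in MD. s (k n) y x = \<rho> (s (k n) y) x" using bspec[OF \<rho> mem] by blast
        then show "nrm ?V (g y - \<rho> (s (k n) y)) = nrm ?V (g y - s (k n) y)"
          unfolding nrm_Lpq_eq by (intro MD.cong_AE, eventually_elim) simp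
      qed
      then show ?thesis using k[of n] by simp
    qed
  qed
qed

section \<open>Error estimates and the integrand\<close>

locale fubini_approx = operator p q D1 D2 \<nu>1 \<D> P FT T PP TT r LL
  for p q :: real and D1 :: "'a measure" and D2 :: "'b measure" and \<nu>1 and \<D>
    and P FT :: "'o measure" and T :: real and PP and TT :: "(real \<Rightarrow> 'f::banach) set" and r
    and LL :: "('a \<times> 'b \<Rightarrow> 'e::banach) \<Rightarrow> ('o \<times> real \<Rightarrow> 'f)" +
  fixes G :: "'g measure" and g :: "'g \<Rightarrow> ('a \<times> 'b \<Rightarrow> 'e)" and s :: "nat \<Rightarrow> 'g \<Rightarrow> ('a \<times> 'b \<Rightarrow> 'e)"
  assumes finite_G: "finite_measure G"
    and g_measurable: "g \<in> measurable G (seminorm_borel Epq)"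
    and simple: "\<And>n. simple_function G (s n)"
    and s_elems: "\<And>n y. y \<in> space G \<Longrightarrow> s n y \<in> elems Epq"
    and s_strongly: "\<And>n y. y \<in> space G \<Longrightarrow> strongly_measurable \<D> (s n y)"
    and rate: "\<And>n. (\<integral>\<^sup>+y. nrm Epq (g y - s n y) \<partial>G) \<le> ennreal ((1 / 2) ^ n)"
begin

definition a :: "nat \<Rightarrow> 'g \<Rightarrow> ennreal" where "a n y = nrm Epq (g y - s n y)"
definition b :: "nat \<Rightarrow> 'g \<Rightarrow> ennreal" where "b n y = nrm Epq (s (Suc n) y - s n y)"
definition t :: "nat \<Rightarrow> 'g \<Rightarrow> ('a \<times> 'b \<Rightarrow> 'e) \<times> ('a \<times> 'b \<Rightarrow> 'e)" where "t n y = (s (Suc n) y, s n y)"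
definition G0 :: "'g set" where "G0 = {y \<in> space G. (\<Sum>n. a n y) < \<infinity>}"

lemma g_elems: "y \<in> space G \<Longrightarrow> g y \<in> elems Epq"
  using measurable_space[OF g_measurable] by simp

lemma simple_t: "simple_function G (t n)"
  unfolding t_def[abs_def] by (rule simple_function_Pair[OF simple simple])

lemma t_elems: "v \<in> t n ` space G \<Longrightarrow> fst v \<in> elems Epq \<and> snd v \<in> elems Epq"
  unfolding t_def using s_elems by auto

lemma t_strongly: "v \<in> t n ` space G \<Longrightarrow> strongly_measurable \<D> (fst v) \<and> strongly_measurable \<D> (snd v)"
  unfolding t_def using s_strongly by auto

lemma simple_t_measurable: "(\<lambda>y. h (t n y)) \<in> borel_measurable G"
  by (rule borel_measurable_simple_function[OF simple_function_compose1[OF simple_t]])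

lemma a_measurable [measurable]: "a n \<in> borel_measurable G"
  unfolding a_def[abs_def]
proof (rule measurable_simple_param[OF simple])
  fix v assume "v \<in> s n ` space G"
  then have "v \<in> elems Epq" using s_elems by blast
  then show "(\<lambda>y. nrm Epq (g y - v)) \<in> borel_measurable G"
    by (rule measurable_compose[OF g_measurable Lpq_normed.nrm_diff_measurable])
qed

lemma b_measurable [measurable]: "b n \<in> borel_measurable G"
  using simple_t_measurable[of "\<lambda>v. nrm Epq (fst v - snd v)" n] unfolding b_def[abs_def] t_def by simp

lemma b_le: "y \<in> space G \<Longrightarrow> b n y \<le> a (Suc n) y + a n y"
  unfolding a_def b_def
  using Lpq_normed.nrm_tri[OF s_elems g_elems s_elems, of y y y "Suc n" n]
    Lpq_normed.nrm_sym[OF s_elems g_elems, of y y "Suc n"] by simp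

lemma integral_b: "(\<integral>\<^sup>+y. b n y \<partial>G) \<le> ennreal (2 * (1 / 2) ^ n)"
proof -
  have "(\<integral>\<^sup>+y. b n y \<partial>G) \<le> (\<integral>\<^sup>+y. a (Suc n) y + a n y \<partial>G)"
    by (rule nn_integral_mono) (rule b_le)
  also have "\<dots> = (\<integral>\<^sup>+y. a (Suc n) y \<partial>G) + (\<integral>\<^sup>+y. a n y \<partial>G)"
    by (rule nn_integral_add) measurable
  also have "\<dots> \<le> ennreal ((1 / 2) ^ n) + ennreal ((1 / 2) ^ n)"
  proof (rule add_mono)
    have "(\<integral>\<^sup>+y. a (Suc n) y \<partial>G) \<le> ennreal ((1 / 2) ^ Suc n)" unfolding a_def by (rule rate)
    also have "\<dots> \<le> ennreal ((1 / 2) ^ n)" by (rule ennreal_leI) simp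
    finally show "(\<integral>\<^sup>+y. a (Suc n) y \<partial>G) \<le> ennreal ((1 / 2) ^ n)" .
    show "(\<integral>\<^sup>+y. a n y \<partial>G) \<le> ennreal ((1 / 2) ^ n)" unfolding a_def by (rule rate)
  qed
  also have "\<dots> = ennreal (2 * (1 / 2) ^ n)" by (simp add: ennreal_plus[symmetric] del: ennreal_plus)
  finally show ?thesis .
qed

text \<open>The constant is the factor 2 of \<open>integral_b\<close>, which covers two neighbouring
  errors, times the geometric sum 2.\<close>

lemma tail_integral_b: "(\<Sum>m. \<integral>\<^sup>+y. b (m + n) y \<partial>G) \<le> ennreal (4 * (1 / 2) ^ n)"
proof -
  have "(\<Sum>m. \<integral>\<^sup>+y. b (m + n) y \<partial>G) \<le> (\<Sum>m. ennreal (2 * (1 / 2) ^ n) * ennreal ((1 / 2) ^ m))"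
  proof (intro suminf_le)
    fix m
    have "(\<integral>\<^sup>+y. b (m + n) y \<partial>G) \<le> ennreal (2 * (1 / 2) ^ (m + n))" by (rule integral_b)
    also have "\<dots> = ennreal (2 * (1 / 2) ^ n) * ennreal ((1 / 2) ^ m)"
      by (simp add: ennreal_mult[symmetric] power_add)
    finally show "(\<integral>\<^sup>+y. b (m + n) y \<partial>G) \<le> ennreal (2 * (1 / 2) ^ n) * ennreal ((1 / 2) ^ m)" .
  qed auto
  also have "\<dots> = ennreal (2 * (1 / 2) ^ n) * 2"
    by (simp only: ennreal_suminf_cmult suminf_half_power)
  also have "\<dots> = ennreal (4 * (1 / 2) ^ n)"
    by (subst ennreal_numeral[symmetric], subst ennreal_mult[symmetric]) auto
  finally show ?thesis .
qed

lemma sum_integral_b: "(\<Sum>m. \<integral>\<^sup>+y. b m y \<partial>G) < \<infinity>"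
  by (rule le_less_trans[OF tail_integral_b[of 0, unfolded add_0_right]]) simp

lemma G0_sets: "G0 \<in> sets G"
  unfolding G0_def by measurable

lemma G0_space: "y \<in> G0 \<Longrightarrow> y \<in> space G"
  by (simp add: G0_def)

lemma AE_G0: "AE y in G. y \<in> G0"
proof -
  have "(\<integral>\<^sup>+y. (\<Sum>n. a n y) \<partial>G) = (\<Sum>n. \<integral>\<^sup>+y. a n y \<partial>G)"
    by (rule nn_integral_suminf) measurable
  also have "\<dots> \<le> (\<Sum>n. ennreal ((1 / 2) ^ n))"
    unfolding a_def by (intro suminf_le rate) auto
  finally have "(\<integral>\<^sup>+y. (\<Sum>n. a n y) \<partial>G) \<noteq> \<infinity>"
    unfolding suminf_half_power by (auto simp: top_unique)
  then have "AE y in G. (\<Sum>n. a n y) \<noteq> \<infinity>" by (intro nn_integral_PInf_AE) auto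
  then show ?thesis using AE_space by eventually_elim (auto simp: G0_def less_top)
qed

lemma sum_a: "y \<in> G0 \<Longrightarrow> (\<Sum>n. a n y) < \<infinity>"
  by (simp add: G0_def)

lemma a_tendsto: "y \<in> G0 \<Longrightarrow> (\<lambda>n. a n y) \<longlonglongrightarrow> 0"
proof (rule tendsto_sandwich[OF _ _ tendsto_const])
  assume y: "y \<in> G0"
  show "(\<lambda>n. \<Sum>m. a (m + n) y) \<longlonglongrightarrow> 0" by (rule ennreal_suminf_tail[OF sum_a[OF y]])
  have "a n y \<le> (\<Sum>m. a (m + n) y)" for n
    using sum_le_suminf[of "\<lambda>m. a (m + n) y" "{0}"] by simp
  then show "\<forall>\<^sub>F n in sequentially. a n y \<le> (\<Sum>m. a (m + n) y)" by simp
qed simp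

lemma sum_b:
  assumes y: "y \<in> G0"
  shows "(\<Sum>n. b n y) < \<infinity>"
proof -
  have "(\<Sum>n. b n y) \<le> (\<Sum>n. a (Suc n) y + a n y)"
    using b_le[OF G0_space[OF y]] by (intro suminf_le) auto
  also have "\<dots> = (\<Sum>n. a (Suc n) y) + (\<Sum>n. a n y)" by (rule suminf_add[symmetric]) auto
  also have "(\<Sum>n. a (Suc n) y) \<le> (\<Sum>n. a n y)"
  proof (rule suminf_le_const)
    fix n
    have "(\<Sum>m<n. a (Suc m) y) = (\<Sum>m\<in>Suc ` {..<n}. a m y)" by (simp add: sum.reindex)
    also have "\<dots> \<le> (\<Sum>n. a n y)" by (rule sum_le_suminf) auto
    finally show "(\<Sum>m<n. a (Suc m) y) \<le> (\<Sum>n. a n y)" .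
  qed simp
  finally show ?thesis using sum_a[OF y] by (auto simp: add_right_mono intro: le_less_trans)
qed

text \<open>Like \<open>pdist\<close> a function of a pair, so that
  \<open>nn_integral_suminf_step\<close> applies along \<open>t\<close>.\<close>

definition Hd :: "('a \<times> 'b \<Rightarrow> 'e) \<times> ('a \<times> 'b \<Rightarrow> 'e) \<Rightarrow> 'a \<times> 'b \<Rightarrow> ennreal" where
  "Hd v x = ennreal (norm (fst v x - snd v x))"

lemma NN_Hd: "NN (Hd (t n y)) = b n y"
  by (simp add: Hd_def[abs_def] t_def b_def nrm_Lpq_eq)

lemma Hd_measurable: "v \<in> t n ` space G \<Longrightarrow> Hd v \<in> borel_measurable MD"
  unfolding Hd_def[abs_def] using t_strongly by (intro norm_measurable_MD strongly_measurable_diff) blast+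

text \<open>Minkowski's inequality moves the mixed norm inside the integral and the series; what
  remains is a tail of integrated increments.\<close>

lemma Hd_integral:
  shows "(\<lambda>x. \<integral>\<^sup>+y. (\<Sum>m. Hd (t (m + n) y) x) \<partial>G) \<in> borel_measurable MD"
    and "NN (\<lambda>x. \<integral>\<^sup>+y. (\<Sum>m. Hd (t (m + n) y) x) \<partial>G) \<le> ennreal (4 * (1 / 2) ^ n)"
proof -
  note step = MD.nn_integral_suminf_step[of G "\<lambda>m. t (m + n)" Hd, OF simple_t Hd_measurable simple_t_measurable]
  show "(\<lambda>x. \<integral>\<^sup>+y. (\<Sum>m. Hd (t (m + n) y) x) \<partial>G) \<in> borel_measurable MD" by (rule step(1))
  show "NN (\<lambda>x. \<integral>\<^sup>+y. (\<Sum>m. Hd (t (m + n) y) x) \<partial>G) \<le> ennreal (4 * (1 / 2) ^ n)"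
    using step(2) tail_integral_b[of n] unfolding NN_Hd by (rule order_trans)
qed

definition Z1 :: "('a \<times> 'b) set" where
  "Z1 = {x \<in> space \<D>. (\<integral>\<^sup>+y. (\<Sum>m. Hd (t m y) x) \<partial>G) < \<infinity>}"

lemma Z1: "Z1 \<in> sets \<D>" "AE x in MD. x \<in> Z1"
proof -
  have m [measurable]: "(\<lambda>x. \<integral>\<^sup>+y. (\<Sum>m. Hd (t m y) x) \<partial>G) \<in> borel_measurable MD"
    using Hd_integral(1)[of 0] by simp
  then have "(\<lambda>x. \<integral>\<^sup>+y. (\<Sum>m. Hd (t m y) x) \<partial>G) \<in> borel_measurable \<D>" by (simp add: measurable_MD)
  then show "Z1 \<in> sets \<D>" unfolding Z1_def by measurable
  have "NN (\<lambda>x. \<integral>\<^sup>+y. (\<Sum>m. Hd (t m y) x) \<partial>G) < \<infinity>"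
    using Hd_integral(2)[of 0] by (auto intro: le_less_trans)
  then have "AE x in MD. (\<integral>\<^sup>+y. (\<Sum>m. Hd (t m y) x) \<partial>G) < \<infinity>" by (rule MD.AE_finite[OF m])
  then show "AE x in MD. x \<in> Z1" using AE_space by eventually_elim (simp add: Z1_def space_MD)
qed

lemma Hd_eq: "Hd (t m y) x = ennreal (norm (s (Suc m) y x - s m y x))"
  by (simp add: Hd_def t_def)

sublocale X1: step_limit G \<D> s "\<lambda>f. f" Z1 G0
proof (intro step_limit.intro)
  fix z assume "z \<in> Z1"
  then show "(\<integral>\<^sup>+y. (\<Sum>m. ennreal (norm (s (Suc m) y z - s m y z))) \<partial>G) < \<infinity>"
    by (simp add: Z1_def Hd_eq)
next
  show "finite_measure G" by (rule finite_G)
qed (rule simple Z1 G0_sets AE_G0 s_strongly, assumption?)+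

lemma X1_variation: "X1.variation x y = (\<Sum>m. Hd (t m y) x)"
  by (simp add: X1.variation_def Hd_eq)

text \<open>For \<open>y\<close> in \<open>G0\<close> the increments have summable norms, so almost
  every \<open>x\<close> passes the tests in \<open>X1.step_lim\<close>; there the tail bounds the
  error, and Minkowski's inequality bounds the norm of the tail.\<close>

lemma NN_step_lim_diff:
  assumes y: "y \<in> G0"
  shows "NN (\<lambda>x. ennreal (norm (X1.step_lim x y - s n y x))) \<le> (\<Sum>m. b (m + n) y)"
proof -
  have H: "Hd (t m y) \<in> borel_measurable MD" for m
    using Hd_measurable[of "t m y" m] G0_space[OF y] by blast
  have "NN (\<lambda>x. \<Sum>m. Hd (t m y) x) \<le> (\<Sum>m. b m y)"
    using MD.suminf[of "\<lambda>m. Hd (t m y)", OF H] by (simp add: NN_Hd)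
  then have "AE x in MD. (\<Sum>m. Hd (t m y) x) < \<infinity>"
    using sum_b[OF y] by (intro MD.AE_finite borel_measurable_suminf_order H) (auto intro: le_less_trans)
  then have "NN (\<lambda>x. ennreal (norm (X1.step_lim x y - s n y x))) \<le> NN (\<lambda>x. \<Sum>m. Hd (t (m + n) y) x)"
    using Z1(2)
  proof (intro MD.mono_AE, eventually_elim)
    fix x assume "(\<Sum>m. Hd (t m y) x) < \<infinity>" "x \<in> Z1"
    then show "ennreal (norm (X1.step_lim x y - s n y x)) \<le> (\<Sum>m. Hd (t (m + n) y) x)"
      unfolding Hd_eq using y by (intro X1.step_lim_tendsto(2)) (simp_all add: X1_variation Hd_eq)
  qed
  also have "\<dots> \<le> (\<Sum>m. NN (Hd (t (m + n) y)))" by (rule MD.suminf[OF H])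
  finally show ?thesis by (simp add: NN_Hd)
qed

lemma X1_elems:
  assumes y: "y \<in> space G"
  shows "(\<lambda>x. X1.step_lim x y) \<in> elems Epq"
proof (cases "y \<in> G0")
  case True
  have "strongly_measurable \<D> (\<lambda>x. X1.step_lim x y)" by (rule X1.strongly_step_lim2[OF y])
  moreover have "NN (\<lambda>x. ennreal (norm (X1.step_lim x y))) < \<infinity>"
  proof -
    have "NN (\<lambda>x. ennreal (norm (X1.step_lim x y))) \<le>
        NN (\<lambda>x. ennreal (norm (X1.step_lim x y - s 0 y x)) + ennreal (norm (s 0 y x)))"
      by (rule MD.mono) (metis add.commute ennreal_leI ennreal_plus norm_ge_zero norm_triangle_sub)
    also have "\<dots> \<le> NN (\<lambda>x. ennreal (norm (X1.step_lim x y - s 0 y x))) + NN (\<lambda>x. ennreal (norm (s 0 y x)))"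
      by (intro MD.add norm_measurable_MD strongly_measurable_diff X1.strongly_step_lim2 s_strongly y)
    also have "\<dots> < \<infinity>"
      using le_less_trans[OF NN_step_lim_diff[OF True, of 0]] sum_b[OF True] elems_Lpq_finite[OF s_elems[OF y]] by simp
    finally show ?thesis .
  qed
  ultimately show ?thesis by (rule strongly_elems_Lpq)
next
  case False
  then have "(\<lambda>x. X1.step_lim x y) = (\<lambda>_. 0)" by (simp add: X1.step_lim_def fun_eq_iff)
  then show ?thesis using zero_elems_Lpq by simp
qed

text \<open>Both functions are limits of \<open>s n y\<close> in the mixed norm.\<close>

lemma X1_eq_g:
  assumes y: "y \<in> G0"
  shows "nrm Epq ((\<lambda>x. X1.step_lim x y) - g y) = 0"
proof -
  let ?X = "\<lambda>x. X1.step_lim x y"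
  have y': "y \<in> space G" by (rule G0_space[OF y])
  have "nrm Epq (?X - g y) \<le> (\<Sum>m. b (m + n) y) + a n y" for n
  proof -
    have "nrm Epq (?X - g y) \<le> nrm Epq (?X - s n y) + nrm Epq (s n y - g y)"
      by (intro Lpq_normed.nrm_tri X1_elems s_elems g_elems y')
    also have "nrm Epq (s n y - g y) = a n y"
      unfolding a_def by (intro Lpq_normed.nrm_sym s_elems g_elems y')
    also have "nrm Epq (?X - s n y) \<le> (\<Sum>m. b (m + n) y)"
      using NN_step_lim_diff[OF y, of n] by (simp add: nrm_Lpq_eq)
    finally show ?thesis by (simp only: add_right_mono)
  qed
  moreover have "(\<lambda>n. (\<Sum>m. b (m + n) y) + a n y) \<longlonglongrightarrow> 0 + 0"
    by (intro tendsto_add ennreal_suminf_tail sum_b a_tendsto y)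
  ultimately have "nrm Epq (?X - g y) \<le> 0 + 0"
    by (intro LIMSEQ_le_const) auto
  then show ?thesis by simp
qed

text \<open>The integrand is dominated by the first step function plus the variation: the former has
  finitely many values and \<open>G\<close> is finite, the latter is covered by
  \<open>Hd_integral\<close> with \<open>n = 0\<close>.\<close>

lemma NN_integral_X1: "NN (\<lambda>x. \<integral>\<^sup>+y. ennreal (norm (X1.step_lim x y)) \<partial>G) < \<infinity>"
proof -
  interpret G: finite_measure G by (rule finite_G)
  let ?h = "\<lambda>v x. ennreal (norm (v x :: 'e))"
  have h: "?h v \<in> borel_measurable MD" if "v \<in> s 0 ` space G" for v
    using that s_strongly by (intro norm_measurable_MD) blast
  have "NN (\<lambda>x. \<integral>\<^sup>+y. ?h (s 0 y) x \<partial>G) \<le> (\<integral>\<^sup>+y. NN (?h (s 0 y)) \<partial>G)"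
    by (rule MD.nn_integral_step(2)[OF simple h])
  also have "\<dots> = (\<Sum>v\<in>s 0 ` space G. NN (?h v) * emeasure G {y \<in> space G. s 0 y = v})"
    by (rule nn_integral_simple_compose[OF simple])
  also have "\<dots> < \<infinity>"
  proof -
    have "NN (?h v) * emeasure G {y \<in> space G. s 0 y = v} < top" if v: "v \<in> s 0 ` space G" for v
    proof -
      have "v \<in> elems Epq" using v s_elems by blast
      then show ?thesis using elems_Lpq_finite[of v] by (simp add: ennreal_mult_less_top G.emeasure_eq_measure)
    qed
    then show ?thesis using simple_functionD(1)[OF simple, of 0] by simp
  qed
  finally have 1: "NN (\<lambda>x. \<integral>\<^sup>+y. ?h (s 0 y) x \<partial>G) < \<infinity>" .
  have 2: "NN (\<lambda>x. \<integral>\<^sup>+y. X1.variation x y \<partial>G) < \<infinity>"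
    unfolding X1_variation using Hd_integral(2)[of 0] by (auto intro: le_less_trans)
  have "NN (\<lambda>x. \<integral>\<^sup>+y. ennreal (norm (X1.step_lim x y)) \<partial>G) \<le>
      NN (\<lambda>x. (\<integral>\<^sup>+y. ?h (s 0 y) x \<partial>G) + (\<integral>\<^sup>+y. X1.variation x y \<partial>G))"
    by (rule MD.mono) (simp add: space_MD X1.integral_norm_le)
  also have "\<dots> \<le> NN (\<lambda>x. \<integral>\<^sup>+y. ?h (s 0 y) x \<partial>G) + NN (\<lambda>x. \<integral>\<^sup>+y. X1.variation x y \<partial>G)"
    by (rule MD.add[OF MD.nn_integral_step(1)[OF simple h]])
      (use Hd_integral(1)[of 0] in \<open>simp_all add: X1_variation\<close>)
  also have "\<dots> < \<infinity>" using 1 2 by simp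
  finally show ?thesis .
qed

lemma X1_mixed_elems: "X1.step_lim \<in> elems (Lpq p q D1 D2 \<nu>1 \<D> (L1 G normed_type))"
proof (rule elems_LpqI)
  show "X1.step_lim \<in> measurable \<D> (seminorm_borel (L1 G normed_type))" by (rule X1.step_lim_measurable)
  show "separable_in (L1 G normed_type) (X1.step_lim ` space \<D>)"
    by (rule X1.dense_in_step_lim) (rule L1_normed.separable_inI)
  show "NN (\<lambda>x. nrm (L1 G normed_type) (X1.step_lim x)) < \<infinity>"
    using NN_integral_X1 by (simp add: nrm_L1)
qed

text \<open>Measurability into \<open>Epq\<close> is inherited from \<open>g\<close>: on
  \<open>G0\<close> the two maps are at distance zero, and elsewhere both are put equal to zero. The
  approximating simple functions are the \<open>s n\<close> themselves.\<close>

lemma X1_L1_elems: "(\<lambda>y x. X1.step_lim x y) \<in> elems (L1 G Epq)"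
proof -
  have "(\<lambda>y. if y \<in> G0 then g y else (\<lambda>_. 0)) \<in> measurable G (seminorm_borel Epq)"
    using G0_sets zero_elems_Lpq by (intro measurable_If_set[OF g_measurable measurable_const]) auto
  then have "(\<lambda>y x. X1.step_lim x y) \<in> measurable G (seminorm_borel Epq)"
  proof (rule measurable_seminorm_borel_saturated)
    fix y assume y: "y \<in> space G"
    let ?X = "\<lambda>x. X1.step_lim x y" and ?g = "if y \<in> G0 then g y else (\<lambda>_. 0)"
    have g': "?g \<in> elems Epq" by (simp add: g_elems[OF y] zero_elems_Lpq)
    have "nrm Epq (?X - ?g) = 0"
    proof (cases "y \<in> G0")
      case False
      then have "?X = (\<lambda>_. 0)" by (simp add: X1.step_lim_def fun_eq_iff)
      then show ?thesis using False Lpq_normed.nrm_self[OF zero_elems_Lpq] by simp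
    qed (simp add: X1_eq_g)
    then show "?X \<in> elems Epq \<and> nrm Epq (?X - ?g) = 0 \<and> nrm Epq (?g - ?X) = 0"
      using Lpq_normed.nrm_sym[OF g' X1_elems[OF y]] X1_elems[OF y] by simp
  qed
  moreover have "(\<lambda>n. \<integral>\<^sup>+y. nrm Epq ((\<lambda>x. X1.step_lim x y) - s n y) \<partial>G) \<longlonglongrightarrow> 0"
  proof (rule tendsto_sandwich[OF _ _ tendsto_const])
    have "(\<lambda>n. (1 / 2 :: real) ^ n) \<longlonglongrightarrow> 0" by (rule LIMSEQ_power_zero) simp
    then show "(\<lambda>n. ennreal ((1 / 2) ^ n)) \<longlonglongrightarrow> 0" using tendsto_ennrealI by fastforce
    have "(\<integral>\<^sup>+y. nrm Epq ((\<lambda>x. X1.step_lim x y) - s n y) \<partial>G) \<le> ennreal ((1 / 2) ^ n)" for n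
    proof -
      have "(\<integral>\<^sup>+y. nrm Epq ((\<lambda>x. X1.step_lim x y) - s n y) \<partial>G) \<le> (\<integral>\<^sup>+y. nrm Epq (g y - s n y) \<partial>G)"
      proof (rule nn_integral_mono_AE, use AE_G0 in eventually_elim)
        fix y assume y: "y \<in> G0"
        show "nrm Epq ((\<lambda>x. X1.step_lim x y) - s n y) \<le> nrm Epq (g y - s n y)"
          using Lpq_normed.nrm_tri[OF X1_elems g_elems s_elems, of y y y n] G0_space[OF y]
          by (simp add: X1_eq_g[OF y])
      qed
      also have "\<dots> \<le> ennreal ((1 / 2) ^ n)" by (rule rate)
      finally show ?thesis .
    qed
    then show "\<forall>\<^sub>F n in sequentially. (\<integral>\<^sup>+y. nrm Epq ((\<lambda>x. X1.step_lim x y) - s n y) \<partial>G) \<le> ennreal ((1 / 2) ^ n)"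
      by simp
  qed simp
  moreover have "(\<lambda>y. (\<lambda>x. X1.step_lim x y) - s n y) = (\<lambda>y. (\<lambda>y x. X1.step_lim x y) y - s n y)" for n by simp
  ultimately show ?thesis
    unfolding L1_def using simple s_elems by (auto intro!: exI[of _ s])
qed

lemma X1_AE_eq:
  assumes y: "y \<in> G0"
  shows "AE x in MD. X1.step_lim x y = g y x"
  using AE_eq_if_nrm_zero[OF X1_elems g_elems, of y y] X1_eq_g[OF y] G0_space[OF y]
  by (simp add: nrm_Lpq_eq)

definition Y :: "'a \<times> 'b \<Rightarrow> 'e" where "Y x = bochner_integral G (X1.step_lim x)"

lemma Y_elems: "Y \<in> elems Epq"
proof (rule strongly_elems_Lpq)
  show "strongly_measurable \<D> Y" unfolding Y_def[abs_def] by (rule X1.strongly_bochner_integral)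
  have "NN (\<lambda>x. ennreal (norm (Y x))) \<le> NN (\<lambda>x. \<integral>\<^sup>+y. ennreal (norm (X1.step_lim x y)) \<partial>G)"
    unfolding Y_def by (rule MD.mono) (simp add: space_MD norm_bochner_integral_le[OF finite_G] X1.step_lim_L1)
  then show "NN (\<lambda>x. ennreal (norm (Y x))) < \<infinity>" using NN_integral_X1 by (rule le_less_trans)
qed

lemma NN_Y_diff: "NN (\<lambda>x. ennreal (norm (Y x - X1.step_sum n x))) \<le> ennreal (4 * (1 / 2) ^ n)"
proof -
  have "NN (\<lambda>x. ennreal (norm (Y x - X1.step_sum n x))) \<le> NN (\<lambda>x. \<integral>\<^sup>+y. (\<Sum>m. Hd (t (m + n) y) x) \<partial>G)"
  proof (rule MD.mono_AE, use Z1(2) in eventually_elim)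
    fix x assume x: "x \<in> Z1"
    have "ennreal (norm (Y x - X1.step_sum n x)) \<le> (\<integral>\<^sup>+y. ennreal (norm (X1.step_lim x y - s n y x)) \<partial>G)"
      unfolding Y_def by (rule X1.bochner_integral_diff_step_sum[OF X1.Z0_space[OF x]])
    also have "\<dots> \<le> (\<Sum>m. \<integral>\<^sup>+y. ennreal (norm (s (Suc (m + n)) y x - s (m + n) y x)) \<partial>G)"
      by (rule X1.integral_diff_le[OF x])
    also have "\<dots> = (\<integral>\<^sup>+y. (\<Sum>m. Hd (t (m + n) y) x) \<partial>G)"
      unfolding Hd_eq by (rule nn_integral_suminf[symmetric]) (rule X1.diff_measurable)
    finally show "ennreal (norm (Y x - X1.step_sum n x)) \<le> (\<integral>\<^sup>+y. (\<Sum>m. Hd (t (m + n) y) x) \<partial>G)" .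
  qed
  also have "\<dots> \<le> ennreal (4 * (1 / 2) ^ n)" by (rule Hd_integral(2))
  finally show ?thesis .
qed

end

section \<open>The limit process and the interchange of operator and integral\<close>

context fubini_approx
begin

text \<open>By the operator bound, summable errors become summable norms of path distances, and
  Minkowski's inequality makes the sum of the distances finite almost surely. Hence the full
  sequence converges, at all times outside one null set.\<close>

lemma LR_AE_tendsto:
  assumes f: "f \<in> elems Epq" and f': "\<And>n. f' n \<in> elems Epq"
    and fin: "(\<Sum>n. nrm Epq (f - f' n)) < \<infinity>"
  shows "AE \<omega> in P. \<forall>\<tau>\<in>{0..T}. (\<lambda>n. LR (f' n) (\<omega>, \<tau>)) \<longlonglongrightarrow> LR f (\<omega>, \<tau>)"
proof -
  have m: "pdist (f, f' n) \<in> borel_measurable P" for n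
    using pdist_measurable[of "(f, f' n)"] f f' by (intro measurable_FT) simp
  have "Lnorm P r (\<lambda>\<omega>. \<Sum>n. pdist (f, f' n) \<omega>) \<le> (\<Sum>n. Lnorm P r (pdist (f, f' n)))"
    by (rule LP.suminf[OF m])
  also have "\<dots> \<le> (\<Sum>n. ennreal op_bound * nrm Epq (f - f' n))"
    using pdist_bounded[OF f f'] by (intro suminf_le) simp_all
  also have "\<dots> = ennreal op_bound * (\<Sum>n. nrm Epq (f - f' n))" by (rule ennreal_suminf_cmult)
  also have "\<dots> < \<infinity>" using fin by (simp add: ennreal_mult_less_top)
  finally have "AE \<omega> in P. (\<Sum>n. pdist (f, f' n) \<omega>) < \<infinity>"
    by (intro LP.AE_finite borel_measurable_suminf_order m)
  then show ?thesis
  proof (eventually_elim, intro ballI)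
    fix \<omega> \<tau> assume w: "(\<Sum>n. pdist (f, f' n) \<omega>) < \<infinity>" and \<tau>: "\<tau> \<in> {0..T}"
    have le: "ennreal (norm (LR f (\<omega>, \<tau>) - LR (f' n) (\<omega>, \<tau>))) \<le> pdist (f, f' n) \<omega>" for n
      by (rule norm_le_pdist[OF \<tau>])
    have "(\<Sum>n. ennreal (norm (LR f (\<omega>, \<tau>) - LR (f' n) (\<omega>, \<tau>)))) \<le> (\<Sum>n. pdist (f, f' n) \<omega>)"
      by (rule suminf_le[OF le]) simp_all
    also note w
    finally have "summable (\<lambda>n. norm (LR f (\<omega>, \<tau>) - LR (f' n) (\<omega>, \<tau>)))"
      by (intro summable_suminf_not_top) auto
    then have "(\<lambda>n. LR f (\<omega>, \<tau>) - LR (f' n) (\<omega>, \<tau>)) \<longlonglongrightarrow> 0"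
      by (rule tendsto_norm_zero_cancel[OF summable_LIMSEQ_zero])
    then have "(\<lambda>n. LR f (\<omega>, \<tau>) - (LR f (\<omega>, \<tau>) - LR (f' n) (\<omega>, \<tau>))) \<longlonglongrightarrow> LR f (\<omega>, \<tau>) - 0"
      by (intro tendsto_diff tendsto_const)
    then show "(\<lambda>n. LR (f' n) (\<omega>, \<tau>)) \<longlonglongrightarrow> LR f (\<omega>, \<tau>)" by simp
  qed
qed

text \<open>Total variation of the step processes in the supremum norm. It dominates
  \<open>X2.variation\<close> at all times simultaneously.\<close>

definition S :: "'o \<Rightarrow> 'g \<Rightarrow> ennreal" where "S \<omega> y = (\<Sum>m. pdist (t m y) \<omega>)"

lemma pdist_t_measurable: "v \<in> t m ` space G \<Longrightarrow> pdist v \<in> borel_measurable FT"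
  using t_elems by (intro pdist_measurable) blast+

lemma S_pair_measurable: "(\<lambda>p. S (fst p) (snd p)) \<in> borel_measurable (FT \<Otimes>\<^sub>M G)"
  unfolding S_def
proof (rule borel_measurable_suminf_order)
  fix m
  show "(\<lambda>p. pdist (t m (snd p)) (fst p)) \<in> borel_measurable (FT \<Otimes>\<^sub>M G)"
  proof (rule measurable_simple_param[OF simple_function_comp_measurable[OF simple_t measurable_snd]])
    fix v assume "v \<in> (\<lambda>p. t m (snd p)) ` space (FT \<Otimes>\<^sub>M G)"
    then have "v \<in> t m ` space G" by (auto simp: space_pair_measure)
    then have "pdist v \<in> borel_measurable FT" by (rule pdist_t_measurable)
    then show "(\<lambda>p. pdist v (fst p)) \<in> borel_measurable (FT \<Otimes>\<^sub>M G)"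
      by (rule measurable_compose[OF measurable_fst])
  qed
qed

lemma S_measurable: "\<omega> \<in> space P \<Longrightarrow> S \<omega> \<in> borel_measurable G"
  using measurable_compose[OF measurable_Pair1' S_pair_measurable, of \<omega>] by (simp add: space_FT)

definition \<Omega>0 :: "'o set" where "\<Omega>0 = {\<omega> \<in> space P. (\<integral>\<^sup>+y. S \<omega> y \<partial>G) < \<infinity>}"

text \<open>The operator bound replaces path distances by the increments \<open>b\<close>, whose
  integrals are summable; a finite norm then means finiteness almost surely.\<close>

lemma AE_\<Omega>0: "AE \<omega> in P. \<omega> \<in> \<Omega>0"
proof -
  note step = LP.nn_integral_suminf_step[of G t pdist, OF simple_t measurable_FT[OF pdist_t_measurable] simple_t_measurable]
  have "Lnorm P r (\<lambda>\<omega>. \<integral>\<^sup>+y. S \<omega> y \<partial>G) \<le> (\<Sum>m. \<integral>\<^sup>+y. Lnorm P r (pdist (t m y)) \<partial>G)"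
    unfolding S_def by (rule step(2))
  also have "\<dots> \<le> (\<Sum>m. \<integral>\<^sup>+y. ennreal op_bound * b m y \<partial>G)"
  proof (intro suminf_le nn_integral_mono)
    fix m y assume "y \<in> space G"
    then show "Lnorm P r (pdist (t m y)) \<le> ennreal op_bound * b m y"
      using pdist_bounded[OF s_elems s_elems, of y y "Suc m" m] by (simp add: t_def b_def)
  qed simp_all
  also have "\<dots> = ennreal op_bound * (\<Sum>m. \<integral>\<^sup>+y. b m y \<partial>G)"
    by (simp only: nn_integral_cmult[OF b_measurable] ennreal_suminf_cmult)
  also have "\<dots> < \<infinity>" using sum_integral_b by (simp add: ennreal_mult_less_top)
  finally have "AE \<omega> in P. (\<integral>\<^sup>+y. S \<omega> y \<partial>G) < \<infinity>"
    using step(1) by (intro LP.AE_finite) (simp_all add: S_def)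
  then show ?thesis using AE_space by eventually_elim (simp add: \<Omega>0_def)
qed

lemma S_finite:
  assumes y: "y \<in> G0"
  shows "(\<lambda>\<omega>. S \<omega> y) \<in> borel_measurable P" "Lnorm P r (\<lambda>\<omega>. S \<omega> y) < \<infinity>" "AE \<omega> in P. S \<omega> y < \<infinity>"
proof -
  have m: "pdist (t m y) \<in> borel_measurable P" for m
    using G0_space[OF y] by (intro measurable_FT pdist_t_measurable[of _ m]) blast
  then show Sm: "(\<lambda>\<omega>. S \<omega> y) \<in> borel_measurable P" unfolding S_def by (rule borel_measurable_suminf_order)
  have "Lnorm P r (\<lambda>\<omega>. S \<omega> y) \<le> (\<Sum>m. Lnorm P r (pdist (t m y)))"
    unfolding S_def by (rule LP.suminf[OF m])
  also have "\<dots> \<le> (\<Sum>m. ennreal op_bound * b m y)"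
    using pdist_bounded[OF s_elems s_elems, OF G0_space[OF y] G0_space[OF y]]
    by (intro suminf_le) (simp_all add: t_def b_def)
  also have "\<dots> = ennreal op_bound * (\<Sum>m. b m y)" by (rule ennreal_suminf_cmult)
  also have "\<dots> < \<infinity>" using sum_b[OF y] by (simp add: ennreal_mult_less_top)
  finally show fin: "Lnorm P r (\<lambda>\<omega>. S \<omega> y) < \<infinity>" .
  show "AE \<omega> in P. S \<omega> y < \<infinity>" by (rule LP.AE_finite[OF Sm fin])
qed

text \<open>A cylinder over an almost sure event: it belongs to \<open>PP\<close> by the assumption
  on null cylinders, and membership does not depend on time, so the formula for the integral holds
  at all times outside one null set.\<close>

definition Z2 :: "('o \<times> real) set" where "Z2 = \<Omega>0 \<times> {0..T}"

lemma Z2_sets: "Z2 \<in> sets PP"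
proof -
  have "{\<omega> \<in> space P. \<omega> \<in> \<Omega>0} = \<Omega>0" by (auto simp: \<Omega>0_def)
  then show ?thesis using AE_imp_sets_FT(3)[OF AE_\<Omega>0] by (simp add: Z2_def)
qed

lemma diff_le_pdist:
  assumes "\<tau> \<in> {0..T}"
  shows "ennreal (norm (LR (s (Suc m) y) (\<omega>, \<tau>) - LR (s m y) (\<omega>, \<tau>))) \<le> pdist (t m y) \<omega>"
  unfolding t_def by (rule norm_le_pdist[OF assms])

sublocale X2: step_limit G PP s LR Z2 G0
proof (intro step_limit.intro)
  fix z assume "z \<in> Z2"
  then obtain \<omega> \<tau> where z: "z = (\<omega>, \<tau>)" "\<omega> \<in> \<Omega>0" "\<tau> \<in> {0..T}" by (auto simp: Z2_def)
  have "(\<integral>\<^sup>+y. (\<Sum>m. ennreal (norm (LR (s (Suc m) y) z - LR (s m y) z))) \<partial>G) \<le> (\<integral>\<^sup>+y. S \<omega> y \<partial>G)"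
    unfolding S_def z(1) by (intro nn_integral_mono suminf_le diff_le_pdist z(3)) simp_all
  also have "\<dots> < \<infinity>" using z(2) by (simp add: \<Omega>0_def)
  finally show "(\<integral>\<^sup>+y. (\<Sum>m. ennreal (norm (LR (s (Suc m) y) z - LR (s m y) z))) \<partial>G) < \<infinity>" .
next
  show "finite_measure G" by (rule finite_G)
  fix n y assume "y \<in> space G"
  then show "strongly_measurable PP (LR (s n y))" using LR(1)[OF s_elems] by (simp add: regular_def)
qed (rule simple Z2_sets G0_sets AE_G0)+

lemma X2_variation_le: "\<tau> \<in> {0..T} \<Longrightarrow> X2.variation (\<omega>, \<tau>) y \<le> S \<omega> y"
  unfolding X2.variation_def S_def by (intro suminf_le diff_le_pdist) simp_all

text \<open>
  Where the sum of the supremum distances diverges, the pointwise limit of the processes may still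
  exist, but its paths need not lie in a separable subset of the path space; there the process is
  put equal to zero. As an element of \<open>L\<^sup>1\<close> in the last variable it does not change.
\<close>

definition W :: "'o \<times> real \<Rightarrow> 'g \<Rightarrow> 'f" where
  "W z y = (if S (fst z) y < \<infinity> then X2.step_lim z y else 0)"

lemma W_AE_eq:
  assumes z: "z \<in> space PP"
  shows "AE y in G. X2.step_lim z y = W z y"
proof (cases "z \<in> Z2")
  case True
  then have w: "fst z \<in> space P" "(\<integral>\<^sup>+y. S (fst z) y \<partial>G) < \<infinity>" by (auto simp: Z2_def \<Omega>0_def)
  have "AE y in G. S (fst z) y \<noteq> \<infinity>"
    using w(2) by (intro nn_integral_PInf_AE S_measurable w(1)) simp
  then show ?thesis by eventually_elim (simp add: W_def less_top)
qed (simp add: W_def X2.step_lim_outside)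

text \<open>The test on \<open>S\<close> is measurable in \<open>(\<omega>, y)\<close> for
  \<open>FT\<close> and \<open>G\<close>, and the resulting sets need not be measurable for
  \<open>PP\<close> and \<open>G\<close>. Joint measurability is therefore stated for the larger
  sigma-algebra; measurability for \<open>PP\<close> is available for fixed \<open>y\<close> and for
  the map into \<open>L1\<close>.\<close>

lemma strongly_W: "strongly_measurable ((FT \<Otimes>\<^sub>M restrict_space borel {0..T}) \<Otimes>\<^sub>M G) (\<lambda>p. W (fst p) (snd p))"
proof -
  let ?N = "FT \<Otimes>\<^sub>M (restrict_space borel {0..T} :: real measure)"
  have id: "(\<lambda>z. z) \<in> measurable ?N PP"
    using PP by (intro measurableI) (auto simp: subalgebra_def)
  have "(\<lambda>p. (fst p, snd p)) \<in> measurable (?N \<Otimes>\<^sub>M G) (PP \<Otimes>\<^sub>M G)"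
    by (intro measurable_Pair measurable_compose[OF measurable_fst id] measurable_snd)
  from strongly_measurable_compose[OF X2.strongly_step_lim this]
  have 1: "strongly_measurable (?N \<Otimes>\<^sub>M G) (\<lambda>p. X2.step_lim (fst p) (snd p))" by simp
  have "(\<lambda>p. (fst (fst p), snd p)) \<in> measurable (?N \<Otimes>\<^sub>M G) (FT \<Otimes>\<^sub>M G)"
    by (intro measurable_Pair measurable_compose[OF measurable_fst measurable_fst] measurable_snd)
  from measurable_compose[OF this S_pair_measurable]
  have [measurable]: "(\<lambda>p. S (fst (fst p)) (snd p)) \<in> borel_measurable (?N \<Otimes>\<^sub>M G)" by simp
  have "Measurable.pred (?N \<Otimes>\<^sub>M G) (\<lambda>p. S (fst (fst p)) (snd p) < \<infinity>)" by measurable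
  from strongly_measurable_If[OF 1 strongly_measurable_const this, of 0]
  show ?thesis unfolding W_def .
qed

lemma W_L1:
  assumes z: "z \<in> space P \<times> {0..T}"
  shows "W z \<in> elems (L1 G normed_type)"
proof (rule elems_L1_normed_type_cong_AE)
  have z': "z \<in> space PP" using z by (simp add: space_PP)
  show "X2.step_lim z \<in> elems (L1 G normed_type)" by (rule X2.step_lim_L1[OF z'])
  show "AE y in G. X2.step_lim z y = W z y" by (rule W_AE_eq[OF z'])
  have "z \<in> space (FT \<Otimes>\<^sub>M restrict_space borel {0..T})"
    using z by (simp add: space_pair_measure space_FT space_restrict_space)
  from strongly_measurable_compose[OF strongly_W measurable_Pair1'[OF this]]
  show "W z \<in> borel_measurable G" using strongly_measurableD by force
qed

lemma W_measurable_L1: "W \<in> measurable PP (seminorm_borel (L1 G normed_type))"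
proof (rule measurable_seminorm_borel_saturated[OF X2.step_lim_measurable])
  fix z assume z: "z \<in> space PP"
  have W: "W z \<in> elems (L1 G normed_type)" using z by (intro W_L1) (simp add: space_PP)
  have "nrm (L1 G normed_type) (W z - X2.step_lim z) = (\<integral>\<^sup>+y. 0 \<partial>G)"
    unfolding nrm_L1 by (rule nn_integral_cong_AE) (use W_AE_eq[OF z] in \<open>eventually_elim, simp\<close>)
  then show "W z \<in> elems (L1 G normed_type) \<and> nrm (L1 G normed_type) (W z - X2.step_lim z) = 0 \<and>
      nrm (L1 G normed_type) (X2.step_lim z - W z) = 0"
    using W L1_normed.nrm_sym[OF W X2.step_lim_L1[OF z]] by simp
qed

lemma W_outside:
  assumes "\<not> (fst z \<in> \<Omega>0 \<and> y \<in> G0 \<and> S (fst z) y < \<infinity>)"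
  shows "W z y = 0"
proof -
  have "z \<in> Z2 \<Longrightarrow> fst z \<in> \<Omega>0" by (auto simp: Z2_def)
  then show ?thesis using assms unfolding W_def X2.step_lim_def by auto
qed

lemma W_tendsto:
  assumes "\<omega> \<in> \<Omega>0" "y \<in> G0" "S \<omega> y < \<infinity>" "\<tau> \<in> {0..T}"
  shows "(\<lambda>n. LR (s n y) (\<omega>, \<tau>)) \<longlonglongrightarrow> W (\<omega>, \<tau>) y"
    and "ennreal (norm (W (\<omega>, \<tau>) y - LR (s n y) (\<omega>, \<tau>))) \<le> (\<Sum>m. pdist (t (m + n) y) \<omega>)"
proof -
  have W: "W (\<omega>, \<tau>) y = X2.step_lim (\<omega>, \<tau>) y" using assms(3) by (simp add: W_def)
  have c: "(\<omega>, \<tau>) \<in> Z2" "X2.variation (\<omega>, \<tau>) y < \<infinity>"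
    using assms le_less_trans[OF X2_variation_le[OF assms(4)] assms(3)] by (simp_all add: Z2_def)
  show "(\<lambda>n. LR (s n y) (\<omega>, \<tau>)) \<longlonglongrightarrow> W (\<omega>, \<tau>) y"
    unfolding W by (rule X2.step_lim_tendsto(1)[OF c(1) assms(2) c(2)])
  have "ennreal (norm (W (\<omega>, \<tau>) y - LR (s n y) (\<omega>, \<tau>))) \<le>
      (\<Sum>m. ennreal (norm (LR (s (Suc (m + n)) y) (\<omega>, \<tau>) - LR (s (m + n) y) (\<omega>, \<tau>))))"
    unfolding W by (rule X2.step_lim_tendsto(2)[OF c(1) assms(2) c(2)])
  also have "\<dots> \<le> (\<Sum>m. pdist (t (m + n) y) \<omega>)" by (intro suminf_le diff_le_pdist assms(4)) simp_all
  finally show "ennreal (norm (W (\<omega>, \<tau>) y - LR (s n y) (\<omega>, \<tau>))) \<le> (\<Sum>m. pdist (t (m + n) y) \<omega>)" .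
qed

text \<open>The tail of \<open>S\<close> bounds the supremum distance between a path of
  \<open>W\<close> and its approximations, so the paths are uniform limits and stay in
  \<open>TT\<close>.\<close>

lemma W_regular:
  assumes y: "y \<in> space G"
  shows "regular (\<lambda>z. W z y)"
proof (cases "y \<in> G0")
  case False
  then have "(\<lambda>z. W z y) = (\<lambda>_. 0)" by (auto simp: W_outside fun_eq_iff)
  then show ?thesis using regular_zero by simp
next
  case True
  let ?Q = "\<lambda>\<omega>. \<omega> \<in> \<Omega>0 \<and> S \<omega> y < \<infinity>"
  have Q: "AE \<omega> in P. ?Q \<omega>" using AE_\<Omega>0 S_finite(3)[OF True] by eventually_elim simp
  \<comment> \<open>Outside the almost sure event \<open>?Q\<close> the approximations are switched
    off like \<open>W\<close>, so that the paths converge for every outcome, as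
    \<open>regular_LIMSEQ\<close> demands.\<close>
  let ?X = "\<lambda>n z. if ?Q (fst z) then LR (s n y) z else 0"
  show ?thesis
  proof (rule regular_LIMSEQ)
    show "regular (?X n)" for n by (rule regular_If[OF LR(1)[OF s_elems[OF y]] Q])
    show "strongly_measurable PP (\<lambda>z. W z y)"
    proof -
      \<comment> \<open>For this fixed \<open>y\<close> in \<open>G0\<close> the test holds almost
        surely, so the set is a cylinder over an almost sure event and belongs to
        \<open>PP\<close>.\<close>
      have "{z \<in> space PP. S (fst z) y < \<infinity>} = {\<omega> \<in> space P. S \<omega> y < \<infinity>} \<times> {0..T}"
        by (auto simp: space_PP)
      then have "Measurable.pred PP (\<lambda>z. S (fst z) y < \<infinity>)"
        using AE_imp_sets_FT(3)[OF S_finite(3)[OF True]] by (simp add: pred_def)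
      from strongly_measurable_If[OF X2.strongly_step_lim2[OF y] strongly_measurable_const this, of 0]
      show ?thesis unfolding W_def .
    qed
    fix \<omega> assume w: "\<omega> \<in> space P"
    show "(\<lambda>n. path_nrm (path T (?X n) \<omega> - path T (\<lambda>z. W z y) \<omega>)) \<longlonglongrightarrow> 0"
    proof (cases "?Q \<omega>")
      case False
      have "path T (?X n) \<omega> - path T (\<lambda>z. W z y) \<omega> = (\<lambda>\<tau>. 0)" for n
        using False by (auto simp: path_def W_outside fun_eq_iff)
      then show ?thesis by (simp add: nrm_path_space)
    next
      case good: True
      show ?thesis
      proof (rule tendsto_sandwich[OF _ _ tendsto_const])
        show "(\<lambda>n. \<Sum>m. pdist (t (m + n) y) \<omega>) \<longlonglongrightarrow> 0"
          using good by (intro ennreal_suminf_tail) (simp add: S_def)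
        have "path_nrm (path T (?X n) \<omega> - path T (\<lambda>z. W z y) \<omega>) \<le> (\<Sum>m. pdist (t (m + n) y) \<omega>)" for n
          unfolding nrm_path_space
        proof (rule SUP_least)
          fix \<tau> assume \<tau>: "\<tau> \<in> {0..T}"
          have "ennreal (norm ((path T (?X n) \<omega> - path T (\<lambda>z. W z y) \<omega>) \<tau>)) =
              ennreal (norm (W (\<omega>, \<tau>) y - LR (s n y) (\<omega>, \<tau>)))"
            using good \<tau> by (simp add: path_def norm_minus_commute)
          also have "\<dots> \<le> (\<Sum>m. pdist (t (m + n) y) \<omega>)"
            using good by (intro W_tendsto(2) True \<tau>) simp_all
          finally show "ennreal (norm ((path T (?X n) \<omega> - path T (\<lambda>z. W z y) \<omega>) \<tau>)) \<le> (\<Sum>m. pdist (t (m + n) y) \<omega>)" .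
        qed
        then show "\<forall>\<^sub>F n in sequentially. path_nrm (path T (?X n) \<omega> - path T (\<lambda>z. W z y) \<omega>) \<le> (\<Sum>m. pdist (t (m + n) y) \<omega>)"
          by (intro always_eventually allI)
      qed simp
    qed
  qed
qed

text \<open>Each path of \<open>W\<close> is bounded by that of the first step process plus
  \<open>S\<close>, and for \<open>y\<close> in \<open>G0\<close> both have finite norm.\<close>

lemma W_elems:
  assumes y: "y \<in> space G"
  shows "(\<lambda>z. W z y) \<in> elems Lr"
proof (rule regular_elems[OF W_regular[OF y]])
  show "Lnorm P r (\<lambda>\<omega>. path_nrm (path T (\<lambda>z. W z y) \<omega>)) < \<infinity>"
  proof (cases "y \<in> G0")
    case False
    then have "(\<lambda>z. W z y) = (\<lambda>_. 0)" by (auto simp: W_outside fun_eq_iff)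
    then show ?thesis by (simp add: path_zero nrm_path_space)
  next
    case True
    let ?h = "\<lambda>\<omega>. path_nrm (path T (LR (s 0 y)) \<omega>)"
    have h: "?h \<in> borel_measurable P"
      by (rule measurable_FT[OF regular_nrm_measurable[OF LR(1)[OF s_elems[OF y]]]])
    have "Lnorm P r ?h = nrm Lr (LL (s 0 y))"
      unfolding nrm_Lr by (rule LP.cong_AE) (use LR(2)[OF s_elems[OF y], of 0] in \<open>eventually_elim, simp\<close>)
    also have "\<dots> < \<infinity>" using LL_elems[OF s_elems[OF y], of 0] by (simp add: Lr_process_def Let_def)
    finally have hfin: "Lnorm P r ?h < \<infinity>" .
    have "Lnorm P r (\<lambda>\<omega>. path_nrm (path T (\<lambda>z. W z y) \<omega>)) \<le> Lnorm P r (\<lambda>\<omega>. ?h \<omega> + S \<omega> y)"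
    proof (rule LP.mono)
      fix \<omega>
      show "path_nrm (path T (\<lambda>z. W z y) \<omega>) \<le> ?h \<omega> + S \<omega> y"
        unfolding nrm_path_space[of T TT "path T (\<lambda>z. W z y) \<omega>"]
      proof (rule SUP_least)
        fix \<tau> assume \<tau>: "\<tau> \<in> {0..T}"
        show "ennreal (norm (path T (\<lambda>z. W z y) \<omega> \<tau>)) \<le> ?h \<omega> + S \<omega> y"
        proof (cases "\<omega> \<in> \<Omega>0 \<and> S \<omega> y < \<infinity>")
          case good: True
          have "norm (W (\<omega>, \<tau>) y) \<le> norm (LR (s 0 y) (\<omega>, \<tau>)) + norm (W (\<omega>, \<tau>) y - LR (s 0 y) (\<omega>, \<tau>))"
            by (rule norm_triangle_sub)
          then have "ennreal (norm (W (\<omega>, \<tau>) y)) \<le>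
              ennreal (norm (LR (s 0 y) (\<omega>, \<tau>))) + ennreal (norm (W (\<omega>, \<tau>) y - LR (s 0 y) (\<omega>, \<tau>)))"
            by (simp add: ennreal_plus[symmetric] ennreal_leI del: ennreal_plus)
          also have "\<dots> \<le> ?h \<omega> + S \<omega> y"
          proof (rule add_mono)
            show "ennreal (norm (LR (s 0 y) (\<omega>, \<tau>))) \<le> ?h \<omega>"
              using norm_le_nrm_path_space[OF \<tau>, of "path T (LR (s 0 y)) \<omega>" TT] \<tau> by (simp add: path_def)
            show "ennreal (norm (W (\<omega>, \<tau>) y - LR (s 0 y) (\<omega>, \<tau>))) \<le> S \<omega> y"
              using W_tendsto(2)[of \<omega> y \<tau> 0] good True \<tau> by (simp add: S_def)
          qed
          finally show ?thesis using \<tau> by (simp add: path_def)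
        next
          case False
          then have "path T (\<lambda>z. W z y) \<omega> \<tau> = 0" by (auto simp: path_def W_outside)
          then show ?thesis by simp
        qed
      qed
    qed
    also have "\<dots> \<le> Lnorm P r ?h + Lnorm P r (\<lambda>\<omega>. S \<omega> y)"
      by (rule LP.add[OF h S_finite(1)[OF True]])
    also have "\<dots> < \<infinity>" using hfin S_finite(2)[OF True] by simp
    finally show ?thesis .
  qed
qed

text \<open>Both sides are limits of \<open>LR (s n y)\<close>: one by the construction of
  \<open>W\<close>, the other because the errors \<open>a n y\<close> are summable on
  \<open>G0\<close>.\<close>

lemma W_eq_LL:
  assumes y: "y \<in> G0"
  shows "AE \<omega> in P. \<forall>\<tau>\<in>{0..T}. W (\<omega>, \<tau>) y = LL (g y) (\<omega>, \<tau>)"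
proof -
  have g: "g y \<in> elems Epq" by (rule g_elems[OF G0_space[OF y]])
  have "AE \<omega> in P. \<forall>\<tau>\<in>{0..T}. (\<lambda>n. LR (s n y) (\<omega>, \<tau>)) \<longlonglongrightarrow> LR (g y) (\<omega>, \<tau>)"
    using sum_a[OF y] unfolding a_def by (intro LR_AE_tendsto g s_elems G0_space[OF y])
  then show ?thesis
    using AE_\<Omega>0 S_finite(3)[OF y] LR_AE_eq[OF g]
  proof eventually_elim
    fix \<omega> assume w: "\<forall>\<tau>\<in>{0..T}. (\<lambda>n. LR (s n y) (\<omega>, \<tau>)) \<longlonglongrightarrow> LR (g y) (\<omega>, \<tau>)" "\<omega> \<in> \<Omega>0" "S \<omega> y < \<infinity>"
      "\<forall>\<tau>\<in>{0..T}. LR (g y) (\<omega>, \<tau>) = LL (g y) (\<omega>, \<tau>)"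
    show "\<forall>\<tau>\<in>{0..T}. W (\<omega>, \<tau>) y = LL (g y) (\<omega>, \<tau>)"
    proof
      fix \<tau> assume \<tau>: "\<tau> \<in> {0..T}"
      have "W (\<omega>, \<tau>) y = LR (g y) (\<omega>, \<tau>)"
        using LIMSEQ_unique[OF W_tendsto(1)[OF w(2) y w(3) \<tau>]] w(1) \<tau> by blast
      then show "W (\<omega>, \<tau>) y = LL (g y) (\<omega>, \<tau>)" using w(4) \<tau> by simp
    qed
  qed
qed

lemma LL_Y: "AE \<omega> in P. \<forall>\<tau>\<in>{0..T}. LL Y (\<omega>, \<tau>) = bochner_integral G (W (\<omega>, \<tau>))"
proof -
  \<comment> \<open>\<open>X1.step_sum n\<close> and \<open>X2.step_sum n\<close> run over the same
    values of \<open>s n\<close> with the same weights, so linearity sends one to the other up to a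
    null set.\<close>
  have sum: "X1.step_sum n \<in> elems Epq"
      "AE \<omega> in P. \<forall>\<tau>\<in>{0..T}. LR (X1.step_sum n) (\<omega>, \<tau>) = X2.step_sum n (\<omega>, \<tau>)" for n
    using LR_sum[OF simple_functionD(1)[OF simple, of n], of "\<lambda>v. v" "\<lambda>v. measure G {y \<in> space G. s n y = v}"]
      s_elems s_strongly unfolding X1.step_sum_def[abs_def] X2.step_sum_def by blast+
  \<comment> \<open>The geometric bound of \<open>NN_Y_diff\<close> is summable, as
    \<open>LR_AE_tendsto\<close> requires.\<close>
  have "(\<Sum>n. nrm Epq (Y - X1.step_sum n)) \<le> (\<Sum>n. ennreal 4 * ennreal ((1 / 2) ^ n))"
    using NN_Y_diff by (intro suminf_le) (simp_all add: nrm_Lpq_eq ennreal_mult[symmetric] del: ennreal_numeral)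
  also have "\<dots> = ennreal 4 * 2" by (simp only: ennreal_suminf_cmult suminf_half_power)
  also have "\<dots> < \<infinity>" by (simp add: ennreal_mult_less_top)
  finally have "AE \<omega> in P. \<forall>\<tau>\<in>{0..T}. (\<lambda>n. LR (X1.step_sum n) (\<omega>, \<tau>)) \<longlonglongrightarrow> LR Y (\<omega>, \<tau>)"
    by (intro LR_AE_tendsto Y_elems sum(1))
  moreover have "AE \<omega> in P. \<forall>n. \<forall>\<tau>\<in>{0..T}. LR (X1.step_sum n) (\<omega>, \<tau>) = X2.step_sum n (\<omega>, \<tau>)"
    using sum(2) by (simp add: AE_all_countable)
  ultimately show ?thesis
    using AE_\<Omega>0 LR_AE_eq[OF Y_elems]
  proof eventually_elim
    fix \<omega> assume w: "\<forall>\<tau>\<in>{0..T}. (\<lambda>n. LR (X1.step_sum n) (\<omega>, \<tau>)) \<longlonglongrightarrow> LR Y (\<omega>, \<tau>)"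
      "\<forall>n. \<forall>\<tau>\<in>{0..T}. LR (X1.step_sum n) (\<omega>, \<tau>) = X2.step_sum n (\<omega>, \<tau>)" "\<omega> \<in> \<Omega>0"
      "\<forall>\<tau>\<in>{0..T}. LR Y (\<omega>, \<tau>) = LL Y (\<omega>, \<tau>)"
    show "\<forall>\<tau>\<in>{0..T}. LL Y (\<omega>, \<tau>) = bochner_integral G (W (\<omega>, \<tau>))"
    proof
      fix \<tau> assume \<tau>: "\<tau> \<in> {0..T}"
      have z: "(\<omega>, \<tau>) \<in> Z2" using w(3) \<tau> by (simp add: Z2_def)
      have "(\<lambda>n. X2.step_sum n (\<omega>, \<tau>)) \<longlonglongrightarrow> LR Y (\<omega>, \<tau>)" using w(1,2) \<tau> by simp
      then have "LR Y (\<omega>, \<tau>) = bochner_integral G (X2.step_lim (\<omega>, \<tau>))"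
        using X2.step_sum_tendsto[OF z] by (rule LIMSEQ_unique)
      also have "\<dots> = bochner_integral G (W (\<omega>, \<tau>))"
        by (rule bochner_integral_cong_AE[OF W_AE_eq[OF X2.Z0_space[OF z]]])
      finally show "LL Y (\<omega>, \<tau>) = bochner_integral G (W (\<omega>, \<tau>))" using w(4) \<tau> by simp
    qed
  qed
qed

end

section \<open>Choice of the two functions and verification of the claims\<close>

theorem theorem2p3:
  fixes G :: "'g measure"
    and D1 :: "'a measure" and D2 :: "'b measure" and \<nu>1 :: "'b \<Rightarrow> 'a measure"
    and \<D> :: "('a \<times> 'b) measure"
    and P :: "'o measure" and F :: "real \<Rightarrow> 'o measure" and T :: real
    and \<P>' :: "('o \<times> real) measure"
    and TT :: "(real \<Rightarrow> 'f::banach) set"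
    and p q r :: real
    and g :: "'g \<Rightarrow> ('a \<times> 'b \<Rightarrow> 'e::banach)"
    and \<LL> :: "('a \<times> 'b \<Rightarrow> 'e) \<Rightarrow> ('o \<times> real \<Rightarrow> 'f)"
  assumes "finite_measure G" and "finite_measure D2"
    and "finite_kernel D2 D1 \<nu>1"
    and "(\<integral>\<^sup>+x. emeasure (\<nu>1 x) (space D1) \<partial>D2) < \<infinity>"
    and "subalgebra (D1 \<Otimes>\<^sub>M D2) \<D>"
    and "T > 0"
    and "complete_filtered_prob_space P F T"
    and "closed_path_subspace T TT"
    and "(\<lambda>(x, t). x t) \<in> borel_measurable
           (seminorm_borel (path_space T TT) \<Otimes>\<^sub>M restrict_space borel {0..T})"
    and "subalgebra (F T \<Otimes>\<^sub>M restrict_space borel {0..T}) \<P>'"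
    and "\<forall>A\<in>sets (F T). emeasure P A = 0 \<longrightarrow> A \<times> {0..T} \<in> sets \<P>'"
    and "p \<ge> 1" and "q \<ge> 1" and "r \<ge> 1"
    and "g \<in> elems (L1 G (Lpq p q D1 D2 \<nu>1 \<D> normed_type))"
    and \<LL>_continuous:
      "continuous_map (seminorm_topology (Lpq p q D1 D2 \<nu>1 \<D> normed_type))
         (seminorm_topology (Lr_process r P (F T) T \<P>' TT)) \<LL>"
    and \<LL>_linear:
      "\<forall>f1 \<in> elems (Lpq p q D1 D2 \<nu>1 \<D> normed_type).
       \<forall>f2 \<in> elems (Lpq p q D1 D2 \<nu>1 \<D> normed_type).
       \<forall>h \<in> elems (Lpq p q D1 D2 \<nu>1 \<D> normed_type). \<forall>a b.
         (AE x in restr_to_subalg (kernel_measure D1 D2 \<nu>1) \<D>.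
            h x = a *\<^sub>R f1 x + b *\<^sub>R f2 x) \<longrightarrow>
         (AE \<omega> in P. \<forall>t\<in>{0..T}.
            \<LL> h (\<omega>, t) = a *\<^sub>R \<LL> f1 (\<omega>, t) + b *\<^sub>R \<LL> f2 (\<omega>, t))"
  shows "\<exists>(X1 :: ('a \<times> 'b) \<times> 'g \<Rightarrow> 'e) (X2 :: ('o \<times> real) \<times> 'g \<Rightarrow> 'f).
    X1 \<in> borel_measurable (\<D> \<Otimes>\<^sub>M G) \<and>
    X2 \<in> borel_measurable ((F T \<Otimes>\<^sub>M restrict_space borel {0..T}) \<Otimes>\<^sub>M G) \<and>
    \<comment> \<open>(a)\<close>
    (\<forall>x \<in> space D1 \<times> space D2. (\<lambda>y. X1 (x, y)) \<in> elems (L1 G normed_type)) \<and>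
    (\<forall>z \<in> space P \<times> {0..T}. (\<lambda>y. X2 (z, y)) \<in> elems (L1 G normed_type)) \<and>
    \<comment> \<open>(b)\<close>
    (\<lambda>x y. X1 (x, y)) \<in> elems (Lpq p q D1 D2 \<nu>1 \<D> (L1 G normed_type)) \<and>
    \<comment> \<open>(c)\<close>
    (\<lambda>z y. X2 (z, y)) \<in> measurable \<P>' (seminorm_borel (L1 G normed_type)) \<and>
    \<comment> \<open>(d)\<close>
    (\<forall>y \<in> space G. (\<lambda>x. X1 (x, y)) \<in> elems (Lpq p q D1 D2 \<nu>1 \<D> normed_type)) \<and>
    \<comment> \<open>(e)\<close>
    (\<lambda>y x. X1 (x, y)) \<in> elems (L1 G (Lpq p q D1 D2 \<nu>1 \<D> normed_type)) \<and>
    \<comment> \<open>(f)\<close>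
    (AE y in G. AE x in restr_to_subalg (kernel_measure D1 D2 \<nu>1) \<D>. X1 (x, y) = g y x) \<and>
    \<comment> \<open>(g)\<close>
    (\<forall>y \<in> space G. (\<lambda>z. X2 (z, y)) \<in> elems (Lr_process r P (F T) T \<P>' TT)) \<and>
    \<comment> \<open>(h)\<close>
    (AE y in G. AE \<omega> in P. \<forall>t\<in>{0..T}. X2 ((\<omega>, t), y) = \<LL> (g y) (\<omega>, t)) \<and>
    \<comment> \<open>(i)\<close>
    (let Y = (\<lambda>x. bochner_integral G (\<lambda>y. X1 (x, y))) in
      Y \<in> elems (Lpq p q D1 D2 \<nu>1 \<D> normed_type) \<and>
      (AE \<omega> in P. \<forall>t\<in>{0..T}.
         \<LL> Y (\<omega>, t) = bochner_integral G (\<lambda>y. X2 ((\<omega>, t), y))))"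
proof -
  have fil: "complete_measure P" "subalgebra P (F T)" "null_sets P \<subseteq> sets (F T)"
    using assms(6,7) by (auto simp: complete_filtered_prob_space_def)
  interpret mixed_space p q D1 D2 \<nu>1 \<D>
    by (rule mixed_space.intro[OF assms(3,5,12,13)])
  interpret process_setup P "F T" T \<P>' TT r
    by (rule process_setup.intro[OF fil assms(8,10) _ assms(14)]) (use assms(11) in blast)
  interpret operator p q D1 D2 \<nu>1 \<D> P "F T" T \<P>' TT r \<LL>
    by unfold_locales (use \<LL>_continuous \<LL>_linear in blast)+
  obtain s where s: "\<And>n. simple_function G (s n)" "\<And>n y. y \<in> space G \<Longrightarrow> s n y \<in> elems Epq"
    "\<And>n y. y \<in> space G \<Longrightarrow> strongly_measurable \<D> (s n y)"
    "\<And>n. (\<integral>\<^sup>+y. nrm Epq (g y - s n y) \<partial>G) \<le> ennreal ((1 / 2) ^ n)"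
    by (rule step_approximation[OF assms(15)]) blast
  have g: "g \<in> measurable G (seminorm_borel Epq)" using assms(15) by (simp add: L1_def)
  interpret fubini_approx p q D1 D2 \<nu>1 \<D> P "F T" T \<P>' TT r \<LL> G g s
    by (intro fubini_approx.intro fubini_approx_axioms.intro) (fact operator_axioms assms(1) g s)+
  show ?thesis
  proof (intro exI[of _ "\<lambda>p. X1.step_lim (fst p) (snd p)"] exI[of _ "\<lambda>p. W (fst p) (snd p)"] conjI,
      unfold fst_conv snd_conv Let_def)
    show "(\<lambda>p. X1.step_lim (fst p) (snd p)) \<in> borel_measurable (\<D> \<Otimes>\<^sub>M G)"
      by (rule strongly_measurableD[OF X1.strongly_step_lim])
    show "(\<lambda>p. W (fst p) (snd p)) \<in> borel_measurable ((F T \<Otimes>\<^sub>M restrict_space borel {0..T}) \<Otimes>\<^sub>M G)"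
      by (rule strongly_measurableD[OF strongly_W])
    show "\<forall>x\<in>space D1 \<times> space D2. (\<lambda>y. X1.step_lim x y) \<in> elems (L1 G normed_type)"
      using X1.step_lim_L1 unfolding space_D by blast
    show "\<forall>z\<in>space P \<times> {0..T}. (\<lambda>y. W z y) \<in> elems (L1 G normed_type)"
      using W_L1 by blast
    show "(\<lambda>x y. X1.step_lim x y) \<in> elems (Lpq p q D1 D2 \<nu>1 \<D> (L1 G normed_type))"
      by (rule X1_mixed_elems)
    show "(\<lambda>z y. W z y) \<in> measurable \<P>' (seminorm_borel (L1 G normed_type))"
      by (rule W_measurable_L1)
    show "\<forall>y\<in>space G. (\<lambda>x. X1.step_lim x y) \<in> elems (Lpq p q D1 D2 \<nu>1 \<D> normed_type)"
      using X1_elems by blast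
    show "(\<lambda>y x. X1.step_lim x y) \<in> elems (L1 G (Lpq p q D1 D2 \<nu>1 \<D> normed_type))"
      by (rule X1_L1_elems)
    show "AE y in G. AE x in restr_to_subalg (kernel_measure D1 D2 \<nu>1) \<D>. X1.step_lim x y = g y x"
      using AE_G0 by eventually_elim (rule X1_AE_eq)
    show "\<forall>y\<in>space G. (\<lambda>z. W z y) \<in> elems (Lr_process r P (F T) T \<P>' TT)"
      using W_elems by blast
    show "AE y in G. AE \<omega> in P. \<forall>t\<in>{0..T}. W (\<omega>, t) y = \<LL> (g y) (\<omega>, t)"
      using AE_G0 by eventually_elim (rule W_eq_LL)
    show "(\<lambda>x. bochner_integral G (\<lambda>y. X1.step_lim x y)) \<in> elems (Lpq p q D1 D2 \<nu>1 \<D> normed_type) \<and>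
        (AE \<omega> in P. \<forall>t\<in>{0..T}. \<LL> (\<lambda>x. bochner_integral G (\<lambda>y. X1.step_lim x y)) (\<omega>, t) =
          bochner_integral G (\<lambda>y. W (\<omega>, t) y))"
      by (rule conjI[OF Y_elems LL_Y, unfolded Y_def[abs_def]])
  qed
qed

end
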